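(* Let $f\in A$ be a $\Delta$-homogeneous element and let $\mathcal G\subseteq A$ be a (possibly infinite) set of non-zero $\Delta$-homogeneous elements. Suppose the homogeneous subduction algorithm (described in the context) terminates on input $(f,\mathcal G)$, with output $\mathcal G'=\{f_1,\dots,f_k\}\subseteq\mathcal G$, $h\in K[X_1,\dots,X_k]$ (writing $X_i=X_{f_i}$) and $r\in A$. Then $\mathcal G'$ is a finite subset of $\mathcal G$ and all of the following hold: (1) $f=h(f_1,\dots,f_k)+r$; (2) for every $t\in\operatorname{Supp}(h)$ we have $v(t(f_1,\dots,f_k))\succeq v(f)$ and $\deg_\Delta(t(f_1,\dots,f_k))=\deg_\Delta(f)$; (3) either $h=0$ or $v(r)\succ v(f)$; (4) either $r=0$ or $r$ is $\Delta$-homogeneous with $\deg_\Delta(r)=\deg_\Delta(f)$; (5) either $r=0$ or $\operatorname{in}_v^\Delta(r)\notin\operatorname{in}_v^\Delta(\mathcal G)$.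
   Context: $K$ is a field; $A\le B$ are finitely generated commutative $K$-algebras and domains ($A$ a $K$-subalgebra of $B$). $(\Gamma,+,\succeq)$ is a linearly ordered abelian group (total order with $\gamma_1\succeq\gamma_2\Rightarrow\gamma_1+\gamma_3\succeq\gamma_2+\gamma_3$). $v:B\setminus\{0\}\to\Gamma$ is a valuation over $K$: $v(f+g)\succeq\min\{v(f),v(g)\}$ whenever $f,g,f+g\ne0$; $v(fg)=v(f)+v(g)$ for $f,g\neq 0$; $v(\lambda f)=v(f)$ for $0\ne\lambda\in K$, $f\neq0$. Convention: $v(0)=\infty$, larger than every element of $\Gamma$. For $\gamma\in\Gamma$ let $F_{v\succeq\gamma}=\{f\in B\setminus\{0\}\mid v(f)\succeq\gamma\}\cup\{0\}$, similarly $F_{v\succ\gamma}$, and $\operatorname{gr}_v(B)=\bigoplus_{\gamma\in\Gamma}F_{v\succeq\gamma}/F_{v\succ\gamma}$ (associated graded algebra). For $0\ne f\in B$ with $v(f)=\gamma$, $\operatorname{in}_v(f)$ is the class of $f$ in $F_{v\succeq\gamma}/F_{v\succ\gamma}$; $\operatorname{in}_v(0)=0$. $A$ is graded by a finitely generated abelian group $\Delta$, with degree function $\deg_\Delta$. For $\Delta$-homogeneous $0\neq f\in A$ of degree $\delta$ put $\operatorname{in}_v^\Delta(f)=\operatorname{in}_v(f)\otimes\delta\in\operatorname{gr}_v(B)\otimes_KK\Delta$, where $K\Delta$ is the group ring. For $S\subseteq A$, $\operatorname{in}_v^\Delta(S)\le\operatorname{gr}_v(B)\otimes_KK\Delta$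 is the $K$-subalgebra generated by all $\operatorname{in}_v^\Delta(f)$ with $0\ne f\in S$ $\Delta$-homogeneous. For a polynomial $h$, $\operatorname{Supp}(h)$ is the set of its non-zero terms (monomials together with their coefficients). Homogeneous subduction algorithm. Input: a $\Delta$-homogeneous $f\in A$ and a set $\mathcal G\subseteq A$ of (non-zero) $\Delta$-homogeneous elements. Polynomials live in $K[X_g\mid g\in\mathcal G]$, with one variable $X_g$ for each $g\in\mathcal G$. Initialize $\mathcal G'=\emptyset$, $h=0$, $r=f$. While $r\neq0$ and $\operatorname{in}_v^\Delta(r)\in\operatorname{in}_v^\Delta(\mathcal G)$: choose a finite subset $\{f_1,\dots,f_k\}\subseteq\mathcal G$ and a polynomial $h'\in K[X_{f_1},\dots,X_{f_k}]$ with $h'(\operatorname{in}_v^\Delta(f_1),\dots,\operatorname{in}_v^\Delta(f_k))=\operatorname{in}_v^\Delta(r)$ and with $v(t(f_1,\dots,f_k))\succeq v(r)$ and $\deg_\Delta(t(f_1,\dots,f_k))=\deg_\Delta(r)$ for every $t\in\operatorname{Supp}(h')$ (such a choice always exists; it is made by an arbitrary rule); then replace $\mathcal G'$ by $\mathcal G'\cup\{f_1,\dots,f_k\}$, $r$ by $r-h'(f_1,\dots,f_k)$, and $h$ by $h+h'$. When the loop ends, return $\mathcal G'$, $h$, $r$. *)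

theory Defs
  imports "HOL-Algebra.Generated_Groups" "HOL-Algebra.Subrings" "HOL-Algebra.QuotRing"
    "HOL-Algebra.Module" "HOL-Library.Multiset" "HOL-Library.Extended" "HOL.Hull"
begin

section \<open>Finitely generated algebras\<close>

definition subalg :: "('k, 'm) ring_scheme \<Rightarrow> ('k, 'b, 'n) module_scheme \<Rightarrow> 'b set \<Rightarrow> bool"
  where "subalg K B S \<longleftrightarrow> subring S B \<and> submodule S K B"

definition alg_gen :: "('k, 'm) ring_scheme \<Rightarrow> ('k, 'b, 'n) module_scheme \<Rightarrow> 'b set \<Rightarrow> 'b set"
  where "alg_gen K B S = subalg K B hull S"

definition fin_gen_alg :: "('k, 'm) ring_scheme \<Rightarrow> ('k, 'b, 'n) module_scheme \<Rightarrow> 'b set \<Rightarrow> bool"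
  where "fin_gen_alg K B A \<longleftrightarrow> (\<exists>S. finite S \<and> S \<subseteq> A \<and> A = alg_gen K B S)"


section \<open>Monoid algebras, polynomials\<close>

text \<open>The monoid algebra \<open>K[M]\<close>: finitely supported functions with the convolution product.
  Its three instances here are the group ring \<open>K\<Delta>\<close>, the polynomial ring (with \<open>M\<close> the monoid
  of monomials), and the ambient algebra in the construction of the tensor product.\<close>

definition monoid_algebra ::
    "('k, 'm) ring_scheme \<Rightarrow> ('x, 'n) monoid_scheme \<Rightarrow> ('k, 'x \<Rightarrow> 'k) module"
  where "monoid_algebra K M =
    \<lparr>carrier = {a. (\<forall>x. a x \<in> carrier K) \<and> (\<forall>x. x \<notin> carrier M \<longrightarrow> a x = \<zero>\<^bsub>K\<^esub>)
                   \<and> finite {x. a x \<noteq> \<zero>\<^bsub>K\<^esub>}},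
     monoid.mult = (\<lambda>a b z. \<Oplus>\<^bsub>K\<^esub>x \<in> {x. a x \<noteq> \<zero>\<^bsub>K\<^esub>}.
                        \<Oplus>\<^bsub>K\<^esub>y \<in> {y. b y \<noteq> \<zero>\<^bsub>K\<^esub> \<and> x \<otimes>\<^bsub>M\<^esub> y = z}. a x \<otimes>\<^bsub>K\<^esub> b y),
     one = (\<lambda>x. if x = \<one>\<^bsub>M\<^esub> then \<one>\<^bsub>K\<^esub> else \<zero>\<^bsub>K\<^esub>),
     zero = (\<lambda>x. \<zero>\<^bsub>K\<^esub>),
     add = (\<lambda>a b x. a x \<oplus>\<^bsub>K\<^esub> b x),
     smult = (\<lambda>c a x. c \<otimes>\<^bsub>K\<^esub> a x)\<rparr>"

definition single :: "('k, 'm) ring_scheme \<Rightarrow> 'k \<Rightarrow> 'x \<Rightarrow> 'x \<Rightarrow> 'k"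
  where "single K c m = (\<lambda>x. if x = m then c else \<zero>\<^bsub>K\<^esub>)"

text \<open>The polynomial ring with one variable \<open>X\<^sub>g\<close> for each \<open>g \<in> G\<close>; a monomial is the multiset
  of its variables.\<close>

definition monomials :: "'x set \<Rightarrow> 'x multiset monoid"
  where "monomials G = \<lparr>carrier = {m. set_mset m \<subseteq> G}, monoid.mult = (+), one = {#}\<rparr>"

definition mpoly_ring ::
    "('k, 'm) ring_scheme \<Rightarrow> 'x set \<Rightarrow> ('k, 'x multiset \<Rightarrow> 'k) module"
  where "mpoly_ring K G = monoid_algebra K (monomials G)"

text \<open>\<open>mpoly_eval K T u h\<close> is the value in the \<open>K\<close>-algebra \<open>T\<close> of \<open>h\<close> at \<open>X\<^sub>g = u g\<close>.\<close>

definition mpoly_eval ::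
    "('k, 'm) ring_scheme \<Rightarrow> ('k, 'c, 'n) module_scheme \<Rightarrow> ('x \<Rightarrow> 'c)
      \<Rightarrow> ('x multiset \<Rightarrow> 'k) \<Rightarrow> 'c"
  where "mpoly_eval K T u h =
    (\<Oplus>\<^bsub>T\<^esub>m \<in> {m. h m \<noteq> \<zero>\<^bsub>K\<^esub>}.
        h m \<odot>\<^bsub>T\<^esub> (\<Otimes>\<^bsub>T\<^esub>g \<in> set_mset m. u g [^]\<^bsub>T\<^esub> count m g))"

text \<open>Terms include their coefficients, and are themselves polynomials.\<close>

definition Supp :: "('k, 'm) ring_scheme \<Rightarrow> ('x multiset \<Rightarrow> 'k) \<Rightarrow> ('x multiset \<Rightarrow> 'k) set"
  where "Supp K h = {single K (h m) m |m. h m \<noteq> \<zero>\<^bsub>K\<^esub>}"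


section \<open>Tensor product of algebras\<close>

text \<open>The underlying module is the free \<open>K\<close>-module on \<open>carrier R \<times> carrier S\<close> modulo the
  bilinearity relations. Multiplying a relation by a basis element gives a relation
  again, so the ideal of the monoid algebra of \<open>R \<times>\<times> S\<close> generated by the relations is
  their \<open>K\<close>-span, and the quotient ring multiplies pure tensors componentwise.\<close>

definition tensor_relations ::
    "('k, 'm) ring_scheme \<Rightarrow> ('k, 'r, 'n) module_scheme \<Rightarrow> ('k, 's, 'p) module_scheme
      \<Rightarrow> ('r \<times> 's \<Rightarrow> 'k) set"
  where "tensor_relations K R S =
    (let F = monoid_algebra K (R \<times>\<times> S); e = (\<lambda>x y. single K \<one>\<^bsub>K\<^esub> (x, y)) in
      {e (x \<oplus>\<^bsub>R\<^esub> x') y \<ominus>\<^bsub>F\<^esub> (e x y \<oplus>\<^bsub>F\<^esub> e x' y) |x x' y.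
         x \<in> carrier R \<and> x' \<in> carrier R \<and> y \<in> carrier S}
    \<union> {e x (y \<oplus>\<^bsub>S\<^esub> y') \<ominus>\<^bsub>F\<^esub> (e x y \<oplus>\<^bsub>F\<^esub> e x y') |x y y'.
         x \<in> carrier R \<and> y \<in> carrier S \<and> y' \<in> carrier S}
    \<union> {e (c \<odot>\<^bsub>R\<^esub> x) y \<ominus>\<^bsub>F\<^esub> c \<odot>\<^bsub>F\<^esub> e x y |c x y.
         c \<in> carrier K \<and> x \<in> carrier R \<and> y \<in> carrier S}
    \<union> {e x (c \<odot>\<^bsub>S\<^esub> y) \<ominus>\<^bsub>F\<^esub> c \<odot>\<^bsub>F\<^esub> e x y |c x y.
         c \<in> carrier K \<and> x \<in> carrier R \<and> y \<in> carrier S})"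

definition tensor_ideal ::
    "('k, 'm) ring_scheme \<Rightarrow> ('k, 'r, 'n) module_scheme \<Rightarrow> ('k, 's, 'p) module_scheme
      \<Rightarrow> ('r \<times> 's \<Rightarrow> 'k) set"
  where "tensor_ideal K R S = Idl\<^bsub>monoid_algebra K (R \<times>\<times> S)\<^esub> (tensor_relations K R S)"

definition tensor_algebra ::
    "('k, 'm) ring_scheme \<Rightarrow> ('k, 'r, 'n) module_scheme \<Rightarrow> ('k, 's, 'p) module_scheme
      \<Rightarrow> ('k, ('r \<times> 's \<Rightarrow> 'k) set) module"
  where "tensor_algebra K R S =
    (let F = monoid_algebra K (R \<times>\<times> S); J = tensor_ideal K R S in
      ring.extend (F Quot J) (module.fields (\<lambda>c X. \<Union>x\<in>X. J +>\<^bsub>F\<^esub> (c \<odot>\<^bsub>F\<^esub> x))))"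

definition pure_tensor ::
    "('k, 'm) ring_scheme \<Rightarrow> ('k, 'r, 'n) module_scheme \<Rightarrow> ('k, 's, 'p) module_scheme
      \<Rightarrow> 'r \<Rightarrow> 's \<Rightarrow> ('r \<times> 's \<Rightarrow> 'k) set"
  where "pure_tensor K R S x y =
    tensor_ideal K R S +>\<^bsub>monoid_algebra K (R \<times>\<times> S)\<^esub> single K \<one>\<^bsub>K\<^esub> (x, y)"


section \<open>Valuations and the associated graded algebra\<close>

text \<open>The value of \<open>v\<close> at zero is irrelevant; \<open>xval\<close> implements the convention that it is \<open>\<infinity>\<close>.\<close>

definition valuation_over ::
    "('k, 'm) ring_scheme \<Rightarrow> ('k, 'b, 'n) module_scheme
      \<Rightarrow> ('b \<Rightarrow> 'g::linordered_ab_group_add) \<Rightarrow> bool"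
  where "valuation_over K B v \<longleftrightarrow>
    (\<forall>f \<in> carrier B - {\<zero>\<^bsub>B\<^esub>}. \<forall>g \<in> carrier B - {\<zero>\<^bsub>B\<^esub>}.
       f \<oplus>\<^bsub>B\<^esub> g \<noteq> \<zero>\<^bsub>B\<^esub> \<longrightarrow> min (v f) (v g) \<le> v (f \<oplus>\<^bsub>B\<^esub> g)) \<and>
    (\<forall>f \<in> carrier B - {\<zero>\<^bsub>B\<^esub>}. \<forall>g \<in> carrier B - {\<zero>\<^bsub>B\<^esub>}. v (f \<otimes>\<^bsub>B\<^esub> g) = v f + v g) \<and>
    (\<forall>c \<in> carrier K - {\<zero>\<^bsub>K\<^esub>}. \<forall>f \<in> carrier B - {\<zero>\<^bsub>B\<^esub>}. v (c \<odot>\<^bsub>B\<^esub> f) = v f)"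

definition xval :: "('b, 'n) ring_scheme \<Rightarrow> ('b \<Rightarrow> 'g) \<Rightarrow> 'b \<Rightarrow> 'g extended"
  where "xval B v f = (if f = \<zero>\<^bsub>B\<^esub> then \<infinity> else Fin (v f))"

definition filt_ge ::
    "('b, 'n) ring_scheme \<Rightarrow> ('b \<Rightarrow> 'g::linordered_ab_group_add) \<Rightarrow> 'g \<Rightarrow> 'b set"
  where "filt_ge B v \<gamma> = {f \<in> carrier B - {\<zero>\<^bsub>B\<^esub>}. \<gamma> \<le> v f} \<union> {\<zero>\<^bsub>B\<^esub>}"

definition filt_gt ::
    "('b, 'n) ring_scheme \<Rightarrow> ('b \<Rightarrow> 'g::linordered_ab_group_add) \<Rightarrow> 'g \<Rightarrow> 'b set"
  where "filt_gt B v \<gamma> = {f \<in> carrier B - {\<zero>\<^bsub>B\<^esub>}. \<gamma> < v f} \<union> {\<zero>\<^bsub>B\<^esub>}"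

text \<open>The additive quotient group of the two filtration steps, which, as always with
  \<^const>\<open>A_FactGroup\<close>, is a record with multiplicative notation.\<close>

definition gr_piece ::
    "('b, 'n) ring_scheme \<Rightarrow> ('b \<Rightarrow> 'g::linordered_ab_group_add) \<Rightarrow> 'g \<Rightarrow> 'b set monoid"
  where "gr_piece B v \<gamma> = (B\<lparr>carrier := filt_ge B v \<gamma>\<rparr>) A_Mod (filt_gt B v \<gamma>)"

text \<open>Elements of the direct sum are finitely supported families of cosets. The
  component in degree \<open>\<gamma>\<close> of a product is the sum over \<open>\<alpha>\<close> of the products of the
  components of degrees \<open>\<alpha>\<close> and \<open>\<gamma> - \<alpha>\<close>.\<close>

definition gr ::
    "('k, 'b, 'n) module_scheme \<Rightarrow> ('b \<Rightarrow> 'g::linordered_ab_group_add)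
      \<Rightarrow> ('k, 'g \<Rightarrow> 'b set) module"
  where "gr B v =
    \<lparr>carrier = {\<phi>. (\<forall>\<gamma>. \<phi> \<gamma> \<in> carrier (gr_piece B v \<gamma>)) \<and> finite {\<gamma>. \<phi> \<gamma> \<noteq> filt_gt B v \<gamma>}},
     monoid.mult = (\<lambda>\<phi> \<psi> \<gamma>. \<Otimes>\<^bsub>gr_piece B v \<gamma>\<^esub>\<alpha> \<in> {\<alpha>. \<phi> \<alpha> \<noteq> filt_gt B v \<alpha>}.
                        rcoset_mult B (filt_gt B v \<gamma>) (\<phi> \<alpha>) (\<psi> (\<gamma> - \<alpha>))),
     one = (\<lambda>\<gamma>. if \<gamma> = 0 then filt_gt B v \<gamma> +>\<^bsub>B\<^esub> \<one>\<^bsub>B\<^esub> else filt_gt B v \<gamma>),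
     zero = (\<lambda>\<gamma>. filt_gt B v \<gamma>),
     add = (\<lambda>\<phi> \<psi> \<gamma>. \<phi> \<gamma> \<otimes>\<^bsub>gr_piece B v \<gamma>\<^esub> \<psi> \<gamma>),
     smult = (\<lambda>c \<phi> \<gamma>. \<Union>x \<in> \<phi> \<gamma>. filt_gt B v \<gamma> +>\<^bsub>B\<^esub> (c \<odot>\<^bsub>B\<^esub> x))\<rparr>"

definition init_form ::
    "('k, 'b, 'n) module_scheme \<Rightarrow> ('b \<Rightarrow> 'g::linordered_ab_group_add) \<Rightarrow> 'b \<Rightarrow> 'g \<Rightarrow> 'b set"
  where "init_form B v f =
    (if f = \<zero>\<^bsub>B\<^esub> then \<zero>\<^bsub>gr B v\<^esub>
     else (\<lambda>\<gamma>. if \<gamma> = v f then filt_gt B v \<gamma> +>\<^bsub>B\<^esub> f else filt_gt B v \<gamma>))"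


section \<open>Gradings\<close>

text \<open>The grading group is a group of HOL-Algebra and hence written multiplicatively.
  \<open>\<A> \<delta>\<close> is the homogeneous component of degree \<open>\<delta>\<close>; zero counts as homogeneous.\<close>

definition alg_grading ::
    "('k, 'm) ring_scheme \<Rightarrow> ('k, 'b, 'n) module_scheme \<Rightarrow> 'b set \<Rightarrow> ('d, 'p) monoid_scheme
      \<Rightarrow> ('d \<Rightarrow> 'b set) \<Rightarrow> bool"
  where "alg_grading K B A \<Delta> \<A> \<longleftrightarrow>
    (\<forall>\<delta> \<in> carrier \<Delta>. submodule (\<A> \<delta>) K B \<and> \<A> \<delta> \<subseteq> A) \<and>
    (\<forall>\<delta> \<in> carrier \<Delta>. \<forall>\<epsilon> \<in> carrier \<Delta>. \<forall>f \<in> \<A> \<delta>. \<forall>g \<in> \<A> \<epsilon>. f \<otimes>\<^bsub>B\<^esub> g \<in> \<A> (\<delta> \<otimes>\<^bsub>\<Delta>\<^esub> \<epsilon>)) \<and>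
    (\<forall>f \<in> A. \<exists>!c. c \<in> (\<Pi>\<^sub>E \<delta> \<in> carrier \<Delta>. \<A> \<delta>) \<and> finite {\<delta> \<in> carrier \<Delta>. c \<delta> \<noteq> \<zero>\<^bsub>B\<^esub>}
       \<and> f = (\<Oplus>\<^bsub>B\<^esub>\<delta> \<in> {\<delta> \<in> carrier \<Delta>. c \<delta> \<noteq> \<zero>\<^bsub>B\<^esub>}. c \<delta>))"

definition homogeneous :: "('d, 'p) monoid_scheme \<Rightarrow> ('d \<Rightarrow> 'b set) \<Rightarrow> 'b \<Rightarrow> bool"
  where "homogeneous \<Delta> \<A> f \<longleftrightarrow> (\<exists>\<delta> \<in> carrier \<Delta>. f \<in> \<A> \<delta>)"

text \<open>Meaningful for non-zero homogeneous elements only.\<close>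

definition hdeg :: "('d, 'p) monoid_scheme \<Rightarrow> ('d \<Rightarrow> 'b set) \<Rightarrow> 'b \<Rightarrow> 'd"
  where "hdeg \<Delta> \<A> f = (THE \<delta>. \<delta> \<in> carrier \<Delta> \<and> f \<in> \<A> \<delta>)"

definition fin_gen_group :: "('d, 'p) monoid_scheme \<Rightarrow> bool"
  where "fin_gen_group \<Delta> \<longleftrightarrow> (\<exists>S. finite S \<and> S \<subseteq> carrier \<Delta> \<and> generate \<Delta> S = carrier \<Delta>)"


section \<open>Graded initial forms\<close>

definition gr_tensor ::
    "('k, 'm) ring_scheme \<Rightarrow> ('k, 'b, 'n) module_scheme \<Rightarrow> ('b \<Rightarrow> 'g::linordered_ab_group_add)
      \<Rightarrow> ('d, 'p) monoid_scheme \<Rightarrow> ('k, (('g \<Rightarrow> 'b set) \<times> ('d \<Rightarrow> 'k) \<Rightarrow> 'k) set) module"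
  where "gr_tensor K B v \<Delta> = tensor_algebra K (gr B v) (monoid_algebra K \<Delta>)"

definition init_deg ::
    "('k, 'm) ring_scheme \<Rightarrow> ('k, 'b, 'n) module_scheme \<Rightarrow> ('b \<Rightarrow> 'g::linordered_ab_group_add)
      \<Rightarrow> ('d, 'p) monoid_scheme \<Rightarrow> ('d \<Rightarrow> 'b set) \<Rightarrow> 'b
      \<Rightarrow> (('g \<Rightarrow> 'b set) \<times> ('d \<Rightarrow> 'k) \<Rightarrow> 'k) set"
  where "init_deg K B v \<Delta> \<A> f =
    pure_tensor K (gr B v) (monoid_algebra K \<Delta>) (init_form B v f) (single K \<one>\<^bsub>K\<^esub> (hdeg \<Delta> \<A> f))"

definition init_alg ::
    "('k, 'm) ring_scheme \<Rightarrow> ('k, 'b, 'n) module_scheme \<Rightarrow> ('b \<Rightarrow> 'g::linordered_ab_group_add)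
      \<Rightarrow> ('d, 'p) monoid_scheme \<Rightarrow> ('d \<Rightarrow> 'b set) \<Rightarrow> 'b set
      \<Rightarrow> (('g \<Rightarrow> 'b set) \<times> ('d \<Rightarrow> 'k) \<Rightarrow> 'k) set set"
  where "init_alg K B v \<Delta> \<A> S =
    alg_gen K (gr_tensor K B v \<Delta>)
      (init_deg K B v \<Delta> \<A> ` {f \<in> S. f \<noteq> \<zero>\<^bsub>B\<^esub> \<and> homogeneous \<Delta> \<A> f})"


section \<open>The homogeneous subduction algorithm\<close>

definition subduction_guard ::
    "('k, 'm) ring_scheme \<Rightarrow> ('k, 'b, 'n) module_scheme \<Rightarrow> ('b \<Rightarrow> 'g::linordered_ab_group_add)
      \<Rightarrow> ('d, 'p) monoid_scheme \<Rightarrow> ('d \<Rightarrow> 'b set) \<Rightarrow> 'b set \<Rightarrow> 'b \<Rightarrow> bool"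
  where "subduction_guard K B v \<Delta> \<A> G r \<longleftrightarrow>
    r \<noteq> \<zero>\<^bsub>B\<^esub> \<and> init_deg K B v \<Delta> \<A> r \<in> init_alg K B v \<Delta> \<A> G"

text \<open>One pass through the loop body, acting on states \<open>(\<G>', h, r)\<close>. The step is a relation, so
  the runs of the algorithm under all possible choice rules are its paths.\<close>

inductive subduction_step ::
    "('k, 'm) ring_scheme \<Rightarrow> ('k, 'b, 'n) module_scheme \<Rightarrow> ('b \<Rightarrow> 'g::linordered_ab_group_add)
      \<Rightarrow> ('d, 'p) monoid_scheme \<Rightarrow> ('d \<Rightarrow> 'b set) \<Rightarrow> 'b set
      \<Rightarrow> 'b set \<times> ('b multiset \<Rightarrow> 'k) \<times> 'b \<Rightarrow> 'b set \<times> ('b multiset \<Rightarrow> 'k) \<times> 'b \<Rightarrow> bool"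
  for K B v \<Delta> \<A> G
  where
    "\<lbrakk>subduction_guard K B v \<Delta> \<A> G r;
      finite F; F \<subseteq> G; h' \<in> carrier (mpoly_ring K F);
      mpoly_eval K (gr_tensor K B v \<Delta>) (init_deg K B v \<Delta> \<A>) h' = init_deg K B v \<Delta> \<A> r;
      \<forall>t \<in> Supp K h'. xval B v r \<le> xval B v (mpoly_eval K B (\<lambda>g. g) t)
                     \<and> hdeg \<Delta> \<A> (mpoly_eval K B (\<lambda>g. g) t) = hdeg \<Delta> \<A> r\<rbrakk>
    \<Longrightarrow> subduction_step K B v \<Delta> \<A> G (G', h, r)
          (G' \<union> F, h \<oplus>\<^bsub>mpoly_ring K G\<^esub> h', r \<ominus>\<^bsub>B\<^esub> mpoly_eval K B (\<lambda>g. g) h')"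

definition subduction_output ::
    "('k, 'm) ring_scheme \<Rightarrow> ('k, 'b, 'n) module_scheme \<Rightarrow> ('b \<Rightarrow> 'g::linordered_ab_group_add)
      \<Rightarrow> ('d, 'p) monoid_scheme \<Rightarrow> ('d \<Rightarrow> 'b set) \<Rightarrow> 'b \<Rightarrow> 'b set
      \<Rightarrow> 'b set \<Rightarrow> ('b multiset \<Rightarrow> 'k) \<Rightarrow> 'b \<Rightarrow> bool"
  where "subduction_output K B v \<Delta> \<A> f G G' h r \<longleftrightarrow>
    (subduction_step K B v \<Delta> \<A> G)\<^sup>*\<^sup>* ({}, \<zero>\<^bsub>mpoly_ring K G\<^esub>, f) (G', h, r) \<and>
    \<not> subduction_guard K B v \<Delta> \<A> G r"

end

theory Submission
  imports Defs
begin

text \<open>Everything rests on the claim that one pass through the loop strictly increases the value of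
  the remainder. Monomials in non-zero homogeneous elements are non-zero and homogeneous, and
  graded initial forms are multiplicative on them, so the equation
  \<open>h'(in(f\<^sub>1), \<dots>, in(f\<^sub>k)) = in(r)\<close> is a linear relation between the initial forms of the terms'
  monomials, all tensored with the same degree \<open>\<delta>\<close>. The bilinear map \<open>x \<otimes> y \<mapsto> y(\<delta>) x\<close> carries it to
  \<open>gr B v\<close>, and its component of degree \<open>v(r)\<close> says that \<open>r - h'(f\<^sub>1, \<dots>, f\<^sub>k)\<close> has value greater
  than \<open>v(r)\<close>. The properties of the output are then invariants of the loop.\<close>

text \<open>The monoid algebra, \<open>gr B v\<close> and the tensor algebra are bare records of
  operations, so before any calculation their ring axioms have to be established. The common tool is
  \<open>K\<close>-linear extension from the monoid basis of \<open>K[M]\<close>: it describes the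
  product of \<open>K[M]\<close>, polynomial evaluation, and maps out of the free module behind the
  tensor product.

  About the tensor product only one implication is needed: tensors that are equal have equal images
  under a bilinear map. Nothing about independence of pure tensors enters.

  Passing to the component of degree \<open>v r\<close> loses nothing because every term of
  \<open>h'\<close> has value at least \<open>v r\<close>: a term of larger value vanishes in that
  component and also lies in \<open>filt_gt B v (v r)\<close>.

  The empty monomial evaluates to 1, so 1 must be homogeneous of neutral degree. A grading in the
  sense of \<open>alg_grading\<close> does not say so; it is derived from the absence of zero
  divisors in \<open>B\<close>.\<close>

lemma (in comm_monoid) finprod_swap:
  assumes "finite X" "finite Y" "\<And>x y. x \<in> X \<Longrightarrow> y \<in> Y \<Longrightarrow> f x y \<in> carrier G"
  shows "(\<Otimes>x\<in>X. \<Otimes>y\<in>Y. f x y) = (\<Otimes>y\<in>Y. \<Otimes>x\<in>X. f x y)"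
  using assms(1,3)
proof (induction X)
  case (insert a X)
  have "(\<Otimes>x\<in>insert a X. \<Otimes>y\<in>Y. f x y) = (\<Otimes>y\<in>Y. f a y) \<otimes> (\<Otimes>x\<in>X. \<Otimes>y\<in>Y. f x y)"
    using insert by (intro finprod_insert) (auto intro!: finprod_closed)
  also have "\<dots> = (\<Otimes>y\<in>Y. f a y) \<otimes> (\<Otimes>y\<in>Y. \<Otimes>x\<in>X. f x y)"
    using insert by simp
  also have "\<dots> = (\<Otimes>y\<in>Y. f a y \<otimes> (\<Otimes>x\<in>X. f x y))"
    using insert by (intro finprod_multf [symmetric]) (auto intro!: finprod_closed)
  also have "\<dots> = (\<Otimes>y\<in>Y. \<Otimes>x\<in>insert a X. f x y)"
    using insert by (intro finprod_cong') (auto intro!: finprod_insert [symmetric] finprod_closed)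
  finally show ?case .
qed simp

lemma (in abelian_monoid) finsum_swap:
  assumes "finite X" "finite Y" "\<And>x y. x \<in> X \<Longrightarrow> y \<in> Y \<Longrightarrow> f x y \<in> carrier G"
  shows "(\<Oplus>x\<in>X. \<Oplus>y\<in>Y. f x y) = (\<Oplus>y\<in>Y. \<Oplus>x\<in>X. f x y)"
  using add.finprod_swap [OF assms(1,2)] assms(3) by simp

lemma (in abelian_monoid) finsum_superset:
  assumes "finite Y" "X \<subseteq> Y" "\<And>y. y \<in> Y - X \<Longrightarrow> f y = \<zero>" "f \<in> Y \<rightarrow> carrier G"
  shows "(\<Oplus>x\<in>X. f x) = (\<Oplus>x\<in>Y. f x)"
  using assms by (intro add.finprod_mono_neutral_cong_left) auto

lemma (in abelian_monoid) finsum_delta: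
  assumes "finite X" "a \<in> X" "f a \<in> carrier G"
  shows "(\<Oplus>x\<in>X. if a = x then f x else \<zero>) = f a"
proof -
  have "(\<Oplus>x\<in>{a}. if a = x then f x else \<zero>) = (\<Oplus>x\<in>X. if a = x then f x else \<zero>)"
    using assms by (intro finsum_superset) auto
  then show ?thesis using assms(3) by simp
qed

section \<open>Monoid algebras and linear extension\<close>

text \<open>The codomain is an arbitrary module, which allows three uses: with values in
  \<open>K\<close> it gives the coefficients of a product, with values in \<open>B\<close> it is
  polynomial evaluation, and applied to a bilinear map it is the induced map on the free module over
  pairs.\<close>

definition lin_ext ::
    "('k, 'm) ring_scheme \<Rightarrow> ('k, 'c, 'n) module_scheme \<Rightarrow> ('x \<Rightarrow> 'c) \<Rightarrow> ('x \<Rightarrow> 'k) \<Rightarrow> 'c"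
  where "lin_ext K N \<phi> a = (\<Oplus>\<^bsub>N\<^esub>x \<in> {x. a x \<noteq> \<zero>\<^bsub>K\<^esub>}. a x \<odot>\<^bsub>N\<^esub> \<phi> x)"

lemma monoid_algebra_simps:
  "carrier (monoid_algebra K M) = {a. (\<forall>x. a x \<in> carrier K) \<and>
     (\<forall>x. x \<notin> carrier M \<longrightarrow> a x = \<zero>\<^bsub>K\<^esub>) \<and> finite {x. a x \<noteq> \<zero>\<^bsub>K\<^esub>}}"
  "\<one>\<^bsub>monoid_algebra K M\<^esub> = single K \<one>\<^bsub>K\<^esub> \<one>\<^bsub>M\<^esub>"
  "\<zero>\<^bsub>monoid_algebra K M\<^esub> = (\<lambda>x. \<zero>\<^bsub>K\<^esub>)"
  "a \<oplus>\<^bsub>monoid_algebra K M\<^esub> b = (\<lambda>x. a x \<oplus>\<^bsub>K\<^esub> b x)"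
  "c \<odot>\<^bsub>monoid_algebra K M\<^esub> a = (\<lambda>x. c \<otimes>\<^bsub>K\<^esub> a x)"
  by (simp_all add: monoid_algebra_def single_def)

locale lin_extension = module K N + M: comm_monoid M
  for K (structure) and M and N

locale monoid_alg = cring K + M: comm_monoid M for K (structure) and M
begin

abbreviation "KM \<equiv> monoid_algebra K M"

text \<open>In the definition the inner index set varies with \<open>x\<close> and \<open>z\<close>.
  Moving that condition into the summand gives a sum over a fixed finite box, whose sides can be
  enlarged and whose two sums can be swapped.\<close>

lemma mult_eq:
  assumes "a \<in> carrier KM" "b \<in> carrier KM" "finite X" "finite Y"
    "{x. a x \<noteq> \<zero>} \<subseteq> X" "{x. b x \<noteq> \<zero>} \<subseteq> Y"
  shows "(a \<otimes>\<^bsub>KM\<^esub> b) z = (\<Oplus>x\<in>X. \<Oplus>y\<in>Y. if x \<otimes>\<^bsub>M\<^esub> y = z then a x \<otimes> b y else \<zero>)"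
proof -
  have ab: "a x \<in> carrier K" "b x \<in> carrier K" for x
    using assms by (auto simp: monoid_algebra_simps)
  have inner: "(\<Oplus>y\<in>{y. b y \<noteq> \<zero> \<and> x \<otimes>\<^bsub>M\<^esub> y = z}. a x \<otimes> b y)
      = (\<Oplus>y\<in>Y. if x \<otimes>\<^bsub>M\<^esub> y = z then a x \<otimes> b y else \<zero>)" for x
    using assms ab by (intro add.finprod_mono_neutral_cong_left) auto
  have "(a \<otimes>\<^bsub>KM\<^esub> b) z = (\<Oplus>x\<in>{x. a x \<noteq> \<zero>}. \<Oplus>y\<in>{y. b y \<noteq> \<zero> \<and> x \<otimes>\<^bsub>M\<^esub> y = z}. a x \<otimes> b y)"
    by (simp add: monoid_algebra_def)
  also have "\<dots> = (\<Oplus>x\<in>X. \<Oplus>y\<in>Y. if x \<otimes>\<^bsub>M\<^esub> y = z then a x \<otimes> b y else \<zero>)"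
    unfolding inner using assms ab
    by (intro finsum_superset) (auto intro!: finsum_closed add.finprod_one_eqI)
  finally show ?thesis .
qed

lemma mem_carrierD:
  assumes "a \<in> carrier KM"
  shows "a x \<in> carrier K" "finite {x. a x \<noteq> \<zero>}" "{x. a x \<noteq> \<zero>} \<subseteq> carrier M"
  using assms by (auto simp: monoid_algebra_simps)

lemma mem_carrierI:
  assumes "\<And>x. a x \<in> carrier K" "finite X" "X \<subseteq> carrier M" "\<And>x. x \<notin> X \<Longrightarrow> a x = \<zero>"
  shows "a \<in> carrier KM"
proof -
  have "{x. a x \<noteq> \<zero>} \<subseteq> X" using assms(4) by auto
  then show ?thesis using assms by (auto simp: monoid_algebra_simps intro: finite_subset)
qed

lemma single_closed [simp, intro]:
  "c \<in> carrier K \<Longrightarrow> m \<in> carrier M \<Longrightarrow> single K c m \<in> carrier KM"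
  by (rule mem_carrierI [where X = "{m}"]) (auto simp: single_def)

lemma mult_outside:
  assumes a: "a \<in> carrier KM" and b: "b \<in> carrier KM"
    and z: "z \<notin> (\<lambda>(x, y). x \<otimes>\<^bsub>M\<^esub> y) ` ({x. a x \<noteq> \<zero>} \<times> {y. b y \<noteq> \<zero>})"
  shows "(a \<otimes>\<^bsub>KM\<^esub> b) z = \<zero>"
  unfolding mult_eq [OF a b mem_carrierD(2) [OF a] mem_carrierD(2) [OF b] order.refl order.refl]
  using z by (auto intro!: add.finprod_one_eqI)

lemma mult_closed:
  assumes a: "a \<in> carrier KM" and b: "b \<in> carrier KM"
  shows "a \<otimes>\<^bsub>KM\<^esub> b \<in> carrier KM"
proof (rule mem_carrierI [where X = "(\<lambda>(x, y). x \<otimes>\<^bsub>M\<^esub> y) ` ({x. a x \<noteq> \<zero>} \<times> {y. b y \<noteq> \<zero>})"])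
  note meq = mult_eq [OF a b mem_carrierD(2) [OF a] mem_carrierD(2) [OF b] order.refl order.refl]
  show "(a \<otimes>\<^bsub>KM\<^esub> b) z \<in> carrier K" for z
    unfolding meq using mem_carrierD(1) [OF a] mem_carrierD(1) [OF b]
    by (auto intro!: finsum_closed)
  show "(a \<otimes>\<^bsub>KM\<^esub> b) z = \<zero>"
    if "z \<notin> (\<lambda>(x, y). x \<otimes>\<^bsub>M\<^esub> y) ` ({x. a x \<noteq> \<zero>} \<times> {y. b y \<noteq> \<zero>})" for z
    using mult_outside [OF a b that] .
qed (use mem_carrierD [OF a] mem_carrierD [OF b] in auto)

lemma add_closed: "a \<in> carrier KM \<Longrightarrow> b \<in> carrier KM \<Longrightarrow> a \<oplus>\<^bsub>KM\<^esub> b \<in> carrier KM"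
  by (rule mem_carrierI [where X = "{x. a x \<noteq> \<zero>} \<union> {x. b x \<noteq> \<zero>}"])
    (auto simp: monoid_algebra_simps)

lemma KM_smult_closed: "c \<in> carrier K \<Longrightarrow> a \<in> carrier KM \<Longrightarrow> c \<odot>\<^bsub>KM\<^esub> a \<in> carrier KM"
  by (rule mem_carrierI [where X = "{x. a x \<noteq> \<zero>}"]) (auto simp: monoid_algebra_simps)

lemma abelian_group_KM: "abelian_group KM"
proof (rule abelian_groupI)
  fix a assume a: "a \<in> carrier KM"
  have "(\<lambda>x. \<ominus> a x) \<in> carrier KM"
    using a by (intro mem_carrierI [where X = "{x. a x \<noteq> \<zero>}"]) (auto simp: monoid_algebra_simps)
  moreover have "(\<lambda>x. \<ominus> a x) \<oplus>\<^bsub>KM\<^esub> a = \<zero>\<^bsub>KM\<^esub>"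
    using a by (auto simp: monoid_algebra_simps l_neg)
  ultimately show "\<exists>y\<in>carrier KM. y \<oplus>\<^bsub>KM\<^esub> a = \<zero>\<^bsub>KM\<^esub>" by blast
qed (use add_closed in \<open>auto simp: monoid_algebra_simps a_assoc a_comm a_lcomm\<close>)

end

context lin_extension
begin

sublocale monoid_alg K M ..

text \<open>The freedom to enlarge the support lets several elements be summed over a common index
  set.\<close>

lemma lin_ext_eq:
  assumes "a \<in> carrier KM" "\<phi> \<in> carrier M \<rightarrow> carrier N" "finite X" "X \<subseteq> carrier M"
    "{x. a x \<noteq> \<zero>} \<subseteq> X"
  shows "lin_ext K N \<phi> a = (\<Oplus>\<^bsub>N\<^esub>x\<in>X. a x \<odot>\<^bsub>N\<^esub> \<phi> x)"
proof -
  have "\<phi> x \<in> carrier N" if "x \<in> X" for x using that assms by blast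
  then show ?thesis unfolding lin_ext_def using assms mem_carrierD
    by (intro M.finsum_superset) auto
qed

lemma lin_ext_closed:
  assumes "a \<in> carrier KM" "\<phi> \<in> carrier M \<rightarrow> carrier N"
  shows "lin_ext K N \<phi> a \<in> carrier N"
  unfolding lin_ext_def using assms mem_carrierD(1,3)[OF assms(1)]
  by (auto intro!: M.finsum_closed smult_closed)

lemma lin_ext_zero: "lin_ext K N \<phi> \<zero>\<^bsub>KM\<^esub> = \<zero>\<^bsub>N\<^esub>"
  by (simp add: lin_ext_def monoid_algebra_simps)

lemma lin_ext_single:
  assumes "c \<in> carrier K" "m \<in> carrier M" "\<phi> \<in> carrier M \<rightarrow> carrier N"
  shows "lin_ext K N \<phi> (single K c m) = c \<odot>\<^bsub>N\<^esub> \<phi> m"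
proof -
  have "lin_ext K N \<phi> (single K c m) = (\<Oplus>\<^bsub>N\<^esub>x\<in>{m}. single K c m x \<odot>\<^bsub>N\<^esub> \<phi> x)"
    using assms by (intro lin_ext_eq single_closed) (auto simp: single_def)
  then show ?thesis using assms by (simp add: single_def Pi_iff)
qed

lemma lin_ext_add:
  assumes a: "a \<in> carrier KM" and b: "b \<in> carrier KM" and \<phi>: "\<phi> \<in> carrier M \<rightarrow> carrier N"
  shows "lin_ext K N \<phi> (a \<oplus>\<^bsub>KM\<^esub> b) = lin_ext K N \<phi> a \<oplus>\<^bsub>N\<^esub> lin_ext K N \<phi> b"
proof -
  let ?X = "{x. a x \<noteq> \<zero>} \<union> {x. b x \<noteq> \<zero>}"
  have X: "finite ?X" "?X \<subseteq> carrier M" using mem_carrierD [OF a] mem_carrierD [OF b] by auto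
  have \<phi>X: "\<phi> x \<in> carrier N" if "x \<in> ?X" for x using that X \<phi> by blast
  have "lin_ext K N \<phi> (a \<oplus>\<^bsub>KM\<^esub> b) = (\<Oplus>\<^bsub>N\<^esub>x\<in>?X. (a \<oplus>\<^bsub>KM\<^esub> b) x \<odot>\<^bsub>N\<^esub> \<phi> x)"
    using a b by (intro lin_ext_eq add_closed \<phi> X) (auto simp: monoid_algebra_simps)
  also have "\<dots> = (\<Oplus>\<^bsub>N\<^esub>x\<in>?X. a x \<odot>\<^bsub>N\<^esub> \<phi> x \<oplus>\<^bsub>N\<^esub> b x \<odot>\<^bsub>N\<^esub> \<phi> x)"
    using \<phi>X mem_carrierD(1) [OF a] mem_carrierD(1) [OF b]
    by (intro M.finsum_cong') (auto simp: monoid_algebra_simps smult_l_distr)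
  also have "\<dots> = (\<Oplus>\<^bsub>N\<^esub>x\<in>?X. a x \<odot>\<^bsub>N\<^esub> \<phi> x) \<oplus>\<^bsub>N\<^esub> (\<Oplus>\<^bsub>N\<^esub>x\<in>?X. b x \<odot>\<^bsub>N\<^esub> \<phi> x)"
    using \<phi>X mem_carrierD(1) [OF a] mem_carrierD(1) [OF b] by (intro M.finsum_addf) auto
  also have "\<dots> = lin_ext K N \<phi> a \<oplus>\<^bsub>N\<^esub> lin_ext K N \<phi> b"
    using a b \<phi> X by (simp add: lin_ext_eq [where X = ?X])
  finally show ?thesis .
qed

lemma lin_ext_smult:
  assumes c: "c \<in> carrier K" and a: "a \<in> carrier KM" and \<phi>: "\<phi> \<in> carrier M \<rightarrow> carrier N"
  shows "lin_ext K N \<phi> (c \<odot>\<^bsub>KM\<^esub> a) = c \<odot>\<^bsub>N\<^esub> lin_ext K N \<phi> a"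
proof -
  let ?X = "{x. a x \<noteq> \<zero>}"
  have X: "finite ?X" "?X \<subseteq> carrier M" using mem_carrierD [OF a] by auto
  have \<phi>X: "\<phi> x \<in> carrier N" if "x \<in> ?X" for x using that X \<phi> by blast
  have "lin_ext K N \<phi> (c \<odot>\<^bsub>KM\<^esub> a) = (\<Oplus>\<^bsub>N\<^esub>x\<in>?X. (c \<odot>\<^bsub>KM\<^esub> a) x \<odot>\<^bsub>N\<^esub> \<phi> x)"
    using a c by (intro lin_ext_eq KM_smult_closed \<phi> X) (auto simp: monoid_algebra_simps)
  also have "\<dots> = (\<Oplus>\<^bsub>N\<^esub>x\<in>?X. c \<odot>\<^bsub>N\<^esub> (a x \<odot>\<^bsub>N\<^esub> \<phi> x))"
    using \<phi>X mem_carrierD(1) [OF a] c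
    by (intro M.finsum_cong') (auto simp: monoid_algebra_simps smult_assoc1)
  also have "\<dots> = c \<odot>\<^bsub>N\<^esub> lin_ext K N \<phi> a"
    unfolding lin_ext_def using \<phi>X mem_carrierD(1) [OF a] c X
    by (intro finsum_smult_ldistr [symmetric]) auto
  finally show ?thesis .
qed

text \<open>Both sides are the double sum of \<open>a x\<close> times \<open>b y\<close> times the
  value of \<phi> at the product of \<open>x\<close> and \<open>y\<close>; the left side groups the
  pairs by their product. No multiplicativity of \<phi> is involved, so multiplying by an element
  amounts to averaging over translates of \<phi>. This drives both associativity and the ideal
  property used for tensor products.\<close>

lemma lin_ext_mult:
  assumes a: "a \<in> carrier KM" and b: "b \<in> carrier KM" and \<phi>: "\<phi> \<in> carrier M \<rightarrow> carrier N"
  shows "lin_ext K N \<phi> (a \<otimes>\<^bsub>KM\<^esub> b)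
    = lin_ext K N (\<lambda>x. lin_ext K N (\<lambda>y. \<phi> (x \<otimes>\<^bsub>M\<^esub> y)) b) a"
proof -
  let ?X = "{x. a x \<noteq> \<zero>}" and ?Y = "{x. b x \<noteq> \<zero>}"
  let ?Z = "(\<lambda>(x, y). x \<otimes>\<^bsub>M\<^esub> y) ` (?X \<times> ?Y)"
  have X: "finite ?X" "?X \<subseteq> carrier M" using mem_carrierD [OF a] by auto
  have Y: "finite ?Y" "?Y \<subseteq> carrier M" using mem_carrierD [OF b] by auto
  have Z: "finite ?Z" "?Z \<subseteq> carrier M" using X Y by auto
  have ab: "a x \<in> carrier K" "b x \<in> carrier K" for x
    using mem_carrierD(1) a b by auto
  have \<phi>Z: "\<phi> z \<in> carrier N" if "z \<in> ?Z" for z using that Z \<phi> by blast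
  have \<phi>XY: "\<phi> (x \<otimes>\<^bsub>M\<^esub> y) \<in> carrier N" if "x \<in> ?X" "y \<in> ?Y" for x y
    using that \<phi>Z by blast
  let ?t = "\<lambda>z x y. if x \<otimes>\<^bsub>M\<^esub> y = z then a x \<otimes> b y else \<zero>"
  note meq = mult_eq [OF a b X(1) Y(1) order.refl order.refl]
  have sum_smult: "(\<Oplus>x\<in>W. g x) \<odot>\<^bsub>N\<^esub> n = (\<Oplus>\<^bsub>N\<^esub>x\<in>W. g x \<odot>\<^bsub>N\<^esub> n)"
    if "finite W" "g \<in> W \<rightarrow> carrier K" "n \<in> carrier N" for W n g
    using that by (induction W) (auto simp: smult_l_distr Pi_iff)
  have "lin_ext K N \<phi> (a \<otimes>\<^bsub>KM\<^esub> b) = (\<Oplus>\<^bsub>N\<^esub>z\<in>?Z. (a \<otimes>\<^bsub>KM\<^esub> b) z \<odot>\<^bsub>N\<^esub> \<phi> z)"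
  proof (intro lin_ext_eq mult_closed a b \<phi> Z subsetI)
    fix z assume "z \<in> {z. (a \<otimes>\<^bsub>KM\<^esub> b) z \<noteq> \<zero>}"
    then show "z \<in> ?Z" using mult_outside [OF a b, of z] by blast
  qed
  \<comment> \<open>The product \<open>z\<close> becomes a third summation variable guarded by an
    indicator. Once the sum over \<open>z\<close> is innermost, the indicator leaves exactly one
    summand.\<close>
  also have "\<dots> = (\<Oplus>\<^bsub>N\<^esub>z\<in>?Z. \<Oplus>\<^bsub>N\<^esub>x\<in>?X. \<Oplus>\<^bsub>N\<^esub>y\<in>?Y. ?t z x y \<odot>\<^bsub>N\<^esub> \<phi> z)"
  proof (intro M.finsum_cong' refl)
    fix z assume z: "z \<in> ?Z"
    have "(a \<otimes>\<^bsub>KM\<^esub> b) z \<odot>\<^bsub>N\<^esub> \<phi> z = (\<Oplus>\<^bsub>N\<^esub>x\<in>?X. (\<Oplus>y\<in>?Y. ?t z x y) \<odot>\<^bsub>N\<^esub> \<phi> z)"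
      unfolding meq using X Y ab \<phi>Z [OF z] by (intro sum_smult) (auto intro!: finsum_closed)
    also have "\<dots> = (\<Oplus>\<^bsub>N\<^esub>x\<in>?X. \<Oplus>\<^bsub>N\<^esub>y\<in>?Y. ?t z x y \<odot>\<^bsub>N\<^esub> \<phi> z)"
      using X Y ab \<phi>Z [OF z]
      by (intro M.finsum_cong' refl sum_smult) (auto intro!: M.finsum_closed finsum_closed)
    finally show "(a \<otimes>\<^bsub>KM\<^esub> b) z \<odot>\<^bsub>N\<^esub> \<phi> z = (\<Oplus>\<^bsub>N\<^esub>x\<in>?X. \<Oplus>\<^bsub>N\<^esub>y\<in>?Y. ?t z x y \<odot>\<^bsub>N\<^esub> \<phi> z)" .
  qed (use X Y ab \<phi>Z in \<open>auto intro!: M.finsum_closed\<close>)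
  also have "\<dots> = (\<Oplus>\<^bsub>N\<^esub>x\<in>?X. \<Oplus>\<^bsub>N\<^esub>z\<in>?Z. \<Oplus>\<^bsub>N\<^esub>y\<in>?Y. ?t z x y \<odot>\<^bsub>N\<^esub> \<phi> z)"
    using X Y Z ab \<phi>Z by (intro M.finsum_swap) (auto intro!: M.finsum_closed)
  also have "\<dots> = (\<Oplus>\<^bsub>N\<^esub>x\<in>?X. \<Oplus>\<^bsub>N\<^esub>y\<in>?Y. \<Oplus>\<^bsub>N\<^esub>z\<in>?Z. ?t z x y \<odot>\<^bsub>N\<^esub> \<phi> z)"
    using X Y Z ab \<phi>Z by (intro M.finsum_cong' refl M.finsum_swap) (auto intro!: M.finsum_closed)
  also have "\<dots> = (\<Oplus>\<^bsub>N\<^esub>x\<in>?X. \<Oplus>\<^bsub>N\<^esub>y\<in>?Y. a x \<odot>\<^bsub>N\<^esub> (b y \<odot>\<^bsub>N\<^esub> \<phi> (x \<otimes>\<^bsub>M\<^esub> y)))"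
  proof (intro M.finsum_cong' refl)
    fix x y assume xy: "x \<in> ?X" "y \<in> ?Y"
    have "(\<Oplus>\<^bsub>N\<^esub>z\<in>?Z. ?t z x y \<odot>\<^bsub>N\<^esub> \<phi> z)
      = (\<Oplus>\<^bsub>N\<^esub>z\<in>?Z. if x \<otimes>\<^bsub>M\<^esub> y = z then (a x \<otimes> b y) \<odot>\<^bsub>N\<^esub> \<phi> z else \<zero>\<^bsub>N\<^esub>)"
      using ab \<phi>Z by (intro M.finsum_cong' refl) (auto simp del: image_iff)
    also have "\<dots> = (a x \<otimes> b y) \<odot>\<^bsub>N\<^esub> \<phi> (x \<otimes>\<^bsub>M\<^esub> y)"
      using ab \<phi>XY xy Z by (intro M.finsum_delta) auto
    also have "\<dots> = a x \<odot>\<^bsub>N\<^esub> (b y \<odot>\<^bsub>N\<^esub> \<phi> (x \<otimes>\<^bsub>M\<^esub> y))"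
      using ab \<phi>XY xy by (intro smult_assoc1) auto
    finally show "(\<Oplus>\<^bsub>N\<^esub>z\<in>?Z. ?t z x y \<odot>\<^bsub>N\<^esub> \<phi> z) = a x \<odot>\<^bsub>N\<^esub> (b y \<odot>\<^bsub>N\<^esub> \<phi> (x \<otimes>\<^bsub>M\<^esub> y))" .
  qed (use ab \<phi>XY in \<open>auto intro!: M.finsum_closed\<close>)
  also have "\<dots> = (\<Oplus>\<^bsub>N\<^esub>x\<in>?X. a x \<odot>\<^bsub>N\<^esub> lin_ext K N (\<lambda>y. \<phi> (x \<otimes>\<^bsub>M\<^esub> y)) b)"
    unfolding lin_ext_def using ab \<phi>XY Y
    by (intro M.finsum_cong' refl finsum_smult_ldistr [symmetric]) (auto intro!: M.finsum_closed)
  finally show ?thesis unfolding lin_ext_def [of K N _ a] .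
qed

end

section \<open>Ring axioms of the monoid algebra\<close>

definition self_module :: "('k, 'm) ring_scheme \<Rightarrow> ('k, 'k) module"
  where "self_module K = \<lparr>carrier = carrier K, monoid.mult = monoid.mult K, one = \<one>\<^bsub>K\<^esub>, zero = \<zero>\<^bsub>K\<^esub>,
     add = add K, smult = monoid.mult K\<rparr>"

lemma (in cring) module_self: "module R (self_module R)"
proof (rule moduleI)
  show "abelian_group (self_module R)"
    by (rule abelian_groupI) (auto simp: self_module_def a_assoc a_comm a_lcomm intro: exI l_neg)
qed (auto simp: self_module_def l_distr r_distr m_assoc a_lcomm is_cring)

context monoid_alg
begin

lemma lin_extension_self: "lin_extension K M (self_module K)"
  by (intro lin_extension.intro module_self M.comm_monoid_axioms)

lemma finsum_self: "f \<in> X \<rightarrow> carrier K \<Longrightarrow> finsum (self_module K) f X = finsum K f X"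
proof (induction X rule: infinite_finite_induct)
  case (infinite X)
  then show ?case by (simp add: finsum_def finprod_def self_module_def)
next
  case empty
  then show ?case by (simp add: finsum_def finprod_def self_module_def)
next
  case (insert x X)
  interpret N: module K "self_module K" by (rule module_self)
  have eq: "carrier (self_module K) = carrier K" "add (self_module K) = add K"
    by (simp_all add: self_module_def)
  show ?case using insert
    by (subst N.finsum_insert, simp, simp, simp add: eq Pi_iff, simp add: eq Pi_iff)
      (simp add: Pi_iff eq)
qed

text \<open>A coefficient of the product is the bilinear extension of the indicator of products
  equal to \<open>z\<close>. Repackaging \<open>K\<close> as the module \<open>self_module K\<close>
  brings this under \<open>lin_ext\<close>, so distributivity, associativity and compatibility with
  scalars become instances of its linearity and product rules.\<close>

lemma mult_eq_lin_ext:
  assumes a: "a \<in> carrier KM" and b: "b \<in> carrier KM"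
  shows "(a \<otimes>\<^bsub>KM\<^esub> b) z = lin_ext K (self_module K)
    (\<lambda>x. lin_ext K (self_module K) (\<lambda>y. if x \<otimes>\<^bsub>M\<^esub> y = z then \<one> else \<zero>) b) a"
proof -
  have [simp]: "\<And>u w. u \<odot>\<^bsub>self_module K\<^esub> w = u \<otimes> w" "carrier (self_module K) = carrier K"
    by (simp_all add: self_module_def)
  have ab: "a x \<in> carrier K" "b x \<in> carrier K" for x
    using mem_carrierD(1) a b by auto
  have 1: "lin_ext K (self_module K) (\<lambda>y. if x \<otimes>\<^bsub>M\<^esub> y = z then \<one> else \<zero>) b
     = (\<Oplus>y\<in>{y. b y \<noteq> \<zero>}. if x \<otimes>\<^bsub>M\<^esub> y = z then b y else \<zero>)" for x
    unfolding lin_ext_def using ab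
    by (subst finsum_self) (auto intro!: finsum_cong')
  show ?thesis
    unfolding mult_eq [OF a b mem_carrierD(2) [OF a] mem_carrierD(2) [OF b] order.refl order.refl]
      1 lin_ext_def [of K _ _ a]
    using ab mem_carrierD(2) [OF b]
    by (subst finsum_self)
      (auto intro!: finsum_cong' finsum_closed simp: finsum_rdistr intro!: finsum_cong')
qed

end

lemma (in lin_extension) lin_ext_cong:
  assumes "a \<in> carrier KM" "\<psi> \<in> carrier M \<rightarrow> carrier N" "\<And>x. x \<in> carrier M \<Longrightarrow> \<phi> x = \<psi> x"
  shows "lin_ext K N \<phi> a = lin_ext K N \<psi> a"
proof -
  have "\<psi> x \<in> carrier N" "\<phi> x = \<psi> x" if "a x \<noteq> \<zero>" for x
    using that assms mem_carrierD(3) [OF assms(1)] by blast+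
  then show ?thesis
    unfolding lin_ext_def using mem_carrierD [OF assms(1)] by (intro M.finsum_cong') auto
qed

context monoid_alg
begin

text \<open>At \<open>z\<close>, each bracketing is the trilinear extension of the indicator of
  triples with product \<open>z\<close>. Two uses of \<open>lin_ext_mult\<close> reach this form,
  and associativity of \<open>M\<close> identifies the indicators.\<close>

lemma mult_assoc:
  assumes a: "a \<in> carrier KM" and b: "b \<in> carrier KM" and c: "c \<in> carrier KM"
  shows "a \<otimes>\<^bsub>KM\<^esub> b \<otimes>\<^bsub>KM\<^esub> c = a \<otimes>\<^bsub>KM\<^esub> (b \<otimes>\<^bsub>KM\<^esub> c)"
proof
  fix z :: 'c
  interpret L: lin_extension K M "self_module K" by (rule lin_extension_self)
  let ?N = "self_module K"
  let ?e = "\<lambda>x. if x = z then \<one> else \<zero>"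
  have [simp]: "carrier ?N = carrier K" by (simp add: self_module_def)
  have cl: "lin_ext K ?N (\<lambda>y. ?e (g y)) d \<in> carrier K" if "d \<in> carrier KM" for d g
    using L.lin_ext_closed [OF that, of "\<lambda>y. ?e (g y)"] by auto
  have "(a \<otimes>\<^bsub>KM\<^esub> b \<otimes>\<^bsub>KM\<^esub> c) z = lin_ext K ?N (\<lambda>x. lin_ext K ?N (\<lambda>y. ?e (x \<otimes>\<^bsub>M\<^esub> y)) c) (a \<otimes>\<^bsub>KM\<^esub> b)"
    by (intro mult_eq_lin_ext mult_closed a b c)
  also have "\<dots> = lin_ext K ?N (\<lambda>x. lin_ext K ?N (\<lambda>x'. lin_ext K ?N (\<lambda>y. ?e (x \<otimes>\<^bsub>M\<^esub> x' \<otimes>\<^bsub>M\<^esub> y)) c) b) a"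
    using cl c by (intro L.lin_ext_mult a b) auto
  also have "\<dots> = lin_ext K ?N (\<lambda>x. lin_ext K ?N (\<lambda>u. ?e (x \<otimes>\<^bsub>M\<^esub> u)) (b \<otimes>\<^bsub>KM\<^esub> c)) a"
  proof (intro L.lin_ext_cong a)
    show "(\<lambda>x. lin_ext K ?N (\<lambda>u. ?e (x \<otimes>\<^bsub>M\<^esub> u)) (b \<otimes>\<^bsub>KM\<^esub> c)) \<in> carrier M \<rightarrow> carrier ?N"
      using cl mult_closed [OF b c] by auto
  next
    fix x assume x: "x \<in> carrier M"
    have "lin_ext K ?N (\<lambda>u. ?e (x \<otimes>\<^bsub>M\<^esub> u)) (b \<otimes>\<^bsub>KM\<^esub> c)
      = lin_ext K ?N (\<lambda>x'. lin_ext K ?N (\<lambda>y. ?e (x \<otimes>\<^bsub>M\<^esub> (x' \<otimes>\<^bsub>M\<^esub> y))) c) b"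
      by (intro L.lin_ext_mult b c) auto
    also have "\<dots> = lin_ext K ?N (\<lambda>x'. lin_ext K ?N (\<lambda>y. ?e (x \<otimes>\<^bsub>M\<^esub> x' \<otimes>\<^bsub>M\<^esub> y)) c) b"
      using x cl c by (intro L.lin_ext_cong b c) (auto simp: M.m_assoc)
    finally show "lin_ext K ?N (\<lambda>x'. lin_ext K ?N (\<lambda>y. ?e (x \<otimes>\<^bsub>M\<^esub> x' \<otimes>\<^bsub>M\<^esub> y)) c) b
      = lin_ext K ?N (\<lambda>u. ?e (x \<otimes>\<^bsub>M\<^esub> u)) (b \<otimes>\<^bsub>KM\<^esub> c)" ..
  qed
  also have "\<dots> = (a \<otimes>\<^bsub>KM\<^esub> (b \<otimes>\<^bsub>KM\<^esub> c)) z"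
    by (intro mult_eq_lin_ext [symmetric] mult_closed a b c)
  finally show "(a \<otimes>\<^bsub>KM\<^esub> b \<otimes>\<^bsub>KM\<^esub> c) z = (a \<otimes>\<^bsub>KM\<^esub> (b \<otimes>\<^bsub>KM\<^esub> c)) z" .
qed

lemma mult_comm:
  assumes a: "a \<in> carrier KM" and b: "b \<in> carrier KM"
  shows "a \<otimes>\<^bsub>KM\<^esub> b = b \<otimes>\<^bsub>KM\<^esub> a"
proof
  fix z
  note D = mem_carrierD [OF a] mem_carrierD [OF b]
  let ?X = "{x. a x \<noteq> \<zero>}" and ?Y = "{x. b x \<noteq> \<zero>}"
  have "(a \<otimes>\<^bsub>KM\<^esub> b) z = (\<Oplus>x\<in>?X. \<Oplus>y\<in>?Y. if x \<otimes>\<^bsub>M\<^esub> y = z then a x \<otimes> b y else \<zero>)"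
    by (intro mult_eq a b D order.refl)
  also have "\<dots> = (\<Oplus>y\<in>?Y. \<Oplus>x\<in>?X. if x \<otimes>\<^bsub>M\<^esub> y = z then a x \<otimes> b y else \<zero>)"
    using D by (intro finsum_swap) auto
  also have "\<dots> = (\<Oplus>y\<in>?Y. \<Oplus>x\<in>?X. if y \<otimes>\<^bsub>M\<^esub> x = z then b y \<otimes> a x else \<zero>)"
  proof (intro finsum_cong' refl)
    fix x y assume "y \<in> ?Y" "x \<in> ?X"
    with D show "(if x \<otimes>\<^bsub>M\<^esub> y = z then a x \<otimes> b y else \<zero>) = (if y \<otimes>\<^bsub>M\<^esub> x = z then b y \<otimes> a x else \<zero>)"
      by (simp add: m_comm M.m_comm subset_eq)
  qed (use D in \<open>auto intro!: finsum_closed\<close>)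
  also have "\<dots> = (b \<otimes>\<^bsub>KM\<^esub> a) z"
    by (intro mult_eq [symmetric] a b D order.refl)
  finally show "(a \<otimes>\<^bsub>KM\<^esub> b) z = (b \<otimes>\<^bsub>KM\<^esub> a) z" .
qed

lemma single_mult_single:
  assumes "c \<in> carrier K" "d \<in> carrier K" "x \<in> carrier M" "y \<in> carrier M"
  shows "single K c x \<otimes>\<^bsub>KM\<^esub> single K d y = single K (c \<otimes> d) (x \<otimes>\<^bsub>M\<^esub> y)"
proof
  fix z
  have "(single K c x \<otimes>\<^bsub>KM\<^esub> single K d y) z = (\<Oplus>u\<in>{x}. \<Oplus>w\<in>{y}. if u \<otimes>\<^bsub>M\<^esub> w = z
      then single K c x u \<otimes> single K d y w else \<zero>)"
    using assms by (intro mult_eq single_closed) (auto simp: single_def split: if_splits)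
  then show "(single K c x \<otimes>\<^bsub>KM\<^esub> single K d y) z = single K (c \<otimes> d) (x \<otimes>\<^bsub>M\<^esub> y) z"
    using assms by (auto simp: single_def)
qed

lemma one_mult:
  assumes a: "a \<in> carrier KM"
  shows "\<one>\<^bsub>KM\<^esub> \<otimes>\<^bsub>KM\<^esub> a = a"
proof
  fix z
  \<comment> \<open>The point \<open>z\<close> is adjoined so that the sum can be read off at
    \<open>z\<close> even when \<open>a z\<close> vanishes. It is adjoined only if it lies in
    \<open>M\<close>, because the neutral law is available only there.\<close>
  let ?Y = "{x. a x \<noteq> \<zero>} \<union> ({z} \<inter> carrier M)"
  note D = mem_carrierD [OF a]
  have "(\<one>\<^bsub>KM\<^esub> \<otimes>\<^bsub>KM\<^esub> a) z = (\<Oplus>u\<in>{\<one>\<^bsub>M\<^esub>}. \<Oplus>w\<in>?Y. if u \<otimes>\<^bsub>M\<^esub> w = z then \<one>\<^bsub>KM\<^esub> u \<otimes> a w else \<zero>)"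
    using D by (intro mult_eq a) (auto simp: single_def monoid_algebra_simps split: if_splits)
  also have "\<dots> = (\<Oplus>w\<in>?Y. if \<one>\<^bsub>M\<^esub> \<otimes>\<^bsub>M\<^esub> w = z then a w else \<zero>)"
    using D by (subst finsum_insert)
      (auto intro!: finsum_cong' finsum_closed simp: single_def monoid_algebra_simps)
  also have "\<dots> = (\<Oplus>w\<in>?Y. if z = w then a w else \<zero>)"
    using D by (intro finsum_cong') auto
  also have "\<dots> = a z"
  proof (cases "z \<in> carrier M")
    case True
    then show ?thesis using D by (intro finsum_delta) auto
  next
    case False
    then have "a z = \<zero>" "z \<notin> ?Y" using D by auto
    then show ?thesis by (auto intro!: add.finprod_one_eqI)
  qed
  finally show "(\<one>\<^bsub>KM\<^esub> \<otimes>\<^bsub>KM\<^esub> a) z = a z" .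
qed

lemma monoid_algebra_cring: "cring KM"
proof (rule cringI [OF abelian_group_KM comm_monoidI])
  interpret L: lin_extension K M "self_module K" by (rule lin_extension_self)
  let ?N = "self_module K"
  have N: "\<And>x y. x \<oplus>\<^bsub>?N\<^esub> y = x \<oplus> y" by (simp add: self_module_def)
  fix a b c assume abc: "a \<in> carrier KM" "b \<in> carrier KM" "c \<in> carrier KM"
  show "(a \<oplus>\<^bsub>KM\<^esub> b) \<otimes>\<^bsub>KM\<^esub> c = a \<otimes>\<^bsub>KM\<^esub> c \<oplus>\<^bsub>KM\<^esub> b \<otimes>\<^bsub>KM\<^esub> c"
  proof
    fix z
    let ?\<phi> = "\<lambda>x. lin_ext K ?N (\<lambda>y. if x \<otimes>\<^bsub>M\<^esub> y = z then \<one> else \<zero>) c"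
    have "?\<phi> \<in> carrier M \<rightarrow> carrier ?N"
      using abc by (intro funcsetI L.lin_ext_closed) (auto simp: self_module_def)
    moreover have "(a \<otimes>\<^bsub>KM\<^esub> c \<oplus>\<^bsub>KM\<^esub> b \<otimes>\<^bsub>KM\<^esub> c) z = (a \<otimes>\<^bsub>KM\<^esub> c) z \<oplus> (b \<otimes>\<^bsub>KM\<^esub> c) z"
      by (simp add: monoid_algebra_simps)
    ultimately show "((a \<oplus>\<^bsub>KM\<^esub> b) \<otimes>\<^bsub>KM\<^esub> c) z = (a \<otimes>\<^bsub>KM\<^esub> c \<oplus>\<^bsub>KM\<^esub> b \<otimes>\<^bsub>KM\<^esub> c) z"
      using L.lin_ext_add [OF abc(1,2), of ?\<phi>] mult_eq_lin_ext abc add_closed N by simp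
  qed
qed (use mult_assoc mult_comm mult_closed one_mult in \<open>auto simp: monoid_algebra_simps(2)\<close>)

lemma monoid_algebra_algebra: "algebra K KM"
proof (rule algebraI [OF is_cring monoid_algebra_cring])
  fix c a b assume abc: "c \<in> carrier K" "a \<in> carrier KM" "b \<in> carrier KM"
  interpret L: lin_extension K M "self_module K" by (rule lin_extension_self)
  let ?N = "self_module K"
  have N: "\<And>x y. x \<odot>\<^bsub>?N\<^esub> y = x \<otimes> y" by (simp add: self_module_def)
  show "c \<odot>\<^bsub>KM\<^esub> a \<otimes>\<^bsub>KM\<^esub> b = c \<odot>\<^bsub>KM\<^esub> (a \<otimes>\<^bsub>KM\<^esub> b)"
  proof
    fix z
    let ?\<phi> = "\<lambda>x. lin_ext K ?N (\<lambda>y. if x \<otimes>\<^bsub>M\<^esub> y = z then \<one> else \<zero>) b"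
    have "?\<phi> \<in> carrier M \<rightarrow> carrier ?N"
      using abc by (intro funcsetI L.lin_ext_closed) (auto simp: self_module_def)
    moreover have "(c \<odot>\<^bsub>KM\<^esub> (a \<otimes>\<^bsub>KM\<^esub> b)) z = c \<otimes> (a \<otimes>\<^bsub>KM\<^esub> b) z"
      by (simp add: monoid_algebra_simps)
    ultimately show "(c \<odot>\<^bsub>KM\<^esub> a \<otimes>\<^bsub>KM\<^esub> b) z = (c \<odot>\<^bsub>KM\<^esub> (a \<otimes>\<^bsub>KM\<^esub> b)) z"
      using L.lin_ext_smult [OF abc(1,2), of ?\<phi>] mult_eq_lin_ext abc KM_smult_closed N by simp
  qed
qed (use KM_smult_closed in \<open>auto simp: monoid_algebra_simps l_distr r_distr m_assoc fun_eq_iff\<close>)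

end

section \<open>The associated graded algebra\<close>

text \<open>The value group lives in a type class; this copy in record form makes the group algebra
  \<open>B[\<Gamma>]\<close> an instance of \<open>monoid_algebra\<close>.\<close>

definition value_group :: "'g::linordered_ab_group_add monoid"
  where "value_group = \<lparr>carrier = UNIV, monoid.mult = (+), one = 0\<rparr>"

lemma value_group_simps [simp]:
  "carrier value_group = UNIV" "x \<otimes>\<^bsub>value_group\<^esub> y = x + y" "\<one>\<^bsub>value_group\<^esub> = 0"
  by (simp_all add: value_group_def)

lemma value_group_comm_monoid: "comm_monoid value_group"
  by (rule comm_monoidI) (auto simp: add_ac)

locale valued_algebra = algebra K B + B: domain B + K: field K
  for K :: "('k, 'm) ring_scheme" (structure) and B :: "('k, 'b, 'n) module_scheme"
    and v :: "'b \<Rightarrow> 'g::linordered_ab_group_add" +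
  assumes valuation: "valuation_over K B v"
begin

lemma v_mult:
  "f \<in> carrier B \<Longrightarrow> g \<in> carrier B \<Longrightarrow> f \<noteq> \<zero>\<^bsub>B\<^esub> \<Longrightarrow> g \<noteq> \<zero>\<^bsub>B\<^esub> \<Longrightarrow> v (f \<otimes>\<^bsub>B\<^esub> g) = v f + v g"
  using valuation by (auto simp: valuation_over_def)

lemma v_add:
  "f \<in> carrier B \<Longrightarrow> g \<in> carrier B \<Longrightarrow> f \<noteq> \<zero>\<^bsub>B\<^esub> \<Longrightarrow> g \<noteq> \<zero>\<^bsub>B\<^esub> \<Longrightarrow> f \<oplus>\<^bsub>B\<^esub> g \<noteq> \<zero>\<^bsub>B\<^esub> \<Longrightarrow>
    min (v f) (v g) \<le> v (f \<oplus>\<^bsub>B\<^esub> g)"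
  using valuation by (auto simp: valuation_over_def)

lemma v_smult:
  "c \<in> carrier K \<Longrightarrow> c \<noteq> \<zero> \<Longrightarrow> f \<in> carrier B \<Longrightarrow> f \<noteq> \<zero>\<^bsub>B\<^esub> \<Longrightarrow> v (c \<odot>\<^bsub>B\<^esub> f) = v f"
  using valuation by (auto simp: valuation_over_def)

lemma v_one: "v \<one>\<^bsub>B\<^esub> = 0"
  using v_mult [of "\<one>\<^bsub>B\<^esub>" "\<one>\<^bsub>B\<^esub>"] by simp

lemma smult_eq_zero:
  assumes "c \<in> carrier K" "f \<in> carrier B" "c \<odot>\<^bsub>B\<^esub> f = \<zero>\<^bsub>B\<^esub>"
  shows "c = \<zero> \<or> f = \<zero>\<^bsub>B\<^esub>"
proof (rule disjCI)
  assume "f \<noteq> \<zero>\<^bsub>B\<^esub>"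
  show "c = \<zero>"
  proof (rule ccontr)
    assume "c \<noteq> \<zero>"
    then have c: "c \<in> Units K" using assms(1) by (simp add: K.field_Units)
    have "f = inv c \<odot>\<^bsub>B\<^esub> (c \<odot>\<^bsub>B\<^esub> f)"
      using c assms by (subst smult_assoc1 [symmetric]) auto
    also have "\<dots> = \<zero>\<^bsub>B\<^esub>" using c assms by simp
    finally show False using \<open>f \<noteq> \<zero>\<^bsub>B\<^esub>\<close> by simp
  qed
qed

section \<open>The filtration and its cosets\<close>

lemma mem_filt_ge: "f \<in> filt_ge B v \<gamma> \<longleftrightarrow> f \<in> carrier B \<and> (f = \<zero>\<^bsub>B\<^esub> \<or> \<gamma> \<le> v f)"
  by (auto simp: filt_ge_def)

lemma mem_filt_gt: "f \<in> filt_gt B v \<gamma> \<longleftrightarrow> f \<in> carrier B \<and> (f = \<zero>\<^bsub>B\<^esub> \<or> \<gamma> < v f)"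
  by (auto simp: filt_gt_def)

lemma filt_ge_add: "f \<in> filt_ge B v \<gamma> \<Longrightarrow> g \<in> filt_ge B v \<gamma> \<Longrightarrow> f \<oplus>\<^bsub>B\<^esub> g \<in> filt_ge B v \<gamma>"
  using v_add [of f g] by (cases "f = \<zero>\<^bsub>B\<^esub> \<or> g = \<zero>\<^bsub>B\<^esub>") (auto simp: mem_filt_ge min_le_iff_disj intro: order_trans)

lemma filt_gt_add: "f \<in> filt_gt B v \<gamma> \<Longrightarrow> g \<in> filt_gt B v \<gamma> \<Longrightarrow> f \<oplus>\<^bsub>B\<^esub> g \<in> filt_gt B v \<gamma>"
  using v_add [of f g] by (cases "f = \<zero>\<^bsub>B\<^esub> \<or> g = \<zero>\<^bsub>B\<^esub>")
    (auto simp: mem_filt_gt min_le_iff_disj intro: less_le_trans)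

lemma filt_ge_smult: "c \<in> carrier K \<Longrightarrow> f \<in> filt_ge B v \<gamma> \<Longrightarrow> c \<odot>\<^bsub>B\<^esub> f \<in> filt_ge B v \<gamma>"
  by (cases "c = \<zero>"; cases "f = \<zero>\<^bsub>B\<^esub>") (auto simp: mem_filt_ge v_smult)

lemma filt_gt_smult: "c \<in> carrier K \<Longrightarrow> f \<in> filt_gt B v \<gamma> \<Longrightarrow> c \<odot>\<^bsub>B\<^esub> f \<in> filt_gt B v \<gamma>"
  by (cases "c = \<zero>"; cases "f = \<zero>\<^bsub>B\<^esub>") (auto simp: mem_filt_gt v_smult)

text \<open>Negation is treated as multiplication by the scalar -1, so that closure of the
  filtration steps under negatives follows from the invariance of \<open>v\<close> under non-zero
  scalars.\<close>

lemma uminus_eq_smult: "f \<in> carrier B \<Longrightarrow> \<ominus>\<^bsub>B\<^esub> f = (\<ominus> \<one>) \<odot>\<^bsub>B\<^esub> f"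
  by (simp add: smult_l_minus)

lemma filt_ge_uminus: "f \<in> filt_ge B v \<gamma> \<Longrightarrow> \<ominus>\<^bsub>B\<^esub> f \<in> filt_ge B v \<gamma>"
  using filt_ge_smult [of "\<ominus> \<one>" f \<gamma>] by (simp add: uminus_eq_smult mem_filt_ge)

lemma filt_gt_uminus: "f \<in> filt_gt B v \<gamma> \<Longrightarrow> \<ominus>\<^bsub>B\<^esub> f \<in> filt_gt B v \<gamma>"
  using filt_gt_smult [of "\<ominus> \<one>" f \<gamma>] by (simp add: uminus_eq_smult mem_filt_gt)

lemma filt_ge_mult:
  "f \<in> filt_ge B v \<alpha> \<Longrightarrow> g \<in> filt_ge B v \<beta> \<Longrightarrow> f \<otimes>\<^bsub>B\<^esub> g \<in> filt_ge B v (\<alpha> + \<beta>)"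
  by (cases "f = \<zero>\<^bsub>B\<^esub>"; cases "g = \<zero>\<^bsub>B\<^esub>") (auto simp: mem_filt_ge v_mult add_mono)

lemma filt_gt_mult:
  "f \<in> filt_gt B v \<alpha> \<Longrightarrow> g \<in> filt_ge B v \<beta> \<Longrightarrow> f \<otimes>\<^bsub>B\<^esub> g \<in> filt_gt B v (\<alpha> + \<beta>)"
  by (cases "f = \<zero>\<^bsub>B\<^esub>"; cases "g = \<zero>\<^bsub>B\<^esub>")
    (auto simp: mem_filt_ge mem_filt_gt v_mult add_less_le_mono)

lemma filt_ge_gt_mult:
  "f \<in> filt_ge B v \<alpha> \<Longrightarrow> g \<in> filt_gt B v \<beta> \<Longrightarrow> f \<otimes>\<^bsub>B\<^esub> g \<in> filt_gt B v (\<alpha> + \<beta>)"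
  by (cases "f = \<zero>\<^bsub>B\<^esub>"; cases "g = \<zero>\<^bsub>B\<^esub>")
    (auto simp: mem_filt_ge mem_filt_gt v_mult add_le_less_mono)

lemma filt_gt_le_ge: "filt_gt B v \<gamma> \<subseteq> filt_ge B v \<gamma>"
  by (auto simp: filt_gt_def filt_ge_def)

lemma filt_ge_finsum: "f \<in> X \<rightarrow> filt_ge B v \<gamma> \<Longrightarrow> (\<Oplus>\<^bsub>B\<^esub>i\<in>X. f i) \<in> filt_ge B v \<gamma>"
proof (induction X rule: infinite_finite_induct)
  case (insert x X)
  then show ?case
    using filt_ge_add [of "f x" \<gamma> "\<Oplus>\<^bsub>B\<^esub>i\<in>X. f i"]
    by (subst M.finsum_insert) (auto simp: Pi_iff mem_filt_ge)
qed (auto simp: mem_filt_ge M.finsum_infinite)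

lemma filt_gt_abelian_subgroup: "abelian_subgroup (filt_gt B v \<gamma>) B"
proof (intro abelian_subgroupI3 additive_subgroup.intro M.abelian_group_axioms M.add.subgroupI)
  show "filt_gt B v \<gamma> \<noteq> {}" by (auto simp: filt_gt_def)
qed (use filt_gt_add filt_gt_uminus in \<open>auto simp: mem_filt_gt\<close>)

text \<open>Cosets are formed in all of \<open>B\<close>; those of representatives in
  \<open>filt_ge B v \<gamma>\<close> are the elements of the graded piece of degree
  \<gamma>.\<close>

definition gcoset :: "'g \<Rightarrow> 'b \<Rightarrow> 'b set"
  where "gcoset \<gamma> x = filt_gt B v \<gamma> +>\<^bsub>B\<^esub> x"

lemma mem_gcoset: "x \<in> carrier B \<Longrightarrow> y \<in> gcoset \<gamma> x \<longleftrightarrow> y \<in> carrier B \<and> y \<ominus>\<^bsub>B\<^esub> x \<in> filt_gt B v \<gamma>"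
  using abelian_subgroup.a_rcos_module [OF filt_gt_abelian_subgroup, of x y \<gamma>]
    abelian_subgroup.a_elemrcos_carrier [OF filt_gt_abelian_subgroup, of x y \<gamma>]
  by (auto simp: gcoset_def a_minus_def)

lemma gcoset_eq_iff:
  assumes "x \<in> carrier B" "y \<in> carrier B"
  shows "gcoset \<gamma> x = gcoset \<gamma> y \<longleftrightarrow> x \<ominus>\<^bsub>B\<^esub> y \<in> filt_gt B v \<gamma>"
proof -
  interpret S: abelian_subgroup "filt_gt B v \<gamma>" B by (rule filt_gt_abelian_subgroup)
  show ?thesis
    using assms S.a_repr_independence' [of x y] S.a_repr_independenceD [of x y] mem_gcoset [of y x \<gamma>]
    by (metis gcoset_def)
qed

lemma gcoset_eq_filt_gt: "x \<in> filt_gt B v \<gamma> \<Longrightarrow> gcoset \<gamma> x = filt_gt B v \<gamma>"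
  using abelian_subgroup.a_rcos_const [OF filt_gt_abelian_subgroup] by (simp add: gcoset_def)

lemma gcoset_zero [simp]: "gcoset \<gamma> \<zero>\<^bsub>B\<^esub> = filt_gt B v \<gamma>"
  by (rule gcoset_eq_filt_gt) (simp add: mem_filt_gt)

lemma gcoset_eq_filt_gt_iff: "x \<in> carrier B \<Longrightarrow> gcoset \<gamma> x = filt_gt B v \<gamma> \<longleftrightarrow> x \<in> filt_gt B v \<gamma>"
  using gcoset_eq_iff [of x "\<zero>\<^bsub>B\<^esub>" \<gamma>] by (simp add: a_minus_def)

lemma gcoset_add:
  "x \<in> carrier B \<Longrightarrow> y \<in> carrier B \<Longrightarrow> gcoset \<gamma> x <+>\<^bsub>B\<^esub> gcoset \<gamma> y = gcoset \<gamma> (x \<oplus>\<^bsub>B\<^esub> y)"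
  using abelian_subgroup.a_rcos_sum [OF filt_gt_abelian_subgroup] by (simp add: gcoset_def)

text \<open>The record update in \<open>gr_piece\<close> replaces only the carrier, while cosets and
  their sums depend only on addition. Hence both can be computed in \<open>B\<close> itself.\<close>

lemma gr_piece_simps:
  "carrier (gr_piece B v \<gamma>) = gcoset \<gamma> ` filt_ge B v \<gamma>"
  "X \<otimes>\<^bsub>gr_piece B v \<gamma>\<^esub> Y = X <+>\<^bsub>B\<^esub> Y"
  "\<one>\<^bsub>gr_piece B v \<gamma>\<^esub> = filt_gt B v \<gamma>"
  by (auto simp: gr_piece_def A_FactGroup_def FactGroup_def RCOSETS_def gcoset_def a_r_coset_def
      r_coset_def set_add_def set_mult_def)

lemma filt_ge_carrier: "x \<in> filt_ge B v \<gamma> \<Longrightarrow> x \<in> carrier B"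
  by (simp add: mem_filt_ge)

lemma gr_piece_comm_monoid: "comm_monoid (gr_piece B v \<gamma>)"
proof (rule comm_monoidI)
  have "filt_gt B v \<gamma> = gcoset \<gamma> \<zero>\<^bsub>B\<^esub>" by simp
  moreover have "\<zero>\<^bsub>B\<^esub> \<in> filt_ge B v \<gamma>" by (simp add: mem_filt_ge)
  ultimately show "\<one>\<^bsub>gr_piece B v \<gamma>\<^esub> \<in> carrier (gr_piece B v \<gamma>)"
    unfolding gr_piece_simps by blast
next
  fix X assume "X \<in> carrier (gr_piece B v \<gamma>)"
  then obtain x where "x \<in> carrier B" "X = gcoset \<gamma> x"
    unfolding gr_piece_simps using filt_ge_carrier by auto
  then show "\<one>\<^bsub>gr_piece B v \<gamma>\<^esub> \<otimes>\<^bsub>gr_piece B v \<gamma>\<^esub> X = X"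
    unfolding gr_piece_simps using gcoset_add [of "\<zero>\<^bsub>B\<^esub>" x \<gamma>] by simp
qed (auto simp: gr_piece_simps gcoset_add filt_ge_carrier M.a_ac intro: filt_ge_add)

lemma gr_piece_finprod:
  "f \<in> X \<rightarrow> filt_ge B v \<gamma> \<Longrightarrow>
    (\<Otimes>\<^bsub>gr_piece B v \<gamma>\<^esub>i\<in>X. gcoset \<gamma> (f i)) = gcoset \<gamma> (\<Oplus>\<^bsub>B\<^esub>i\<in>X. f i)"
proof (induction X rule: infinite_finite_induct)
  case (infinite X)
  then show ?case
    by (simp add: comm_monoid.finprod_infinite [OF gr_piece_comm_monoid] gr_piece_simps
        M.finsum_infinite)
next
  case empty
  then show ?case
    by (simp add: comm_monoid.finprod_empty [OF gr_piece_comm_monoid] gr_piece_simps)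
next
  case (insert x X)
  interpret G: comm_monoid "gr_piece B v \<gamma>" by (rule gr_piece_comm_monoid)
  have f: "f i \<in> filt_ge B v \<gamma>" "f i \<in> carrier B" if "i \<in> insert x X" for i
    using insert.prems that by (auto simp: mem_filt_ge)
  have "(\<Otimes>\<^bsub>gr_piece B v \<gamma>\<^esub>i\<in>insert x X. gcoset \<gamma> (f i)) = gcoset \<gamma> (f x) <+>\<^bsub>B\<^esub> gcoset \<gamma> (\<Oplus>\<^bsub>B\<^esub>i\<in>X. f i)"
    using insert f by (subst G.finprod_insert) (auto simp: gr_piece_simps)
  also have "\<dots> = gcoset \<gamma> (\<Oplus>\<^bsub>B\<^esub>i\<in>insert x X. f i)"
    using insert f
    by (subst M.finsum_insert) (auto simp: gcoset_add intro!: M.finsum_closed)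
  finally show ?case .
qed

text \<open>Since \<open>rcoset_mult\<close> is a union over all representatives, the content is
  well-definedness. It follows from x'y' - xy = (x' - x)y' + x(y' - y), where y' has value at least
  \<beta> because it differs from y by an element of larger value.\<close>

lemma rcoset_mult_gcoset:
  assumes "x \<in> filt_ge B v \<alpha>" "y \<in> filt_ge B v \<beta>"
  shows "rcoset_mult B (filt_gt B v (\<alpha> + \<beta>)) (gcoset \<alpha> x) (gcoset \<beta> y) = gcoset (\<alpha> + \<beta>) (x \<otimes>\<^bsub>B\<^esub> y)"
proof -
  have xy: "x \<in> carrier B" "y \<in> carrier B" using assms by (auto simp: filt_ge_carrier)
  have eq: "gcoset (\<alpha> + \<beta>) (x' \<otimes>\<^bsub>B\<^esub> y') = gcoset (\<alpha> + \<beta>) (x \<otimes>\<^bsub>B\<^esub> y)"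
    if "x' \<in> gcoset \<alpha> x" "y' \<in> gcoset \<beta> y" for x' y'
  proof -
    have x': "x' \<in> carrier B" "x' \<ominus>\<^bsub>B\<^esub> x \<in> filt_gt B v \<alpha>"
      and y': "y' \<in> carrier B" "y' \<ominus>\<^bsub>B\<^esub> y \<in> filt_gt B v \<beta>"
      using that mem_gcoset xy by auto
    have "(y' \<ominus>\<^bsub>B\<^esub> y) \<oplus>\<^bsub>B\<^esub> y \<in> filt_ge B v \<beta>"
      using y' assms(2) filt_gt_le_ge by (blast intro: filt_ge_add)
    moreover have "(y' \<ominus>\<^bsub>B\<^esub> y) \<oplus>\<^bsub>B\<^esub> y = y'" using xy y' by algebra
    ultimately have "(x' \<ominus>\<^bsub>B\<^esub> x) \<otimes>\<^bsub>B\<^esub> y' \<oplus>\<^bsub>B\<^esub> x \<otimes>\<^bsub>B\<^esub> (y' \<ominus>\<^bsub>B\<^esub> y) \<in> filt_gt B v (\<alpha> + \<beta>)"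
      using x' y' assms by (intro filt_gt_add filt_gt_mult filt_ge_gt_mult) auto
    moreover have "(x' \<ominus>\<^bsub>B\<^esub> x) \<otimes>\<^bsub>B\<^esub> y' \<oplus>\<^bsub>B\<^esub> x \<otimes>\<^bsub>B\<^esub> (y' \<ominus>\<^bsub>B\<^esub> y) = x' \<otimes>\<^bsub>B\<^esub> y' \<ominus>\<^bsub>B\<^esub> x \<otimes>\<^bsub>B\<^esub> y"
      using xy x'(1) y'(1) by algebra
    ultimately show ?thesis using xy x' y' by (simp add: gcoset_eq_iff)
  qed
  moreover have "x \<in> gcoset \<alpha> x" "y \<in> gcoset \<beta> y"
    using xy by (simp_all add: mem_gcoset mem_filt_gt M.r_neg a_minus_def)
  ultimately show ?thesis
    unfolding rcoset_mult_def gcoset_def [of "\<alpha> + \<beta>", symmetric] by blast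
qed

text \<open>Again a union over representatives: scalar multiples of congruent elements are congruent
  because \<open>filt_gt\<close> is closed under scalars.\<close>

lemma smult_gcoset:
  assumes "c \<in> carrier K" "x \<in> carrier B"
  shows "(\<Union>y\<in>gcoset \<gamma> x. filt_gt B v \<gamma> +>\<^bsub>B\<^esub> (c \<odot>\<^bsub>B\<^esub> y)) = gcoset \<gamma> (c \<odot>\<^bsub>B\<^esub> x)"
proof -
  have "gcoset \<gamma> (c \<odot>\<^bsub>B\<^esub> y) = gcoset \<gamma> (c \<odot>\<^bsub>B\<^esub> x)" if "y \<in> gcoset \<gamma> x" for y
  proof -
    have y: "y \<in> carrier B" "y \<ominus>\<^bsub>B\<^esub> x \<in> filt_gt B v \<gamma>" using that assms mem_gcoset by auto
    have "c \<odot>\<^bsub>B\<^esub> y \<ominus>\<^bsub>B\<^esub> c \<odot>\<^bsub>B\<^esub> x = c \<odot>\<^bsub>B\<^esub> (y \<ominus>\<^bsub>B\<^esub> x)"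
      using assms y by (simp add: a_minus_def smult_r_distr smult_r_minus)
    then show ?thesis using filt_gt_smult [OF assms(1) y(2)] assms y by (simp add: gcoset_eq_iff)
  qed
  moreover have "x \<in> gcoset \<gamma> x"
    using assms by (simp add: mem_gcoset mem_filt_gt M.r_neg a_minus_def)
  ultimately show ?thesis
    unfolding gcoset_def [of _ "c \<odot>\<^bsub>B\<^esub> _", symmetric] by blast
qed

section \<open>A Rees-type subring of the group algebra covering the associated graded
  algebra\<close>

abbreviation "BG \<equiv> monoid_algebra B (value_group :: 'g monoid)"

text \<open>The axioms of \<open>gr B v\<close> are inherited from the subring of the group algebra \<open>B[\<Gamma>]\<close> formed
  by the families \<open>a\<close> with \<open>a \<gamma>\<close> in \<open>filt_ge B v \<gamma>\<close>, which maps onto \<open>gr B v\<close>.\<close>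

definition rees :: "('g \<Rightarrow> 'b) set"
  where "rees = {a \<in> carrier BG. \<forall>\<gamma>. a \<gamma> \<in> filt_ge B v \<gamma>}"

definition to_gr :: "('g \<Rightarrow> 'b) \<Rightarrow> 'g \<Rightarrow> 'b set"
  where "to_gr a = (\<lambda>\<gamma>. gcoset \<gamma> (a \<gamma>))"

sublocale MB: monoid_alg B "value_group :: 'g monoid"
  by (intro monoid_alg.intro M_cring value_group_comm_monoid)

sublocale BG: cring BG
  by (rule MB.monoid_algebra_cring)

text \<open>As \<Gamma> is a group, \<alpha> determines its partner \<gamma> - \<alpha>, so the
  convolution takes the single-sum shape in which the product of \<open>gr\<close> is
  defined.\<close>

lemma BG_mult:
  assumes "a \<in> carrier BG" "b \<in> carrier BG" "finite X" "{x. a x \<noteq> \<zero>\<^bsub>B\<^esub>} \<subseteq> X"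
  shows "(a \<otimes>\<^bsub>BG\<^esub> b) \<gamma> = (\<Oplus>\<^bsub>B\<^esub>\<alpha>\<in>X. a \<alpha> \<otimes>\<^bsub>B\<^esub> b (\<gamma> - \<alpha>))"
proof -
  \<comment> \<open>The partners \<gamma> - \<alpha> are included even where \<open>b\<close>
    vanishes, so that each inner sum has a definite index to collapse to.\<close>
  let ?Y = "{x. b x \<noteq> \<zero>\<^bsub>B\<^esub>} \<union> (\<lambda>\<alpha>. \<gamma> - \<alpha>) ` X"
  have ab: "a x \<in> carrier B" "b x \<in> carrier B" for x
    using assms MB.mem_carrierD(1) by auto
  have Y: "finite ?Y" using assms MB.mem_carrierD(2) by auto
  have "(a \<otimes>\<^bsub>BG\<^esub> b) \<gamma>
    = (\<Oplus>\<^bsub>B\<^esub>x\<in>X. \<Oplus>\<^bsub>B\<^esub>y\<in>?Y. if x \<otimes>\<^bsub>value_group\<^esub> y = \<gamma> then a x \<otimes>\<^bsub>B\<^esub> b y else \<zero>\<^bsub>B\<^esub>)"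
    using assms Y by (intro MB.mult_eq) auto
  also have "\<dots> = (\<Oplus>\<^bsub>B\<^esub>\<alpha>\<in>X. a \<alpha> \<otimes>\<^bsub>B\<^esub> b (\<gamma> - \<alpha>))"
  proof (intro M.finsum_cong' refl)
    fix \<alpha> assume \<alpha>: "\<alpha> \<in> X"
    have "(\<Oplus>\<^bsub>B\<^esub>y\<in>?Y. if \<alpha> \<otimes>\<^bsub>value_group\<^esub> y = \<gamma> then a \<alpha> \<otimes>\<^bsub>B\<^esub> b y else \<zero>\<^bsub>B\<^esub>)
      = (\<Oplus>\<^bsub>B\<^esub>y\<in>?Y. if \<gamma> - \<alpha> = y then a \<alpha> \<otimes>\<^bsub>B\<^esub> b y else \<zero>\<^bsub>B\<^esub>)"
      using ab by (intro M.finsum_cong' refl) (auto simp: algebra_simps)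
    also have "\<dots> = a \<alpha> \<otimes>\<^bsub>B\<^esub> b (\<gamma> - \<alpha>)"
      using ab Y \<alpha> by (intro M.finsum_delta) auto
    finally show "(\<Oplus>\<^bsub>B\<^esub>y\<in>?Y. if \<alpha> \<otimes>\<^bsub>value_group\<^esub> y = \<gamma> then a \<alpha> \<otimes>\<^bsub>B\<^esub> b y else \<zero>\<^bsub>B\<^esub>)
      = a \<alpha> \<otimes>\<^bsub>B\<^esub> b (\<gamma> - \<alpha>)" .
  qed (use ab in auto)
  finally show ?thesis .
qed

lemma rees_carrier: "a \<in> rees \<Longrightarrow> a \<in> carrier BG"
  by (simp add: rees_def)

lemma rees_filt_ge: "a \<in> rees \<Longrightarrow> a \<gamma> \<in> filt_ge B v \<gamma>"
  by (simp add: rees_def)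

lemma rees_zero: "\<zero>\<^bsub>BG\<^esub> \<in> rees"
  using BG.zero_closed by (auto simp: rees_def monoid_algebra_simps(3) mem_filt_ge)

lemma rees_single:
  assumes "f \<in> carrier B" "f \<noteq> \<zero>\<^bsub>B\<^esub>"
  shows "single B f (v f) \<in> rees"
  using assms MB.single_closed by (auto simp: rees_def single_def mem_filt_ge)

lemma rees_one: "\<one>\<^bsub>BG\<^esub> \<in> rees"
  using rees_single [of "\<one>\<^bsub>B\<^esub>"] by (simp add: monoid_algebra_simps(2) v_one)

lemma rees_add: "a \<in> rees \<Longrightarrow> b \<in> rees \<Longrightarrow> a \<oplus>\<^bsub>BG\<^esub> b \<in> rees"
  using BG.a_closed [of a b] filt_ge_add by (auto simp: rees_def monoid_algebra_simps(4))

lemma rees_mult: "a \<in> rees \<Longrightarrow> b \<in> rees \<Longrightarrow> a \<otimes>\<^bsub>BG\<^esub> b \<in> rees"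
proof -
  assume a: "a \<in> rees" and b: "b \<in> rees"
  have "(a \<otimes>\<^bsub>BG\<^esub> b) \<gamma> \<in> filt_ge B v \<gamma>" for \<gamma>
  proof -
    have "a \<alpha> \<otimes>\<^bsub>B\<^esub> b (\<gamma> - \<alpha>) \<in> filt_ge B v \<gamma>" for \<alpha>
      using filt_ge_mult [OF rees_filt_ge [OF a, of \<alpha>] rees_filt_ge [OF b, of "\<gamma> - \<alpha>"]] by simp
    then show ?thesis
      unfolding BG_mult [OF a [THEN rees_carrier] b [THEN rees_carrier]
          MB.mem_carrierD(2) [OF a [THEN rees_carrier]] order.refl]
      by (intro filt_ge_finsum) auto
  qed
  then show ?thesis using a b BG.m_closed by (auto simp: rees_def)
qed

lemma rees_uminus:
  assumes a: "a \<in> rees" shows "\<exists>b\<in>rees. b \<oplus>\<^bsub>BG\<^esub> a = \<zero>\<^bsub>BG\<^esub>"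
proof
  show "(\<lambda>\<gamma>. \<ominus>\<^bsub>B\<^esub> a \<gamma>) \<oplus>\<^bsub>BG\<^esub> a = \<zero>\<^bsub>BG\<^esub>"
    using rees_filt_ge [OF a]
    by (auto simp: monoid_algebra_simps(3,4) fun_eq_iff mem_filt_ge M.l_neg)
  have "(\<lambda>\<gamma>. \<ominus>\<^bsub>B\<^esub> a \<gamma>) \<in> carrier BG"
    using MB.mem_carrierD [OF rees_carrier [OF a]]
    by (intro MB.mem_carrierI [where X = "{x. a x \<noteq> \<zero>\<^bsub>B\<^esub>}"]) auto
  then show "(\<lambda>\<gamma>. \<ominus>\<^bsub>B\<^esub> a \<gamma>) \<in> rees"
    using rees_filt_ge [OF a] by (auto simp: rees_def filt_ge_uminus)
qed

lemma rees_smult: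
  assumes c: "c \<in> carrier K" and a: "a \<in> rees"
  shows "(\<lambda>\<gamma>. c \<odot>\<^bsub>B\<^esub> a \<gamma>) \<in> rees"
proof -
  have "(\<lambda>\<gamma>. c \<odot>\<^bsub>B\<^esub> a \<gamma>) \<in> carrier BG"
    using c MB.mem_carrierD [OF rees_carrier [OF a]]
    by (intro MB.mem_carrierI [where X = "{x. a x \<noteq> \<zero>\<^bsub>B\<^esub>}"]) auto
  then show ?thesis
    using c rees_filt_ge [OF a] by (auto simp: rees_def filt_ge_smult)
qed

lemma gr_simps:
  "carrier (gr B v) = {\<phi>. (\<forall>\<gamma>. \<phi> \<gamma> \<in> gcoset \<gamma> ` filt_ge B v \<gamma>) \<and> finite {\<gamma>. \<phi> \<gamma> \<noteq> filt_gt B v \<gamma>}}"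
  "\<zero>\<^bsub>gr B v\<^esub> = (\<lambda>\<gamma>. filt_gt B v \<gamma>)"
  "\<phi> \<oplus>\<^bsub>gr B v\<^esub> \<psi> = (\<lambda>\<gamma>. \<phi> \<gamma> <+>\<^bsub>B\<^esub> \<psi> \<gamma>)"
  by (simp_all add: gr_def gr_piece_simps)

lemma carrier_gr: "carrier (gr B v) = to_gr ` rees"
proof (intro equalityI subsetI)
  fix \<phi> assume \<phi>: "\<phi> \<in> carrier (gr B v)"
  then have fin: "finite {\<gamma>. \<phi> \<gamma> \<noteq> filt_gt B v \<gamma>}" by (simp add: gr_simps)
  \<comment> \<open>A zero coset must get the representative 0. An arbitrary choice from
    \<open>filt_gt\<close> could give a family with infinite support, outside
    \<open>BG\<close>.\<close>
  have "\<exists>x. x \<in> filt_ge B v \<gamma> \<and> \<phi> \<gamma> = gcoset \<gamma> x \<and> (\<phi> \<gamma> = filt_gt B v \<gamma> \<longrightarrow> x = \<zero>\<^bsub>B\<^esub>)" for \<gamma>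
  proof (cases "\<phi> \<gamma> = filt_gt B v \<gamma>")
    case True
    then show ?thesis by (intro exI [of _ "\<zero>\<^bsub>B\<^esub>"]) (simp add: mem_filt_ge)
  next
    case False
    then show ?thesis using \<phi> by (auto simp: gr_simps)
  qed
  then obtain a where a: "\<And>\<gamma>. a \<gamma> \<in> filt_ge B v \<gamma>" "\<And>\<gamma>. \<phi> \<gamma> = gcoset \<gamma> (a \<gamma>)"
    "\<And>\<gamma>. \<phi> \<gamma> = filt_gt B v \<gamma> \<Longrightarrow> a \<gamma> = \<zero>\<^bsub>B\<^esub>" by metis
  have "a \<in> carrier BG"
    using a by (intro MB.mem_carrierI [OF _ fin]) (auto simp: filt_ge_carrier [OF a(1)])
  then have "a \<in> rees" using a by (simp add: rees_def)
  moreover have "\<phi> = to_gr a" using a by (auto simp: to_gr_def)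
  ultimately show "\<phi> \<in> to_gr ` rees" by blast
next
  fix \<phi> assume "\<phi> \<in> to_gr ` rees"
  then obtain a where a: "a \<in> rees" and \<phi>: "\<phi> = to_gr a" by blast
  have "{\<gamma>. \<phi> \<gamma> \<noteq> filt_gt B v \<gamma>} \<subseteq> {\<gamma>. a \<gamma> \<noteq> \<zero>\<^bsub>B\<^esub>}" by (auto simp: \<phi> to_gr_def)
  then have "finite {\<gamma>. \<phi> \<gamma> \<noteq> filt_gt B v \<gamma>}"
    using MB.mem_carrierD(2) [OF rees_carrier [OF a]] finite_subset by blast
  then show "\<phi> \<in> carrier (gr B v)" using rees_filt_ge [OF a] by (auto simp: gr_simps \<phi> to_gr_def)
qed

lemma to_gr_zero: "to_gr \<zero>\<^bsub>BG\<^esub> = \<zero>\<^bsub>gr B v\<^esub>"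
  by (simp add: to_gr_def gr_simps monoid_algebra_simps(3))

lemma to_gr_one: "to_gr \<one>\<^bsub>BG\<^esub> = \<one>\<^bsub>gr B v\<^esub>"
  by (auto simp: to_gr_def gr_def monoid_algebra_simps(2) single_def gcoset_def [symmetric] fun_eq_iff)

lemma to_gr_add: "a \<in> rees \<Longrightarrow> b \<in> rees \<Longrightarrow> to_gr (a \<oplus>\<^bsub>BG\<^esub> b) = to_gr a \<oplus>\<^bsub>gr B v\<^esub> to_gr b"
  by (simp add: to_gr_def gr_simps monoid_algebra_simps(4) gcoset_add filt_ge_carrier [OF rees_filt_ge])

lemma to_gr_smult:
  "c \<in> carrier K \<Longrightarrow> a \<in> rees \<Longrightarrow> to_gr (\<lambda>\<gamma>. c \<odot>\<^bsub>B\<^esub> a \<gamma>) = c \<odot>\<^bsub>gr B v\<^esub> to_gr a"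
  by (simp add: to_gr_def gr_def smult_gcoset filt_ge_carrier [OF rees_filt_ge])

text \<open>The two products run over different index sets: non-zero cosets on one side, non-zero
  coefficients of \<open>a\<close> on the other. At an additional \<alpha> the coefficient
  \<open>a \<alpha>\<close> lies in \<open>filt_gt B v \<alpha>\<close>, so its product with
  \<open>b (\<gamma> - \<alpha>)\<close> lies in \<open>filt_gt B v \<gamma>\<close> and contributes
  the neutral coset.\<close>

lemma to_gr_mult:
  assumes a: "a \<in> rees" and b: "b \<in> rees"
  shows "to_gr (a \<otimes>\<^bsub>BG\<^esub> b) = to_gr a \<otimes>\<^bsub>gr B v\<^esub> to_gr b"
proof
  fix \<gamma>
  interpret G: comm_monoid "gr_piece B v \<gamma>" by (rule gr_piece_comm_monoid)
  let ?X = "{\<alpha>. a \<alpha> \<noteq> \<zero>\<^bsub>B\<^esub>}"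
  note X = MB.mem_carrierD(2) [OF rees_carrier [OF a]]
  have prod: "a \<alpha> \<otimes>\<^bsub>B\<^esub> b (\<gamma> - \<alpha>) \<in> filt_ge B v \<gamma>" for \<alpha>
    using filt_ge_mult [OF rees_filt_ge [OF a, of \<alpha>] rees_filt_ge [OF b, of "\<gamma> - \<alpha>"]] by simp
  have "(to_gr a \<otimes>\<^bsub>gr B v\<^esub> to_gr b) \<gamma> = (\<Otimes>\<^bsub>gr_piece B v \<gamma>\<^esub>\<alpha>\<in>{\<alpha>. to_gr a \<alpha> \<noteq> filt_gt B v \<alpha>}.
      rcoset_mult B (filt_gt B v \<gamma>) (to_gr a \<alpha>) (to_gr b (\<gamma> - \<alpha>)))"
    by (simp add: gr_def)
  also have "\<dots> = (\<Otimes>\<^bsub>gr_piece B v \<gamma>\<^esub>\<alpha>\<in>?X. gcoset \<gamma> (a \<alpha> \<otimes>\<^bsub>B\<^esub> b (\<gamma> - \<alpha>)))"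
  proof (intro G.finprod_mono_neutral_cong_left X)
    show "{\<alpha>. to_gr a \<alpha> \<noteq> filt_gt B v \<alpha>} \<subseteq> ?X" by (auto simp: to_gr_def)
  next
    fix \<alpha>
    show "rcoset_mult B (filt_gt B v \<gamma>) (to_gr a \<alpha>) (to_gr b (\<gamma> - \<alpha>))
      = gcoset \<gamma> (a \<alpha> \<otimes>\<^bsub>B\<^esub> b (\<gamma> - \<alpha>))"
      using rcoset_mult_gcoset [OF rees_filt_ge [OF a, of \<alpha>] rees_filt_ge [OF b, of "\<gamma> - \<alpha>"]]
      by (simp add: to_gr_def)
  next
    fix \<alpha> assume "\<alpha> \<in> ?X - {\<alpha>. to_gr a \<alpha> \<noteq> filt_gt B v \<alpha>}"
    then have "a \<alpha> \<in> filt_gt B v \<alpha>"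
      by (auto simp: to_gr_def gcoset_eq_filt_gt_iff filt_ge_carrier [OF rees_filt_ge [OF a]])
    from filt_gt_mult [OF this rees_filt_ge [OF b, of "\<gamma> - \<alpha>"]]
    show "gcoset \<gamma> (a \<alpha> \<otimes>\<^bsub>B\<^esub> b (\<gamma> - \<alpha>)) = \<one>\<^bsub>gr_piece B v \<gamma>\<^esub>"
      by (simp add: gcoset_eq_filt_gt gr_piece_simps)
  qed (auto simp: gr_piece_simps prod)
  also have "\<dots> = gcoset \<gamma> (\<Oplus>\<^bsub>B\<^esub>\<alpha>\<in>?X. a \<alpha> \<otimes>\<^bsub>B\<^esub> b (\<gamma> - \<alpha>))"
    using prod by (intro gr_piece_finprod) auto
  also have "\<dots> = to_gr (a \<otimes>\<^bsub>BG\<^esub> b) \<gamma>"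
    unfolding to_gr_def by (subst BG_mult [OF rees_carrier [OF a] rees_carrier [OF b] X order.refl]) simp
  finally show "to_gr (a \<otimes>\<^bsub>BG\<^esub> b) \<gamma> = (to_gr a \<otimes>\<^bsub>gr B v\<^esub> to_gr b) \<gamma>" ..
qed

lemma gr_cring: "cring (gr B v)"
proof (intro cringI abelian_groupI comm_monoidI)
  fix \<phi> assume "\<phi> \<in> carrier (gr B v)"
  then obtain a where "a \<in> rees" "\<phi> = to_gr a" by (auto simp: carrier_gr)
  then show "\<exists>\<psi>\<in>carrier (gr B v). \<psi> \<oplus>\<^bsub>gr B v\<^esub> \<phi> = \<zero>\<^bsub>gr B v\<^esub>"
    using rees_uminus [of a] to_gr_add to_gr_zero by (auto simp: carrier_gr) metis
qed (auto simp: carrier_gr to_gr_add [symmetric] to_gr_mult [symmetric] to_gr_zero [symmetric]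
    to_gr_one [symmetric] rees_add rees_mult rees_zero rees_one rees_carrier
    BG.a_ac BG.m_ac BG.l_distr BG.r_distr)

text \<open>The scalars of \<open>BG\<close> are elements of \<open>B\<close>, not of
  \<open>K\<close>. The action of \<open>K\<close> is therefore taken coefficientwise on
  representatives, and its compatibility with the convolution is checked from that of
  \<open>B\<close>.\<close>

lemma gr_algebra: "algebra K (gr B v)"
proof (rule algebraI [OF R_cring gr_cring])
  fix c \<phi> \<psi> assume c: "c \<in> carrier K" and "\<phi> \<in> carrier (gr B v)" "\<psi> \<in> carrier (gr B v)"
  then obtain a b where a: "a \<in> rees" "\<phi> = to_gr a" and b: "b \<in> rees" "\<psi> = to_gr b"
    by (auto simp: carrier_gr)
  have ab: "a \<gamma> \<in> carrier B" "b \<gamma> \<in> carrier B" for \<gamma>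
    using rees_filt_ge a b filt_ge_carrier by blast+
  have "(\<lambda>\<gamma>. c \<odot>\<^bsub>B\<^esub> a \<gamma>) \<oplus>\<^bsub>BG\<^esub> (\<lambda>\<gamma>. c \<odot>\<^bsub>B\<^esub> b \<gamma>) = (\<lambda>\<gamma>. c \<odot>\<^bsub>B\<^esub> (a \<oplus>\<^bsub>BG\<^esub> b) \<gamma>)"
    using ab c by (simp add: monoid_algebra_simps(4) smult_r_distr)
  then show "c \<odot>\<^bsub>gr B v\<^esub> (\<phi> \<oplus>\<^bsub>gr B v\<^esub> \<psi>) = c \<odot>\<^bsub>gr B v\<^esub> \<phi> \<oplus>\<^bsub>gr B v\<^esub> c \<odot>\<^bsub>gr B v\<^esub> \<psi>"
    using a b c by (simp add: to_gr_add [symmetric] to_gr_smult [symmetric] rees_add rees_smult)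
  have "(\<lambda>\<gamma>. c \<odot>\<^bsub>B\<^esub> a \<gamma>) \<otimes>\<^bsub>BG\<^esub> b = (\<lambda>\<gamma>. c \<odot>\<^bsub>B\<^esub> (a \<otimes>\<^bsub>BG\<^esub> b) \<gamma>)"
  proof
    fix \<gamma>
    have X: "finite {x. a x \<noteq> \<zero>\<^bsub>B\<^esub>}" using MB.mem_carrierD(2) rees_carrier a by blast
    have "((\<lambda>\<gamma>. c \<odot>\<^bsub>B\<^esub> a \<gamma>) \<otimes>\<^bsub>BG\<^esub> b) \<gamma>
      = (\<Oplus>\<^bsub>B\<^esub>\<alpha>\<in>{x. a x \<noteq> \<zero>\<^bsub>B\<^esub>}. c \<odot>\<^bsub>B\<^esub> a \<alpha> \<otimes>\<^bsub>B\<^esub> b (\<gamma> - \<alpha>))"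
      using c a b X by (intro BG_mult rees_carrier rees_smult) auto
    also have "\<dots> = (\<Oplus>\<^bsub>B\<^esub>\<alpha>\<in>{x. a x \<noteq> \<zero>\<^bsub>B\<^esub>}. c \<odot>\<^bsub>B\<^esub> (a \<alpha> \<otimes>\<^bsub>B\<^esub> b (\<gamma> - \<alpha>)))"
      using c ab by (intro M.finsum_cong' refl) (auto simp: smult_assoc2)
    also have "\<dots> = c \<odot>\<^bsub>B\<^esub> (a \<otimes>\<^bsub>BG\<^esub> b) \<gamma>"
      using c ab X a b
      by (subst BG_mult [OF _ _ X order.refl]) (auto simp: finsum_smult_ldistr rees_carrier)
    finally show "((\<lambda>\<gamma>. c \<odot>\<^bsub>B\<^esub> a \<gamma>) \<otimes>\<^bsub>BG\<^esub> b) \<gamma> = c \<odot>\<^bsub>B\<^esub> (a \<otimes>\<^bsub>BG\<^esub> b) \<gamma>" .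
  qed
  then show "c \<odot>\<^bsub>gr B v\<^esub> \<phi> \<otimes>\<^bsub>gr B v\<^esub> \<psi> = c \<odot>\<^bsub>gr B v\<^esub> (\<phi> \<otimes>\<^bsub>gr B v\<^esub> \<psi>)"
    using a b c by (simp add: to_gr_mult [symmetric] to_gr_smult [symmetric] rees_mult rees_smult)
next
  fix c d \<phi> assume c: "c \<in> carrier K" "d \<in> carrier K" and "\<phi> \<in> carrier (gr B v)"
  then obtain a where a: "a \<in> rees" "\<phi> = to_gr a" by (auto simp: carrier_gr)
  have a': "a \<gamma> \<in> carrier B" for \<gamma> using rees_filt_ge a filt_ge_carrier by blast
  have "(\<lambda>\<gamma>. c \<odot>\<^bsub>B\<^esub> a \<gamma>) \<oplus>\<^bsub>BG\<^esub> (\<lambda>\<gamma>. d \<odot>\<^bsub>B\<^esub> a \<gamma>) = (\<lambda>\<gamma>. (c \<oplus> d) \<odot>\<^bsub>B\<^esub> a \<gamma>)"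
    using a' c by (simp add: monoid_algebra_simps(4) smult_l_distr)
  then show "(c \<oplus> d) \<odot>\<^bsub>gr B v\<^esub> \<phi> = c \<odot>\<^bsub>gr B v\<^esub> \<phi> \<oplus>\<^bsub>gr B v\<^esub> d \<odot>\<^bsub>gr B v\<^esub> \<phi>"
    using a c by (simp add: to_gr_add [symmetric] to_gr_smult [symmetric] rees_smult)
  show "(c \<otimes> d) \<odot>\<^bsub>gr B v\<^esub> \<phi> = c \<odot>\<^bsub>gr B v\<^esub> (d \<odot>\<^bsub>gr B v\<^esub> \<phi>)"
    using a c a' by (simp add: to_gr_smult [symmetric] rees_smult smult_assoc1)
qed (auto simp: carrier_gr to_gr_smult [symmetric] rees_smult rees_carrier filt_ge_carrier [OF rees_filt_ge])

section \<open>Initial forms\<close>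

lemma init_form_eq:
  "f \<in> carrier B \<Longrightarrow> f \<noteq> \<zero>\<^bsub>B\<^esub> \<Longrightarrow> init_form B v f = to_gr (single B f (v f))"
  by (auto simp: init_form_def to_gr_def single_def gcoset_def [symmetric] fun_eq_iff)

lemma init_form_closed: "f \<in> carrier B \<Longrightarrow> f \<noteq> \<zero>\<^bsub>B\<^esub> \<Longrightarrow> init_form B v f \<in> carrier (gr B v)"
  using rees_single by (auto simp: init_form_eq carrier_gr)

lemma init_form_one: "init_form B v \<one>\<^bsub>B\<^esub> = \<one>\<^bsub>gr B v\<^esub>"
  by (simp add: init_form_eq v_one to_gr_one [symmetric] monoid_algebra_simps(2))

text \<open>An initial form is the image of a family concentrated in one degree. Such families
  multiply by multiplying entries and adding degrees; \<open>v\<close> is additive on products, and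
  the product is non-zero because \<open>B\<close> is a domain.\<close>

lemma init_form_mult:
  assumes "f \<in> carrier B" "f \<noteq> \<zero>\<^bsub>B\<^esub>" "g \<in> carrier B" "g \<noteq> \<zero>\<^bsub>B\<^esub>"
  shows "init_form B v (f \<otimes>\<^bsub>B\<^esub> g) = init_form B v f \<otimes>\<^bsub>gr B v\<^esub> init_form B v g"
proof -
  have "f \<otimes>\<^bsub>B\<^esub> g \<noteq> \<zero>\<^bsub>B\<^esub>" using assms B.integral by blast
  then show ?thesis
    using assms MB.single_mult_single [of f g "v f" "v g"]
    by (simp add: init_form_eq to_gr_mult [symmetric] rees_single v_mult)
qed

text \<open>Compare components of degree \<open>v r\<close>. A summand with \<open>v (p m)\<close>
  equal to \<open>v r\<close> contributes the coset of \<open>c m\<close> times \<open>p m\<close>.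
  One of larger value contributes the zero coset, which is again the coset of \<open>c m\<close>
  times \<open>p m\<close>. So the component of the sum is the coset of the corresponding sum in
  \<open>B\<close>, and it equals the coset of \<open>r\<close>.\<close>

lemma lift_init_form_relation:
  assumes X: "finite X" and c: "c \<in> X \<rightarrow> carrier K" and p: "p \<in> X \<rightarrow> carrier B - {\<zero>\<^bsub>B\<^esub>}"
    and r: "r \<in> carrier B" "r \<noteq> \<zero>\<^bsub>B\<^esub>" and le: "\<And>m. m \<in> X \<Longrightarrow> v r \<le> v (p m)"
    and eq: "(\<Oplus>\<^bsub>gr B v\<^esub>m\<in>X. c m \<odot>\<^bsub>gr B v\<^esub> init_form B v (p m)) = init_form B v r"
  shows "r \<ominus>\<^bsub>B\<^esub> (\<Oplus>\<^bsub>B\<^esub>m\<in>X. c m \<odot>\<^bsub>B\<^esub> p m) \<in> filt_gt B v (v r)"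
proof -
  interpret gr: algebra K "gr B v" by (rule gr_algebra)
  have "(\<Oplus>\<^bsub>gr B v\<^esub>m\<in>Y. c m \<odot>\<^bsub>gr B v\<^esub> init_form B v (p m)) (v r)
      = gcoset (v r) (\<Oplus>\<^bsub>B\<^esub>m\<in>Y. c m \<odot>\<^bsub>B\<^esub> p m)" if "finite Y" "Y \<subseteq> X" for Y
    using that
  proof (induction Y)
    case empty
    then show ?case by (simp add: gr_simps)
  next
    case (insert m Y)
    have m: "c m \<in> carrier K" "p m \<in> carrier B" "p m \<noteq> \<zero>\<^bsub>B\<^esub>" "v r \<le> v (p m)"
      using insert c p le by auto
    have Y: "\<And>m. m \<in> Y \<Longrightarrow> c m \<in> carrier K" "\<And>m. m \<in> Y \<Longrightarrow> p m \<in> carrier B"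
      "\<And>m. m \<in> Y \<Longrightarrow> p m \<noteq> \<zero>\<^bsub>B\<^esub>" using insert c p by auto
    have "(c m \<odot>\<^bsub>gr B v\<^esub> init_form B v (p m)) (v r)
      = to_gr (\<lambda>\<gamma>. c m \<odot>\<^bsub>B\<^esub> single B (p m) (v (p m)) \<gamma>) (v r)"
      using m by (simp add: init_form_eq to_gr_smult rees_single)
    also have "\<dots> = gcoset (v r) (c m \<odot>\<^bsub>B\<^esub> p m)"
    proof (cases "v r = v (p m)")
      case False
      then have "p m \<in> filt_gt B v (v r)" using m by (simp add: mem_filt_gt)
      then show ?thesis using False m filt_gt_smult by (simp add: to_gr_def single_def gcoset_eq_filt_gt)
    qed (simp add: to_gr_def single_def)
    finally show ?case
      using insert m Y
      by (subst gr.M.finsum_insert, simp, simp, force intro: init_form_closed gr.smult_closed,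
          force intro: init_form_closed gr.smult_closed, subst M.finsum_insert)
        (auto simp: gr_simps(3) gcoset_add)
  qed
  from this [OF X] eq have "init_form B v r (v r) = gcoset (v r) (\<Oplus>\<^bsub>B\<^esub>m\<in>X. c m \<odot>\<^bsub>B\<^esub> p m)"
    by simp
  moreover have "init_form B v r (v r) = gcoset (v r) r" using r by (simp add: init_form_def gcoset_def)
  moreover have "(\<Oplus>\<^bsub>B\<^esub>m\<in>X. c m \<odot>\<^bsub>B\<^esub> p m) \<in> carrier B"
    using c p by (intro M.finsum_closed) auto
  ultimately show ?thesis using r by (simp add: gcoset_eq_iff)
qed

end

section \<open>Tensor products\<close>

lemma DirProd_comm_monoid:
  assumes "comm_monoid G" "comm_monoid H"
  shows "comm_monoid (G \<times>\<times> H)"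
proof -
  interpret G: comm_monoid G by fact
  interpret H: comm_monoid H by fact
  show ?thesis
    by (rule comm_monoidI) (auto simp: G.m_ac H.m_ac)
qed

context lin_extension
begin

lemma lin_ext_minus:
  assumes a: "a \<in> carrier KM" and b: "b \<in> carrier KM" and \<phi>: "\<phi> \<in> carrier M \<rightarrow> carrier N"
  shows "lin_ext K N \<phi> (a \<ominus>\<^bsub>KM\<^esub> b) = lin_ext K N \<phi> a \<ominus>\<^bsub>N\<^esub> lin_ext K N \<phi> b"
proof -
  interpret KM: cring KM by (rule monoid_algebra_cring)
  have "(a \<ominus>\<^bsub>KM\<^esub> b) \<oplus>\<^bsub>KM\<^esub> b = a" using a b by algebra
  then have "lin_ext K N \<phi> a = lin_ext K N \<phi> (a \<ominus>\<^bsub>KM\<^esub> b) \<oplus>\<^bsub>N\<^esub> lin_ext K N \<phi> b"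
    using lin_ext_add [of "a \<ominus>\<^bsub>KM\<^esub> b" b \<phi>] a b \<phi> by simp
  then show ?thesis
    using a b \<phi> by (simp add: a_minus_def lin_ext_closed M.a_assoc M.r_neg)
qed

lemma lin_ext_finsum:
  assumes "finite X" "g \<in> X \<rightarrow> carrier KM" "\<phi> \<in> carrier M \<rightarrow> carrier N"
  shows "lin_ext K N \<phi> (\<Oplus>\<^bsub>KM\<^esub>i\<in>X. g i) = (\<Oplus>\<^bsub>N\<^esub>i\<in>X. lin_ext K N \<phi> (g i))"
  using assms(1,2)
proof (induction X)
  case empty
  interpret KM: cring KM by (rule monoid_algebra_cring)
  show ?case by (simp add: lin_ext_zero)
next
  case (insert x X)
  interpret KM: cring KM by (rule monoid_algebra_cring)
  have "g \<in> X \<rightarrow> carrier KM" "g x \<in> carrier KM" using insert.prems by auto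
  with insert assms(3) show ?case
    by (subst KM.finsum_insert, simp, simp, simp, simp, subst M.finsum_insert)
      (auto simp: lin_ext_add intro!: lin_ext_closed KM.finsum_closed)
qed

end

section \<open>The tensor product as a quotient of a monoid algebra\<close>

locale tensor_product = R: algebra K R + S: algebra K S
  for K :: "('k, 'm) ring_scheme" (structure)
    and R :: "('k, 'r, 'n) module_scheme" and S :: "('k, 's, 'p) module_scheme"
begin

abbreviation "F \<equiv> monoid_algebra K (R \<times>\<times> S)"
abbreviation "J \<equiv> tensor_ideal K R S"
abbreviation "T \<equiv> tensor_algebra K R S"
abbreviation "e x y \<equiv> single K \<one> (x, y)"

sublocale MF: monoid_alg K "R \<times>\<times> S"
  by (intro monoid_alg.intro R.R_cring DirProd_comm_monoid R.M_cring [THEN cring.axioms(2)]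
      S.M_cring [THEN cring.axioms(2)])

sublocale F: algebra K F
  by (rule MF.monoid_algebra_algebra)

lemma e_closed: "x \<in> carrier R \<Longrightarrow> y \<in> carrier S \<Longrightarrow> e x y \<in> carrier F"
  by (intro MF.single_closed) auto

lemma tensor_relations_carrier: "tensor_relations K R S \<subseteq> carrier F"
  unfolding tensor_relations_def Let_def
  by (auto intro!: F.M.minus_closed F.M.a_closed F.smult_closed e_closed)

lemma tensor_ideal_ideal: "ideal J F"
  unfolding tensor_ideal_def by (rule F.genideal_ideal [OF tensor_relations_carrier])

sublocale J: ideal J F
  by (rule tensor_ideal_ideal)

definition proj :: "('r \<times> 's \<Rightarrow> 'k) \<Rightarrow> ('r \<times> 's \<Rightarrow> 'k) set"
  where "proj a = J +>\<^bsub>F\<^esub> a"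

lemma tensor_algebra_simps:
  "carrier T = carrier (F Quot J)" "monoid.mult T = monoid.mult (F Quot J)"
  "\<one>\<^bsub>T\<^esub> = \<one>\<^bsub>F Quot J\<^esub>" "\<zero>\<^bsub>T\<^esub> = \<zero>\<^bsub>F Quot J\<^esub>" "add T = add (F Quot J)"
  "c \<odot>\<^bsub>T\<^esub> X = (\<Union>x\<in>X. proj (c \<odot>\<^bsub>F\<^esub> x))"
  by (simp_all add: tensor_algebra_def Let_def ring.defs module.defs proj_def)

text \<open>The tensor algebra extends the quotient ring by a scalar field and so has a different
  record type; the axioms are carried over operation by operation.\<close>

sublocale T: cring T
proof -
  interpret Q: cring "F Quot J" by (rule J.quotient_is_cring [OF F.M_cring])
  show "cring T"
  proof (intro cringI abelian_groupI comm_monoidI)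
    fix X assume "X \<in> carrier T"
    then show "\<exists>Y\<in>carrier T. Y \<oplus>\<^bsub>T\<^esub> X = \<zero>\<^bsub>T\<^esub>"
      using Q.l_neg [of X] Q.a_inv_closed [of X] by (auto simp: tensor_algebra_simps)
  qed (simp_all add: tensor_algebra_simps Q.a_ac Q.m_ac Q.l_distr Q.r_distr)
qed

sublocale proj: ring_hom_cring F T proj
proof (unfold_locales, rule ring_hom_memI)
  note h = J.rcos_ring_hom
  show "proj a \<in> carrier T" if "a \<in> carrier F" for a
    using ring_hom_closed [OF h that] by (simp add: tensor_algebra_simps proj_def)
  show "proj (a \<otimes>\<^bsub>F\<^esub> b) = proj a \<otimes>\<^bsub>T\<^esub> proj b" if "a \<in> carrier F" "b \<in> carrier F" for a b
    using ring_hom_mult [OF h that] by (simp add: tensor_algebra_simps proj_def)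
  show "proj (a \<oplus>\<^bsub>F\<^esub> b) = proj a \<oplus>\<^bsub>T\<^esub> proj b" if "a \<in> carrier F" "b \<in> carrier F" for a b
    using ring_hom_add [OF h that] by (simp add: tensor_algebra_simps proj_def)
  show "proj \<one>\<^bsub>F\<^esub> = \<one>\<^bsub>T\<^esub>"
    using ring_hom_one [OF h] by (simp add: tensor_algebra_simps proj_def)
qed

lemma proj_eq_iff:
  assumes "a \<in> carrier F" "b \<in> carrier F"
  shows "proj a = proj b \<longleftrightarrow> a \<ominus>\<^bsub>F\<^esub> b \<in> J"
proof -
  have "proj a = proj b \<longleftrightarrow> a \<in> J +>\<^bsub>F\<^esub> b"
    using J.a_repr_independence' [of a b] J.a_repr_independenceD [of a b] assms
    by (auto simp only: proj_def)
  then show ?thesis using J.a_rcos_module [of b a] assms by (simp add: a_minus_def)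
qed

text \<open>Scalar multiplication of a coset is defined as a union over representatives. It is
  independent of the representative because the ideal \<open>J\<close> absorbs scalars: multiplying
  by \<open>c\<close> is multiplying by the ring element \<open>c\<close> times 1 of
  \<open>F\<close>.\<close>

lemma proj_smult:
  assumes c: "c \<in> carrier K" and a: "a \<in> carrier F"
  shows "proj (c \<odot>\<^bsub>F\<^esub> a) = c \<odot>\<^bsub>T\<^esub> proj a"
proof -
  have "proj (c \<odot>\<^bsub>F\<^esub> x) = proj (c \<odot>\<^bsub>F\<^esub> a)" if "x \<in> proj a" for x
  proof -
    have x: "x \<in> carrier F" using J.a_elemrcos_carrier [OF a] that by (simp add: proj_def)
    then have xa: "x \<ominus>\<^bsub>F\<^esub> a \<in> J"
      using J.a_rcos_module [OF a x] that by (simp add: proj_def a_minus_def)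
    have "c \<odot>\<^bsub>F\<^esub> x \<ominus>\<^bsub>F\<^esub> c \<odot>\<^bsub>F\<^esub> a = c \<odot>\<^bsub>F\<^esub> (x \<ominus>\<^bsub>F\<^esub> a)"
      using a c x by (simp add: a_minus_def F.smult_r_distr F.smult_r_minus)
    also have "\<dots> = (c \<odot>\<^bsub>F\<^esub> \<one>\<^bsub>F\<^esub>) \<otimes>\<^bsub>F\<^esub> (x \<ominus>\<^bsub>F\<^esub> a)"
      using a c x by (simp add: F.smult_assoc2)
    also have "\<dots> \<in> J" using xa c by (intro J.I_l_closed) auto
    finally show ?thesis using a c x by (simp add: proj_eq_iff)
  qed
  moreover have "a \<in> proj a" using J.a_rcos_self [OF a] by (simp add: proj_def)
  ultimately show ?thesis unfolding tensor_algebra_simps by blast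
qed

lemma pure_tensor_eq: "pure_tensor K R S x y = proj (e x y)"
  by (simp add: pure_tensor_def proj_def)

lemma pure_tensor_closed:
  "x \<in> carrier R \<Longrightarrow> y \<in> carrier S \<Longrightarrow> pure_tensor K R S x y \<in> carrier T"
  unfolding pure_tensor_eq by (intro proj.hom_closed e_closed)

lemma pure_tensor_mult:
  assumes "x \<in> carrier R" "x' \<in> carrier R" "y \<in> carrier S" "y' \<in> carrier S"
  shows "pure_tensor K R S x y \<otimes>\<^bsub>T\<^esub> pure_tensor K R S x' y'
    = pure_tensor K R S (x \<otimes>\<^bsub>R\<^esub> x') (y \<otimes>\<^bsub>S\<^esub> y')"
proof -
  have "e x y \<otimes>\<^bsub>F\<^esub> e x' y' = e (x \<otimes>\<^bsub>R\<^esub> x') (y \<otimes>\<^bsub>S\<^esub> y')"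
    using assms by (subst MF.single_mult_single) auto
  then show ?thesis
    using proj.hom_mult [OF e_closed [OF assms(1,3)] e_closed [OF assms(2,4)]]
    by (simp only: pure_tensor_eq)
qed

lemma pure_tensor_one: "pure_tensor K R S \<one>\<^bsub>R\<^esub> \<one>\<^bsub>S\<^esub> = \<one>\<^bsub>T\<^esub>"
  using proj.hom_one by (simp add: pure_tensor_eq monoid_algebra_simps(2))

end

section \<open>Bilinear maps on relations between pure tensors\<close>

locale bilinear_form = tensor_product K R S + N: module K N
  for K :: "('k, 'm) ring_scheme" (structure)
    and R :: "('k, 'r, 'n) module_scheme" and S :: "('k, 's, 'p) module_scheme"
    and N :: "('k, 'c, 'q) module_scheme" +
  fixes \<beta> :: "'r \<Rightarrow> 's \<Rightarrow> 'c"
  assumes form_closed: "x \<in> carrier R \<Longrightarrow> y \<in> carrier S \<Longrightarrow> \<beta> x y \<in> carrier N"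
    and form_add_left: "x \<in> carrier R \<Longrightarrow> x' \<in> carrier R \<Longrightarrow> y \<in> carrier S \<Longrightarrow>
      \<beta> (x \<oplus>\<^bsub>R\<^esub> x') y = \<beta> x y \<oplus>\<^bsub>N\<^esub> \<beta> x' y"
    and form_add_right: "x \<in> carrier R \<Longrightarrow> y \<in> carrier S \<Longrightarrow> y' \<in> carrier S \<Longrightarrow>
      \<beta> x (y \<oplus>\<^bsub>S\<^esub> y') = \<beta> x y \<oplus>\<^bsub>N\<^esub> \<beta> x y'"
    and form_smult_left: "c \<in> carrier K \<Longrightarrow> x \<in> carrier R \<Longrightarrow> y \<in> carrier S \<Longrightarrow>
      \<beta> (c \<odot>\<^bsub>R\<^esub> x) y = c \<odot>\<^bsub>N\<^esub> \<beta> x y"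
    and form_smult_right: "c \<in> carrier K \<Longrightarrow> x \<in> carrier R \<Longrightarrow> y \<in> carrier S \<Longrightarrow>
      \<beta> x (c \<odot>\<^bsub>S\<^esub> y) = c \<odot>\<^bsub>N\<^esub> \<beta> x y"
begin

sublocale L: lin_extension K "R \<times>\<times> S" N
  by (intro lin_extension.intro N.module_axioms MF.M.comm_monoid_axioms)

definition form :: "'r \<times> 's \<Rightarrow> 'c"
  where "form = case_prod \<beta>"

lemma form_funcset: "form \<in> carrier (R \<times>\<times> S) \<rightarrow> carrier N"
  by (auto simp: form_def form_closed)

lemma form_translate_funcset:
  "z \<in> carrier (R \<times>\<times> S) \<Longrightarrow> (\<lambda>w. form (z \<otimes>\<^bsub>R \<times>\<times> S\<^esub> w)) \<in> carrier (R \<times>\<times> S) \<rightarrow> carrier N"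
  using form_funcset by (auto simp: Pi_iff)

text \<open>Quantifying over all translates makes this vanishing set an ideal without any
  compatibility of \<open>\<beta>\<close> with the multiplications.\<close>

definition annihilated :: "('r \<times> 's \<Rightarrow> 'k) set"
  where "annihilated = {a \<in> carrier F. \<forall>z\<in>carrier (R \<times>\<times> S).
    lin_ext K N (\<lambda>w. form (z \<otimes>\<^bsub>R \<times>\<times> S\<^esub> w)) a = \<zero>\<^bsub>N\<^esub>}"

text \<open>By \<open>lin_ext_mult\<close>, translating by \<open>z\<close> and evaluating on the
  product of \<open>b\<close> and \<open>a\<close> gives a linear combination of the values of the
  translates by \<open>zu\<close> on \<open>a\<close>, with \<open>u\<close> in the support of
  \<open>b\<close>. All of these vanish, and commutativity of \<open>F\<close> settles the other
  side.\<close>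

lemma annihilated_ideal: "ideal annihilated F"
proof (rule idealI [OF F.ring_axioms F.M.add.subgroupI])
  show "annihilated \<subseteq> carrier F" by (auto simp: annihilated_def)
  have "\<zero>\<^bsub>F\<^esub> \<in> annihilated" by (simp add: annihilated_def L.lin_ext_zero)
  then show "annihilated \<noteq> {}" by blast
  fix a assume a: "a \<in> annihilated"
  then have a': "a \<in> carrier F" by (simp add: annihilated_def)
  have "lin_ext K N (\<lambda>w. form (z \<otimes>\<^bsub>R \<times>\<times> S\<^esub> w)) (\<ominus>\<^bsub>F\<^esub> a) = \<zero>\<^bsub>N\<^esub>" if "z \<in> carrier (R \<times>\<times> S)" for z
    using L.lin_ext_minus [OF F.M.zero_closed a' form_translate_funcset [OF that]] a that
    by (simp add: annihilated_def L.lin_ext_zero a_minus_def del: carrier_DirProd)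
  then show "\<ominus>\<^bsub>F\<^esub> a \<in> annihilated" using a' by (simp add: annihilated_def)
  show "a \<oplus>\<^bsub>F\<^esub> b \<in> annihilated" if b: "b \<in> annihilated" for b
    using a b L.lin_ext_add form_translate_funcset
    by (simp add: annihilated_def del: carrier_DirProd)
  show *: "b \<otimes>\<^bsub>F\<^esub> a \<in> annihilated" if b: "b \<in> carrier F" for b
  proof -
    have "lin_ext K N (\<lambda>w. form (z \<otimes>\<^bsub>R \<times>\<times> S\<^esub> w)) (b \<otimes>\<^bsub>F\<^esub> a) = \<zero>\<^bsub>N\<^esub>"
      if z: "z \<in> carrier (R \<times>\<times> S)" for z
    proof -
      have "lin_ext K N (\<lambda>w. form (z \<otimes>\<^bsub>R \<times>\<times> S\<^esub> w)) (b \<otimes>\<^bsub>F\<^esub> a)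
        = lin_ext K N (\<lambda>u. lin_ext K N (\<lambda>w. form (z \<otimes>\<^bsub>R \<times>\<times> S\<^esub> (u \<otimes>\<^bsub>R \<times>\<times> S\<^esub> w))) a) b"
        by (intro L.lin_ext_mult a' b form_translate_funcset z)
      also have "\<dots> = lin_ext K N (\<lambda>u. \<zero>\<^bsub>N\<^esub>) b"
      proof (intro L.lin_ext_cong b)
        fix u assume u: "u \<in> carrier (R \<times>\<times> S)"
        have zu: "z \<otimes>\<^bsub>R \<times>\<times> S\<^esub> u \<in> carrier (R \<times>\<times> S)" using z u MF.M.m_closed by blast
        have "lin_ext K N (\<lambda>w. form (z \<otimes>\<^bsub>R \<times>\<times> S\<^esub> (u \<otimes>\<^bsub>R \<times>\<times> S\<^esub> w))) a
          = lin_ext K N (\<lambda>w. form (z \<otimes>\<^bsub>R \<times>\<times> S\<^esub> u \<otimes>\<^bsub>R \<times>\<times> S\<^esub> w)) a"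
          using z u by (intro L.lin_ext_cong a' form_translate_funcset zu)
            (simp add: MF.M.m_assoc del: carrier_DirProd)
        also have "\<dots> = \<zero>\<^bsub>N\<^esub>" using a zu by (simp add: annihilated_def del: carrier_DirProd)
        finally show "lin_ext K N (\<lambda>w. form (z \<otimes>\<^bsub>R \<times>\<times> S\<^esub> (u \<otimes>\<^bsub>R \<times>\<times> S\<^esub> w))) a = \<zero>\<^bsub>N\<^esub>" .
      qed auto
      also have "\<dots> = \<zero>\<^bsub>N\<^esub>"
        using MF.mem_carrierD(1) [OF b] by (simp add: lin_ext_def)
      finally show ?thesis .
    qed
    then show ?thesis using a' b by (simp add: annihilated_def)
  qed
  show "a \<otimes>\<^bsub>F\<^esub> b \<in> annihilated" if b: "b \<in> carrier F" for b
    using * [OF b] F.m_comm [OF a' b] by simp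
qed

text \<open>Translation by \<open>(x0, y0)\<close> multiplies the arguments of \<beta> by
  \<open>x0\<close> and \<open>y0\<close>. Since the multiplications of \<open>R\<close> and
  \<open>S\<close> are bilinear, every translated relation is again an instance of the bilinearity
  of \<beta>.\<close>

lemma tensor_relations_annihilated: "tensor_relations K R S \<subseteq> annihilated"
proof -
  have e: "lin_ext K N (\<lambda>w. form ((x0, y0) \<otimes>\<^bsub>R \<times>\<times> S\<^esub> w)) (e x y) = \<beta> (x0 \<otimes>\<^bsub>R\<^esub> x) (y0 \<otimes>\<^bsub>S\<^esub> y)"
    if "x0 \<in> carrier R" "y0 \<in> carrier S" "x \<in> carrier R" "y \<in> carrier S" for x0 y0 x y
    using that by (subst L.lin_ext_single) (auto simp: form_def form_closed)
  have smult_right: "x \<otimes>\<^bsub>R\<^esub> (c \<odot>\<^bsub>R\<^esub> x') = c \<odot>\<^bsub>R\<^esub> (x \<otimes>\<^bsub>R\<^esub> x')"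
    if "c \<in> carrier K" "x \<in> carrier R" "x' \<in> carrier R" for c x x'
    using that R.smult_assoc2 [of c x' x] by (simp add: R.m_comm)
  have smult_right': "x \<otimes>\<^bsub>S\<^esub> (c \<odot>\<^bsub>S\<^esub> x') = c \<odot>\<^bsub>S\<^esub> (x \<otimes>\<^bsub>S\<^esub> x')"
    if "c \<in> carrier K" "x \<in> carrier S" "x' \<in> carrier S" for c x x'
    using that S.smult_assoc2 [of c x' x] by (simp add: S.m_comm)
  have lin: "lin_ext K N (\<lambda>w. form ((x0, y0) \<otimes>\<^bsub>R \<times>\<times> S\<^esub> w)) (a \<ominus>\<^bsub>F\<^esub> b)
      = lin_ext K N (\<lambda>w. form ((x0, y0) \<otimes>\<^bsub>R \<times>\<times> S\<^esub> w)) a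
        \<ominus>\<^bsub>N\<^esub> lin_ext K N (\<lambda>w. form ((x0, y0) \<otimes>\<^bsub>R \<times>\<times> S\<^esub> w)) b"
      "lin_ext K N (\<lambda>w. form ((x0, y0) \<otimes>\<^bsub>R \<times>\<times> S\<^esub> w)) (a \<oplus>\<^bsub>F\<^esub> b)
      = lin_ext K N (\<lambda>w. form ((x0, y0) \<otimes>\<^bsub>R \<times>\<times> S\<^esub> w)) a
        \<oplus>\<^bsub>N\<^esub> lin_ext K N (\<lambda>w. form ((x0, y0) \<otimes>\<^bsub>R \<times>\<times> S\<^esub> w)) b"
    if "x0 \<in> carrier R" "y0 \<in> carrier S" "a \<in> carrier F" "b \<in> carrier F" for x0 y0 a b
    using that by (intro L.lin_ext_minus L.lin_ext_add form_translate_funcset; simp)+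
  have lin_smult: "lin_ext K N (\<lambda>w. form ((x0, y0) \<otimes>\<^bsub>R \<times>\<times> S\<^esub> w)) (c \<odot>\<^bsub>F\<^esub> a)
      = c \<odot>\<^bsub>N\<^esub> lin_ext K N (\<lambda>w. form ((x0, y0) \<otimes>\<^bsub>R \<times>\<times> S\<^esub> w)) a"
    if "x0 \<in> carrier R" "y0 \<in> carrier S" "a \<in> carrier F" "c \<in> carrier K" for x0 y0 a c
    using that by (intro L.lin_ext_smult form_translate_funcset; simp)
  show ?thesis
    unfolding tensor_relations_def Let_def annihilated_def
    by (auto simp: lin lin_smult e e_closed smult_right smult_right' form_add_left form_add_right
        form_smult_left form_smult_right form_closed R.r_distr S.r_distr a_minus_def [of N]
        N.M.r_neg)
qed

text \<open>Lifted to the free module, the two sides differ by an element of \<open>J\<close>, the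
  smallest ideal containing the relations and hence a subset of \<open>annihilated\<close>.\<close>

lemma form_transfer:
  assumes X: "finite X" and c: "c \<in> X \<rightarrow> carrier K" and x: "x \<in> X \<rightarrow> carrier R"
    and y: "y \<in> X \<rightarrow> carrier S" and x0: "x0 \<in> carrier R" and y0: "y0 \<in> carrier S"
    and eq: "(\<Oplus>\<^bsub>T\<^esub>i\<in>X. c i \<odot>\<^bsub>T\<^esub> pure_tensor K R S (x i) (y i)) = pure_tensor K R S x0 y0"
  shows "(\<Oplus>\<^bsub>N\<^esub>i\<in>X. c i \<odot>\<^bsub>N\<^esub> \<beta> (x i) (y i)) = \<beta> x0 y0"
proof -
  let ?s = "\<Oplus>\<^bsub>F\<^esub>i\<in>X. c i \<odot>\<^bsub>F\<^esub> e (x i) (y i)"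
  have ce: "(\<lambda>i. c i \<odot>\<^bsub>F\<^esub> e (x i) (y i)) \<in> X \<rightarrow> carrier F"
    using c x y by (auto intro!: F.smult_closed e_closed)
  have s: "?s \<in> carrier F" by (intro F.M.finsum_closed ce)
  have "proj ?s = (\<Oplus>\<^bsub>T\<^esub>i\<in>X. proj (c i \<odot>\<^bsub>F\<^esub> e (x i) (y i)))"
    using proj.hom_finsum [OF ce] by (simp add: o_def)
  also have "\<dots> = (\<Oplus>\<^bsub>T\<^esub>i\<in>X. c i \<odot>\<^bsub>T\<^esub> pure_tensor K R S (x i) (y i))"
    using c x y ce by (intro T.finsum_cong' refl)
      (auto simp: pure_tensor_eq proj_smult [symmetric] e_closed Pi_iff)
  also have "\<dots> = proj (e x0 y0)" using eq by (simp add: pure_tensor_eq)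
  finally have "?s \<ominus>\<^bsub>F\<^esub> e x0 y0 \<in> J" using s x0 y0 e_closed by (simp add: proj_eq_iff)
  moreover have "J \<subseteq> annihilated"
    unfolding tensor_ideal_def
    by (rule F.genideal_minimal [OF annihilated_ideal tensor_relations_annihilated])
  \<comment> \<open>Translation by the unit recovers the linear extension of \<beta> itself.\<close>
  ultimately have "lin_ext K N (\<lambda>w. form (\<one>\<^bsub>R \<times>\<times> S\<^esub> \<otimes>\<^bsub>R \<times>\<times> S\<^esub> w)) (?s \<ominus>\<^bsub>F\<^esub> e x0 y0) = \<zero>\<^bsub>N\<^esub>"
    using MF.M.one_closed unfolding annihilated_def by blast
  moreover have "lin_ext K N (\<lambda>w. form (\<one>\<^bsub>R \<times>\<times> S\<^esub> \<otimes>\<^bsub>R \<times>\<times> S\<^esub> w)) (?s \<ominus>\<^bsub>F\<^esub> e x0 y0)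
    = lin_ext K N form (?s \<ominus>\<^bsub>F\<^esub> e x0 y0)"
    using s x0 y0 e_closed by (intro L.lin_ext_cong form_funcset) auto
  ultimately have "lin_ext K N form ?s \<ominus>\<^bsub>N\<^esub> lin_ext K N form (e x0 y0) = \<zero>\<^bsub>N\<^esub>"
    using L.lin_ext_minus [OF s e_closed [OF x0 y0] form_funcset] by argo
  moreover have "lin_ext K N form ?s = (\<Oplus>\<^bsub>N\<^esub>i\<in>X. lin_ext K N form (c i \<odot>\<^bsub>F\<^esub> e (x i) (y i)))"
    by (intro L.lin_ext_finsum X ce form_funcset)
  moreover have "\<dots> = (\<Oplus>\<^bsub>N\<^esub>i\<in>X. c i \<odot>\<^bsub>N\<^esub> \<beta> (x i) (y i))"
  proof (intro N.M.finsum_cong' refl)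
    fix i assume "i \<in> X"
    then have "c i \<in> carrier K" "x i \<in> carrier R" "y i \<in> carrier S" using c x y by auto
    then show "lin_ext K N form (c i \<odot>\<^bsub>F\<^esub> e (x i) (y i)) = c i \<odot>\<^bsub>N\<^esub> \<beta> (x i) (y i)"
      using form_funcset by (subst L.lin_ext_smult) (auto simp: L.lin_ext_single form_def form_closed e_closed)
  qed (use c x y form_closed in \<open>auto simp: Pi_iff\<close>)
  moreover have "lin_ext K N form (e x0 y0) = \<beta> x0 y0"
    using x0 y0 form_funcset by (subst L.lin_ext_single) (auto simp: form_def form_closed)
  moreover have "(\<Oplus>\<^bsub>N\<^esub>i\<in>X. c i \<odot>\<^bsub>N\<^esub> \<beta> (x i) (y i)) \<in> carrier N"
    using c x y form_closed by (intro N.M.finsum_closed) (auto simp: Pi_iff)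
  ultimately show ?thesis
    using N.M.minus_equality [of "\<Oplus>\<^bsub>N\<^esub>i\<in>X. c i \<odot>\<^bsub>N\<^esub> \<beta> (x i) (y i)" "\<ominus>\<^bsub>N\<^esub> \<beta> x0 y0"]
      form_closed [OF x0 y0] by (simp add: a_minus_def)
qed

end

section \<open>Graded initial forms\<close>

locale graded_valued_algebra = valued_algebra K B v + \<Delta>: comm_group \<Delta>
  for K :: "('k, 'm) ring_scheme" (structure) and B :: "('k, 'b, 'n) module_scheme"
    and v :: "'b \<Rightarrow> 'g::linordered_ab_group_add" and \<Delta> :: "('d, 'p) monoid_scheme" +
  fixes A :: "'b set" and \<A> :: "'d \<Rightarrow> 'b set"
  assumes subalgebra: "subalg K B A" and grading: "alg_grading K B A \<Delta> \<A>"
begin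

section \<open>Homogeneous components\<close>

lemma component_submodule: "\<delta> \<in> carrier \<Delta> \<Longrightarrow> submodule (\<A> \<delta>) K B"
  using grading by (simp add: alg_grading_def)

lemma component_subset: "\<delta> \<in> carrier \<Delta> \<Longrightarrow> \<A> \<delta> \<subseteq> A"
  using grading by (simp add: alg_grading_def)

lemma component_mult:
  "\<delta> \<in> carrier \<Delta> \<Longrightarrow> \<epsilon> \<in> carrier \<Delta> \<Longrightarrow> f \<in> \<A> \<delta> \<Longrightarrow> g \<in> \<A> \<epsilon> \<Longrightarrow>
    f \<otimes>\<^bsub>B\<^esub> g \<in> \<A> (\<delta> \<otimes>\<^bsub>\<Delta>\<^esub> \<epsilon>)"
  using grading by (simp add: alg_grading_def)

lemma component_carrier: "\<delta> \<in> carrier \<Delta> \<Longrightarrow> f \<in> \<A> \<delta> \<Longrightarrow> f \<in> carrier B"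
  using submoduleE(1) [OF component_submodule] by blast

lemma component_zero: "\<delta> \<in> carrier \<Delta> \<Longrightarrow> \<zero>\<^bsub>B\<^esub> \<in> \<A> \<delta>"
  using subgroup.one_closed [OF submodule.axioms(1) [OF component_submodule]] by simp

lemma component_smult:
  "\<delta> \<in> carrier \<Delta> \<Longrightarrow> c \<in> carrier K \<Longrightarrow> f \<in> \<A> \<delta> \<Longrightarrow> c \<odot>\<^bsub>B\<^esub> f \<in> \<A> \<delta>"
  using submoduleE(4) [OF component_submodule] .

lemma component_minus:
  "\<delta> \<in> carrier \<Delta> \<Longrightarrow> f \<in> \<A> \<delta> \<Longrightarrow> g \<in> \<A> \<delta> \<Longrightarrow> f \<ominus>\<^bsub>B\<^esub> g \<in> \<A> \<delta>"
  unfolding a_minus_def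
  using submoduleE(3,5) [OF component_submodule] by blast

lemma component_finsum:
  assumes "\<delta> \<in> carrier \<Delta>" "g \<in> X \<rightarrow> \<A> \<delta>"
  shows "(\<Oplus>\<^bsub>B\<^esub>i\<in>X. g i) \<in> \<A> \<delta>"
  using assms(2)
proof (induction X rule: infinite_finite_induct)
  case (insert x X)
  then have "g x \<oplus>\<^bsub>B\<^esub> (\<Oplus>\<^bsub>B\<^esub>i\<in>X. g i) \<in> \<A> \<delta>"
    using submoduleE(5) [OF component_submodule [OF assms(1)]] by auto
  moreover have "g \<in> X \<rightarrow> carrier B" "g x \<in> carrier B"
    using insert.prems component_carrier [OF assms(1)] by auto
  ultimately show ?case using insert by simp
qed (auto simp: component_zero assms M.finsum_infinite)

lemma one_in_A: "\<one>\<^bsub>B\<^esub> \<in> A"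
  using subalgebra subringE(3) by (auto simp: subalg_def)

text \<open>The given sum and \<open>f\<close> placed in the single degree \<epsilon> are two
  homogeneous decompositions of \<open>f\<close>. Uniqueness forces every entry away from \<epsilon>
  to vanish.\<close>

lemma sum_homogeneous:
  assumes X: "finite X" "X \<subseteq> carrier \<Delta>" and p: "\<And>\<gamma>. \<gamma> \<in> X \<Longrightarrow> p \<gamma> \<in> \<A> \<gamma>"
    and \<epsilon>: "\<epsilon> \<in> carrier \<Delta>" and f: "f \<in> \<A> \<epsilon>" and eq: "f = (\<Oplus>\<^bsub>B\<^esub>\<gamma>\<in>X. p \<gamma>)"
    and \<gamma>: "\<gamma> \<in> X" "\<gamma> \<noteq> \<epsilon>"
  shows "p \<gamma> = \<zero>\<^bsub>B\<^esub>"
proof -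
  let ?P = "\<lambda>c. c \<in> (\<Pi>\<^sub>E \<delta> \<in> carrier \<Delta>. \<A> \<delta>) \<and> finite {\<delta> \<in> carrier \<Delta>. c \<delta> \<noteq> \<zero>\<^bsub>B\<^esub>}
       \<and> f = (\<Oplus>\<^bsub>B\<^esub>\<delta> \<in> {\<delta> \<in> carrier \<Delta>. c \<delta> \<noteq> \<zero>\<^bsub>B\<^esub>}. c \<delta>)"
  \<comment> \<open>The grading speaks of extensional families summed over their exact support. This
    passes to that format from a family on a finite set of degrees, which may contain zero
    entries.\<close>
  have ext: "?P (\<lambda>\<delta>\<in>carrier \<Delta>. if \<delta> \<in> Y then q \<delta> else \<zero>\<^bsub>B\<^esub>)"
    if Y: "finite Y" "Y \<subseteq> carrier \<Delta>" and q: "\<And>\<gamma>. \<gamma> \<in> Y \<Longrightarrow> q \<gamma> \<in> \<A> \<gamma>"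
      and fq: "f = (\<Oplus>\<^bsub>B\<^esub>\<gamma>\<in>Y. q \<gamma>)" for Y q
  proof -
    let ?c = "\<lambda>\<delta>\<in>carrier \<Delta>. if \<delta> \<in> Y then q \<delta> else \<zero>\<^bsub>B\<^esub>"
    have sub: "{\<delta> \<in> carrier \<Delta>. ?c \<delta> \<noteq> \<zero>\<^bsub>B\<^esub>} \<subseteq> Y" by auto
    have qB: "q \<delta> \<in> carrier B" if "\<delta> \<in> Y" for \<delta>
      using component_carrier q Y(2) that by blast
    have "(\<Oplus>\<^bsub>B\<^esub>\<delta>\<in>{\<delta> \<in> carrier \<Delta>. ?c \<delta> \<noteq> \<zero>\<^bsub>B\<^esub>}. ?c \<delta>) = (\<Oplus>\<^bsub>B\<^esub>\<delta>\<in>Y. q \<delta>)"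
      using Y qB by (intro M.add.finprod_mono_neutral_cong_left Y(1) sub) auto
    with fq have "f = (\<Oplus>\<^bsub>B\<^esub>\<delta>\<in>{\<delta> \<in> carrier \<Delta>. ?c \<delta> \<noteq> \<zero>\<^bsub>B\<^esub>}. ?c \<delta>)" by (simp only:)
    moreover have "?c \<in> (\<Pi>\<^sub>E \<delta> \<in> carrier \<Delta>. \<A> \<delta>)" using q component_zero by auto
    ultimately show ?thesis using finite_subset [OF sub Y(1)] by blast
  qed
  have "f \<in> A" using component_subset \<epsilon> f by blast
  then have "\<exists>!c. ?P c" using grading by (simp add: alg_grading_def)
  then have uniq: "c = d" if "?P c" "?P d" for c d using that by blast
  have "?P (\<lambda>\<delta>\<in>carrier \<Delta>. if \<delta> \<in> X then p \<delta> else \<zero>\<^bsub>B\<^esub>)"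
    by (rule ext [OF X p eq])
  moreover have "?P (\<lambda>\<delta>\<in>carrier \<Delta>. if \<delta> \<in> {\<epsilon>} then f else \<zero>\<^bsub>B\<^esub>)"
    using component_carrier [OF \<epsilon> f] \<epsilon> f by (intro ext) auto
  ultimately have "(\<lambda>\<delta>\<in>carrier \<Delta>. if \<delta> \<in> X then p \<delta> else \<zero>\<^bsub>B\<^esub>)
    = (\<lambda>\<delta>\<in>carrier \<Delta>. if \<delta> \<in> {\<epsilon>} then f else \<zero>\<^bsub>B\<^esub>)"
    by (rule uniq)
  from fun_cong [OF this, of \<gamma>] show ?thesis using X \<gamma> by auto
qed

lemma component_unique:
  assumes "\<delta> \<in> carrier \<Delta>" "\<epsilon> \<in> carrier \<Delta>" "f \<in> \<A> \<delta>" "f \<in> \<A> \<epsilon>" "f \<noteq> \<zero>\<^bsub>B\<^esub>"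
  shows "\<delta> = \<epsilon>"
proof (rule ccontr)
  assume "\<delta> \<noteq> \<epsilon>"
  moreover have "f = (\<Oplus>\<^bsub>B\<^esub>\<gamma>\<in>{\<delta>}. f)"
    using component_carrier [OF assms(1,3)] by simp
  ultimately have "f = \<zero>\<^bsub>B\<^esub>"
    using assms by (intro sum_homogeneous [of "{\<delta>}" "\<lambda>_. f" \<epsilon> f \<delta>]) (simp_all only: singleton_iff, auto)
  with assms(5) show False ..
qed

lemma hdeg_eq: "\<delta> \<in> carrier \<Delta> \<Longrightarrow> f \<in> \<A> \<delta> \<Longrightarrow> f \<noteq> \<zero>\<^bsub>B\<^esub> \<Longrightarrow> hdeg \<Delta> \<A> f = \<delta>"
  unfolding hdeg_def by (rule the_equality) (auto intro: component_unique)

text \<open>Multiplying the decomposition of \<open>1\<close> by a non-zero homogeneous \<open>g\<close> decomposes \<open>g\<close>, so only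
  the component of degree \<open>1\<close> survives.\<close>

lemma one_component: "\<one>\<^bsub>B\<^esub> \<in> \<A> \<one>\<^bsub>\<Delta>\<^esub>"
proof -
  from grading one_in_A obtain c where c: "c \<in> (\<Pi>\<^sub>E \<delta> \<in> carrier \<Delta>. \<A> \<delta>)"
    and fin: "finite {\<delta> \<in> carrier \<Delta>. c \<delta> \<noteq> \<zero>\<^bsub>B\<^esub>}"
    and one: "\<one>\<^bsub>B\<^esub> = (\<Oplus>\<^bsub>B\<^esub>\<delta> \<in> {\<delta> \<in> carrier \<Delta>. c \<delta> \<noteq> \<zero>\<^bsub>B\<^esub>}. c \<delta>)"
    unfolding alg_grading_def by blast
  define X where "X = {\<delta> \<in> carrier \<Delta>. c \<delta> \<noteq> \<zero>\<^bsub>B\<^esub>}"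
  have cA: "c \<delta> \<in> \<A> \<delta>" "c \<delta> \<in> carrier B" if "\<delta> \<in> X" for \<delta>
    using c that component_carrier by (auto simp: X_def)
  have cB: "c \<in> X \<rightarrow> carrier B" using cA by auto
  have X: "finite X" "X \<subseteq> carrier \<Delta>" using fin by (auto simp: X_def)
  have one: "\<one>\<^bsub>B\<^esub> = (\<Oplus>\<^bsub>B\<^esub>\<delta>\<in>X. c \<delta>)" using one by (simp add: X_def)
  have "X \<noteq> {}" using one by auto
  then obtain \<epsilon> where \<epsilon>: "\<epsilon> \<in> X" by blast
  then have \<epsilon>': "\<epsilon> \<in> carrier \<Delta>" "c \<epsilon> \<noteq> \<zero>\<^bsub>B\<^esub>" by (auto simp: X_def)
  have only: "\<gamma> = \<one>\<^bsub>\<Delta>\<^esub>" if \<gamma>: "\<gamma> \<in> X" for \<gamma>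
  proof (rule ccontr)
    assume ne: "\<gamma> \<noteq> \<one>\<^bsub>\<Delta>\<^esub>"
    have \<gamma>': "\<gamma> \<in> carrier \<Delta>" "c \<gamma> \<noteq> \<zero>\<^bsub>B\<^esub>" using \<gamma> by (auto simp: X_def)
    \<comment> \<open>\<open>sum_homogeneous\<close> wants summands indexed by their own degree.
      Multiplying the part of degree \<delta> by \<open>c \<epsilon>\<close> puts it in degree
      \<epsilon>\<delta>, so the index is shifted back by the inverse of \<epsilon>.\<close>
    let ?p = "\<lambda>\<mu>. c \<epsilon> \<otimes>\<^bsub>B\<^esub> c (inv\<^bsub>\<Delta>\<^esub> \<epsilon> \<otimes>\<^bsub>\<Delta>\<^esub> \<mu>)"
    let ?m = "\<lambda>\<delta>. \<epsilon> \<otimes>\<^bsub>\<Delta>\<^esub> \<delta>"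
    have cancel: "inv\<^bsub>\<Delta>\<^esub> \<epsilon> \<otimes>\<^bsub>\<Delta>\<^esub> (\<epsilon> \<otimes>\<^bsub>\<Delta>\<^esub> \<delta>) = \<delta>" if "\<delta> \<in> X" for \<delta>
      using that X \<epsilon>' by (auto simp flip: \<Delta>.m_assoc)
    have inj: "inj_on ?m X" using cancel by (metis inj_onI)
    have "c \<epsilon> = c \<epsilon> \<otimes>\<^bsub>B\<^esub> (\<Oplus>\<^bsub>B\<^esub>\<delta>\<in>X. c \<delta>)" using cA \<epsilon> by (simp flip: one)
    also have "\<dots> = (\<Oplus>\<^bsub>B\<^esub>\<delta>\<in>X. c \<epsilon> \<otimes>\<^bsub>B\<^esub> c \<delta>)"
      by (rule finsum_rdistr [OF X(1) cA(2) [OF \<epsilon>] cB])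
    also have "\<dots> = (\<Oplus>\<^bsub>B\<^esub>\<delta>\<in>X. ?p (?m \<delta>))"
      using cancel cA \<epsilon> by (intro M.finsum_cong' refl) auto
    also have "\<dots> = (\<Oplus>\<^bsub>B\<^esub>\<mu>\<in>?m ` X. ?p \<mu>)"
      using cancel cA \<epsilon> by (intro M.finsum_reindex [symmetric] inj) auto
    finally have sum: "c \<epsilon> = (\<Oplus>\<^bsub>B\<^esub>\<mu>\<in>?m ` X. ?p \<mu>)" .
    have mem: "?p \<mu> \<in> \<A> \<mu>" if "\<mu> \<in> ?m ` X" for \<mu>
      using that cancel cA \<epsilon> \<epsilon>' X component_mult by auto
    \<comment> \<open>The degree \<epsilon>\<gamma> differs from \<epsilon>, so this part of
      \<open>c \<epsilon>\<close> must vanish; but it is the product of the non-zero elements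
      \<open>c \<epsilon>\<close> and \<open>c \<gamma>\<close> of a domain.\<close>
    have "?p (\<epsilon> \<otimes>\<^bsub>\<Delta>\<^esub> \<gamma>) = \<zero>\<^bsub>B\<^esub>"
    proof (rule sum_homogeneous [OF _ _ mem \<epsilon>'(1) cA(1) [OF \<epsilon>] sum])
      show "\<epsilon> \<otimes>\<^bsub>\<Delta>\<^esub> \<gamma> \<noteq> \<epsilon>" using ne \<epsilon>' \<gamma>' by simp
    qed (use X \<epsilon>' \<gamma> in auto)
    then show False
      using cancel [OF \<gamma>] cA [OF \<gamma>] cA [OF \<epsilon>] \<epsilon>' \<gamma>' B.integral by auto
  qed
  with \<open>X \<noteq> {}\<close> have "X = {\<one>\<^bsub>\<Delta>\<^esub>}" by blast
  then have "\<one>\<^bsub>B\<^esub> = c \<one>\<^bsub>\<Delta>\<^esub>" using one cA by simp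
  then show ?thesis using cA \<open>X = {\<one>\<^bsub>\<Delta>\<^esub>}\<close> by simp
qed

section \<open>Multiplicativity of graded initial forms\<close>

abbreviation "KD \<equiv> monoid_algebra K \<Delta>"
abbreviation "T \<equiv> gr_tensor K B v \<Delta>"
abbreviation "in_deg \<equiv> init_deg K B v \<Delta> \<A>"

sublocale MD: monoid_alg K \<Delta>
  by (intro monoid_alg.intro R_cring \<Delta>.comm_monoid_axioms)

sublocale TP: tensor_product K "gr B v" KD
  by (intro tensor_product.intro gr_algebra MD.monoid_algebra_algebra)

lemma T_cring: "cring T"
  using TP.T.is_cring by (simp add: gr_tensor_def)

sublocale T: cring T
  by (rule T_cring)

text \<open>A multiplicative submonoid of \<open>B\<close> on which degree and value are both
  meaningful, so that \<open>in_deg\<close> becomes a monoid homomorphism into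
  \<open>T\<close>.\<close>

definition nz_hom :: "'b set"
  where "nz_hom = {f \<in> carrier B. f \<noteq> \<zero>\<^bsub>B\<^esub> \<and> homogeneous \<Delta> \<A> f}"

lemma nz_homD: "f \<in> nz_hom \<Longrightarrow> f \<in> carrier B" "f \<in> nz_hom \<Longrightarrow> f \<noteq> \<zero>\<^bsub>B\<^esub>"
  by (simp_all add: nz_hom_def)

lemma nz_hom_hdeg:
  assumes "f \<in> nz_hom"
  shows "hdeg \<Delta> \<A> f \<in> carrier \<Delta>" "f \<in> \<A> (hdeg \<Delta> \<A> f)"
  using assms hdeg_eq by (auto simp: nz_hom_def homogeneous_def)

lemma nz_hom_one: "\<one>\<^bsub>B\<^esub> \<in> nz_hom"
  using one_component by (auto simp: nz_hom_def homogeneous_def)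

lemma nz_hom_mult:
  assumes "f \<in> nz_hom" "g \<in> nz_hom"
  shows "f \<otimes>\<^bsub>B\<^esub> g \<in> nz_hom" "hdeg \<Delta> \<A> (f \<otimes>\<^bsub>B\<^esub> g) = hdeg \<Delta> \<A> f \<otimes>\<^bsub>\<Delta>\<^esub> hdeg \<Delta> \<A> g"
proof -
  have ne: "f \<otimes>\<^bsub>B\<^esub> g \<noteq> \<zero>\<^bsub>B\<^esub>" using assms nz_homD B.integral by blast
  have mem: "f \<otimes>\<^bsub>B\<^esub> g \<in> \<A> (hdeg \<Delta> \<A> f \<otimes>\<^bsub>\<Delta>\<^esub> hdeg \<Delta> \<A> g)"
    using assms nz_hom_hdeg by (intro component_mult) auto
  show "f \<otimes>\<^bsub>B\<^esub> g \<in> nz_hom"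
    using ne mem assms nz_hom_hdeg(1) nz_homD(1) \<Delta>.m_closed
    unfolding nz_hom_def homogeneous_def by blast
  show "hdeg \<Delta> \<A> (f \<otimes>\<^bsub>B\<^esub> g) = hdeg \<Delta> \<A> f \<otimes>\<^bsub>\<Delta>\<^esub> hdeg \<Delta> \<A> g"
    using ne mem assms nz_hom_hdeg by (intro hdeg_eq) auto
qed

lemma single_one_closed: "\<delta> \<in> carrier \<Delta> \<Longrightarrow> single K \<one> \<delta> \<in> carrier KD"
  by (intro MD.single_closed) auto

lemma in_deg_closed: "f \<in> nz_hom \<Longrightarrow> in_deg f \<in> carrier T"
  unfolding init_deg_def gr_tensor_def
  by (intro TP.pure_tensor_closed init_form_closed single_one_closed nz_hom_hdeg nz_homD)

lemma in_deg_one: "in_deg \<one>\<^bsub>B\<^esub> = \<one>\<^bsub>T\<^esub>"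
  using hdeg_eq [OF _ one_component] TP.pure_tensor_one
  by (simp add: init_deg_def gr_tensor_def init_form_one monoid_algebra_simps(2))

lemma in_deg_mult:
  assumes "f \<in> nz_hom" "g \<in> nz_hom"
  shows "in_deg (f \<otimes>\<^bsub>B\<^esub> g) = in_deg f \<otimes>\<^bsub>T\<^esub> in_deg g"
proof -
  note D = nz_hom_hdeg [OF assms(1)] nz_hom_hdeg [OF assms(2)]
  have "single K \<one> (hdeg \<Delta> \<A> f) \<otimes>\<^bsub>KD\<^esub> single K \<one> (hdeg \<Delta> \<A> g)
    = single K \<one> (hdeg \<Delta> \<A> f \<otimes>\<^bsub>\<Delta>\<^esub> hdeg \<Delta> \<A> g)"
    using D by (subst MD.single_mult_single) auto
  then show ?thesis
    unfolding init_deg_def gr_tensor_def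
    using D assms by (subst TP.pure_tensor_mult)
      (simp_all add: nz_hom_mult init_form_mult nz_homD init_form_closed single_one_closed)
qed

lemma in_deg_pow:
  assumes "f \<in> nz_hom"
  shows "f [^]\<^bsub>B\<^esub> (n::nat) \<in> nz_hom \<and> in_deg (f [^]\<^bsub>B\<^esub> n) = in_deg f [^]\<^bsub>T\<^esub> n"
  by (induction n) (simp_all add: nz_hom_one in_deg_one in_deg_mult nz_hom_mult assms)

lemma in_deg_finprod:
  assumes "u \<in> X \<rightarrow> nz_hom"
  shows "(\<Otimes>\<^bsub>B\<^esub>i\<in>X. u i) \<in> nz_hom \<and> in_deg (\<Otimes>\<^bsub>B\<^esub>i\<in>X. u i) = (\<Otimes>\<^bsub>T\<^esub>i\<in>X. in_deg (u i))"
  using assms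
proof (induction X rule: infinite_finite_induct)
  case (insert x X)
  then have u: "u x \<in> nz_hom" "u \<in> X \<rightarrow> nz_hom" by auto
  then have "u \<in> X \<rightarrow> carrier B" "u x \<in> carrier B" using nz_homD by auto
  moreover have "(\<lambda>i. in_deg (u i)) \<in> X \<rightarrow> carrier T" using u in_deg_closed by auto
  ultimately show ?case
    using insert u by (simp add: nz_hom_mult in_deg_mult in_deg_closed)
qed (simp_all add: nz_hom_one in_deg_one)

definition mono_val :: "'b multiset \<Rightarrow> 'b"
  where "mono_val m = (\<Otimes>\<^bsub>B\<^esub>g \<in> set_mset m. g [^]\<^bsub>B\<^esub> count m g)"

lemma mono_val:
  assumes "set_mset m \<subseteq> nz_hom"
  shows "mono_val m \<in> nz_hom"
    "in_deg (mono_val m) = (\<Otimes>\<^bsub>T\<^esub>g \<in> set_mset m. in_deg g [^]\<^bsub>T\<^esub> count m g)"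
proof -
  have u: "(\<lambda>g. g [^]\<^bsub>B\<^esub> count m g) \<in> set_mset m \<rightarrow> nz_hom"
    using assms in_deg_pow by auto
  show "mono_val m \<in> nz_hom" using in_deg_finprod [OF u] by (simp add: mono_val_def)
  have "(\<Otimes>\<^bsub>T\<^esub>g \<in> set_mset m. in_deg (g [^]\<^bsub>B\<^esub> count m g))
    = (\<Otimes>\<^bsub>T\<^esub>g \<in> set_mset m. in_deg g [^]\<^bsub>T\<^esub> count m g)"
    using assms in_deg_pow in_deg_closed by (intro T.finprod_cong' refl) auto
  then show "in_deg (mono_val m) = (\<Otimes>\<^bsub>T\<^esub>g \<in> set_mset m. in_deg g [^]\<^bsub>T\<^esub> count m g)"
    using in_deg_finprod [OF u] by (simp add: mono_val_def)
qed

text \<open>At this point \<open>T\<close> is known as a ring only, so closure under scalars is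
  obtained by exhibiting the scaled pure tensor as the image of an element of the free
  module.\<close>

lemma in_deg_smult_closed:
  assumes "c \<in> carrier K" "f \<in> nz_hom"
  shows "c \<odot>\<^bsub>T\<^esub> in_deg f \<in> carrier T"
proof -
  have *: "init_form B v f \<in> carrier (gr B v)" "single K \<one> (hdeg \<Delta> \<A> f) \<in> carrier KD"
    using assms by (auto intro: init_form_closed single_one_closed nz_hom_hdeg dest: nz_homD)
  then have "TP.proj (c \<odot>\<^bsub>TP.F\<^esub> TP.e (init_form B v f) (single K \<one> (hdeg \<Delta> \<A> f))) \<in> carrier TP.T"
    using assms(1) by (intro TP.proj.hom_closed TP.F.smult_closed TP.e_closed)
  then show ?thesis
    using assms(1) * by (simp add: init_deg_def gr_tensor_def TP.pure_tensor_eq TP.proj_smult TP.e_closed)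
qed

text \<open>Reading off the coefficient of \<open>\<delta>\<close> in the second factor turns a relation between graded
  initial forms of equal degree \<open>\<delta>\<close> into one in \<open>gr B v\<close>.\<close>

lemma cancel_initial_form:
  assumes X: "finite X" and c: "c \<in> X \<rightarrow> carrier K" and p: "p \<in> X \<rightarrow> nz_hom"
    and r: "r \<in> nz_hom" and deg: "\<And>m. m \<in> X \<Longrightarrow> hdeg \<Delta> \<A> (p m) = hdeg \<Delta> \<A> r"
    and le: "\<And>m. m \<in> X \<Longrightarrow> v r \<le> v (p m)"
    and eq: "(\<Oplus>\<^bsub>T\<^esub>m\<in>X. c m \<odot>\<^bsub>T\<^esub> in_deg (p m)) = in_deg r"
  shows "r \<ominus>\<^bsub>B\<^esub> (\<Oplus>\<^bsub>B\<^esub>m\<in>X. c m \<odot>\<^bsub>B\<^esub> p m) \<in> filt_gt B v (v r)"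
proof -
  let ?\<delta> = "hdeg \<Delta> \<A> r"
  interpret bilinear_form K "gr B v" KD "gr B v" "\<lambda>x y. y ?\<delta> \<odot>\<^bsub>gr B v\<^esub> x"
  proof unfold_locales
    fix c x y assume *: "c \<in> carrier K" "x \<in> carrier (gr B v)" "y \<in> carrier KD"
    then have y: "y ?\<delta> \<in> carrier K" using MD.mem_carrierD(1) by blast
    with * show "y ?\<delta> \<odot>\<^bsub>gr B v\<^esub> (c \<odot>\<^bsub>gr B v\<^esub> x) = c \<odot>\<^bsub>gr B v\<^esub> (y ?\<delta> \<odot>\<^bsub>gr B v\<^esub> x)"
      by (simp add: R.m_comm flip: TP.R.smult_assoc1)
    from * y show "(c \<odot>\<^bsub>KD\<^esub> y) ?\<delta> \<odot>\<^bsub>gr B v\<^esub> x = c \<odot>\<^bsub>gr B v\<^esub> (y ?\<delta> \<odot>\<^bsub>gr B v\<^esub> x)"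
      by (simp add: monoid_algebra_simps TP.R.smult_assoc1)
  qed (auto simp: MD.mem_carrierD(1) TP.R.smult_r_distr TP.R.smult_l_distr monoid_algebra_simps(4))
  have closed: "init_form B v (p m) \<in> carrier (gr B v)" if "m \<in> X" for m
    using p that by (auto intro!: init_form_closed dest: nz_homD)
  have \<delta>: "single K \<one> ?\<delta> \<in> carrier KD"
    using r nz_hom_hdeg by (intro single_one_closed)
  \<comment> \<open>All terms share the degree \<delta>, so every second tensor factor is the basis
    element of \<delta>. Its coefficient at \<delta> is 1, and the bilinear map returns each initial
    form unchanged.\<close>
  have "(\<Oplus>\<^bsub>T\<^esub>m\<in>X. c m \<odot>\<^bsub>T\<^esub> pure_tensor K (gr B v) KD (init_form B v (p m)) (single K \<one> ?\<delta>))
    = (\<Oplus>\<^bsub>T\<^esub>m\<in>X. c m \<odot>\<^bsub>T\<^esub> in_deg (p m))"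
  proof (intro T.finsum_cong' refl funcsetI)
    fix m assume m: "m \<in> X"
    then show "c m \<odot>\<^bsub>T\<^esub> pure_tensor K (gr B v) KD (init_form B v (p m)) (single K \<one> ?\<delta>)
      = c m \<odot>\<^bsub>T\<^esub> in_deg (p m)" using deg by (simp add: init_deg_def)
    show "c m \<odot>\<^bsub>T\<^esub> in_deg (p m) \<in> carrier T" using m c p in_deg_smult_closed by auto
  qed
  also have "\<dots> = pure_tensor K (gr B v) KD (init_form B v r) (single K \<one> ?\<delta>)"
    using eq by (simp add: init_deg_def)
  finally have "(\<Oplus>\<^bsub>gr B v\<^esub>m\<in>X. c m \<odot>\<^bsub>gr B v\<^esub> (single K \<one> ?\<delta> ?\<delta> \<odot>\<^bsub>gr B v\<^esub> init_form B v (p m)))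
    = single K \<one> ?\<delta> ?\<delta> \<odot>\<^bsub>gr B v\<^esub> init_form B v r"
    using X c closed \<delta> r nz_homD init_form_closed
    by (intro form_transfer) (auto simp: gr_tensor_def)
  moreover have "(\<Oplus>\<^bsub>gr B v\<^esub>m\<in>X. c m \<odot>\<^bsub>gr B v\<^esub> (single K \<one> ?\<delta> ?\<delta> \<odot>\<^bsub>gr B v\<^esub> init_form B v (p m)))
    = (\<Oplus>\<^bsub>gr B v\<^esub>m\<in>X. c m \<odot>\<^bsub>gr B v\<^esub> init_form B v (p m))"
    using c closed by (intro TP.R.M.finsum_cong' refl) (auto simp: single_def intro!: TP.R.smult_closed)
  moreover have "single K \<one> ?\<delta> ?\<delta> \<odot>\<^bsub>gr B v\<^esub> init_form B v r = init_form B v r"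
    using r by (simp add: single_def init_form_closed nz_homD)
  ultimately show ?thesis
    using X c p r le nz_homD by (intro lift_init_form_relation) (auto simp: Pi_iff)
qed

end

section \<open>Subduction\<close>

lemma (in cring) add_diff_add_cancel:
  "x \<in> carrier R \<Longrightarrow> y \<in> carrier R \<Longrightarrow> z \<in> carrier R \<Longrightarrow> x \<oplus> y \<oplus> (z \<ominus> y) = x \<oplus> z"
  by algebra

lemma monomials_comm_monoid: "comm_monoid (monomials G)"
  by (rule comm_monoidI) (auto simp: monomials_def add_ac)

lemma mpoly_ring_mono: "F \<subseteq> G \<Longrightarrow> carrier (mpoly_ring K F) \<subseteq> carrier (mpoly_ring K G)"
  by (auto simp: mpoly_ring_def monoid_algebra_simps monomials_def)

lemma mpoly_ring_add_zero:
  "a \<oplus>\<^bsub>mpoly_ring K G\<^esub> b = (\<lambda>m. a m \<oplus>\<^bsub>K\<^esub> b m)" "\<zero>\<^bsub>mpoly_ring K G\<^esub> = (\<lambda>m. \<zero>\<^bsub>K\<^esub>)"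
  by (simp_all add: mpoly_ring_def monoid_algebra_simps)

context graded_valued_algebra
begin

section \<open>Polynomial evaluation and the subduction loop\<close>

abbreviation "poly_val \<equiv> mpoly_eval K B (\<lambda>g. g)"

lemma eval_eq_lin_ext: "poly_val = lin_ext K B mono_val"
  by (simp add: fun_eq_iff mpoly_eval_def lin_ext_def mono_val_def)

lemma mpolyD:
  assumes "h \<in> carrier (mpoly_ring K G)"
  shows "h m \<in> carrier K" "finite {m. h m \<noteq> \<zero>}" "h m \<noteq> \<zero> \<Longrightarrow> set_mset m \<subseteq> G"
  using assms by (auto simp: mpoly_ring_def monoid_algebra_simps monomials_def)

lemma lin_extension_monomials: "lin_extension K (monomials G) B"
  by (intro lin_extension.intro module_axioms monomials_comm_monoid)

lemma mono_val_funcset: "G \<subseteq> nz_hom \<Longrightarrow> mono_val \<in> carrier (monomials G) \<rightarrow> carrier B"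
  using mono_val(1) nz_homD(1) by (fastforce simp: monomials_def)

lemma eval_add:
  assumes "G \<subseteq> nz_hom" "h \<in> carrier (mpoly_ring K G)" "h' \<in> carrier (mpoly_ring K G)"
  shows "poly_val (h \<oplus>\<^bsub>mpoly_ring K G\<^esub> h') = poly_val h \<oplus>\<^bsub>B\<^esub> poly_val h'"
proof -
  interpret L: lin_extension K "monomials G" B by (rule lin_extension_monomials)
  show ?thesis
    using assms L.lin_ext_add mono_val_funcset by (simp add: eval_eq_lin_ext mpoly_ring_def)
qed

lemma mpoly_add_closed:
  assumes "h \<in> carrier (mpoly_ring K G)" "h' \<in> carrier (mpoly_ring K G)"
  shows "h \<oplus>\<^bsub>mpoly_ring K G\<^esub> h' \<in> carrier (mpoly_ring K G)"
proof -
  interpret L: lin_extension K "monomials G" B by (rule lin_extension_monomials)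
  show ?thesis using L.add_closed assms by (simp add: mpoly_ring_def)
qed

lemma eval_closed:
  assumes "G \<subseteq> nz_hom" "h \<in> carrier (mpoly_ring K G)"
  shows "poly_val h \<in> carrier B"
proof -
  interpret L: lin_extension K "monomials G" B by (rule lin_extension_monomials)
  show ?thesis
    using assms L.lin_ext_closed mono_val_funcset by (simp add: eval_eq_lin_ext mpoly_ring_def)
qed

lemma eval_single:
  assumes "c \<in> carrier K" "set_mset m \<subseteq> nz_hom"
  shows "poly_val (single K c m) = c \<odot>\<^bsub>B\<^esub> mono_val m"
proof -
  interpret L: lin_extension K "monomials (set_mset m)" B by (rule lin_extension_monomials)
  show ?thesis
    unfolding eval_eq_lin_ext using assms mono_val_funcset [OF assms(2)]
    by (intro L.lin_ext_single) (auto simp: monomials_def)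
qed

text \<open>A non-zero scalar changes neither value nor degree, so the requirements on terms depend
  only on their monomials. This matters because coefficients change as polynomials are
  added.\<close>

lemma term_value:
  assumes "c \<in> carrier K" "c \<noteq> \<zero>" "set_mset m \<subseteq> nz_hom"
  shows "xval B v (poly_val (single K c m)) = Fin (v (mono_val m))"
    "hdeg \<Delta> \<A> (poly_val (single K c m)) = hdeg \<Delta> \<A> (mono_val m)"
proof -
  note p = mono_val(1) [OF assms(3)]
  have ne: "c \<odot>\<^bsub>B\<^esub> mono_val m \<noteq> \<zero>\<^bsub>B\<^esub>"
    using smult_eq_zero assms p nz_homD by blast
  then show "xval B v (poly_val (single K c m)) = Fin (v (mono_val m))"
    using assms p by (simp add: eval_single xval_def v_smult nz_homD)
  show "hdeg \<Delta> \<A> (poly_val (single K c m)) = hdeg \<Delta> \<A> (mono_val m)"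
    using assms p ne nz_hom_hdeg [OF p] by (simp add: eval_single hdeg_eq component_smult)
qed

lemma eval_in_deg:
  assumes "G \<subseteq> nz_hom" "h \<in> carrier (mpoly_ring K G)"
  shows "mpoly_eval K T in_deg h = (\<Oplus>\<^bsub>T\<^esub>m \<in> {m. h m \<noteq> \<zero>}. h m \<odot>\<^bsub>T\<^esub> in_deg (mono_val m))"
  unfolding mpoly_eval_def
proof (intro T.finsum_cong' refl funcsetI)
  fix m assume "m \<in> {m. h m \<noteq> \<zero>}"
  then have m: "set_mset m \<subseteq> nz_hom" using assms mpolyD(3) by blast
  show "h m \<odot>\<^bsub>T\<^esub> (\<Otimes>\<^bsub>T\<^esub>g \<in> set_mset m. in_deg g [^]\<^bsub>T\<^esub> count m g)
    = h m \<odot>\<^bsub>T\<^esub> in_deg (mono_val m)" using mono_val(2) [OF m] by simp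
  show "h m \<odot>\<^bsub>T\<^esub> in_deg (mono_val m) \<in> carrier T"
    by (intro in_deg_smult_closed mpolyD(1) [OF assms(2)] mono_val(1) m)
qed

text \<open>The new remainder may be 0. Membership in the component then still makes sense where a
  degree would not, and the strict inequality holds with the value \<infinity>.\<close>

lemma subduction_step_remainder:
  assumes G: "G \<subseteq> nz_hom" and r: "r \<in> nz_hom" and h: "h \<in> carrier (mpoly_ring K G)"
    and eq: "mpoly_eval K T in_deg h = in_deg r"
    and deg: "\<And>m. h m \<noteq> \<zero> \<Longrightarrow> hdeg \<Delta> \<A> (mono_val m) = hdeg \<Delta> \<A> r"
    and le: "\<And>m. h m \<noteq> \<zero> \<Longrightarrow> v r \<le> v (mono_val m)"
  shows "r \<ominus>\<^bsub>B\<^esub> poly_val h \<in> \<A> (hdeg \<Delta> \<A> r)" "xval B v r < xval B v (r \<ominus>\<^bsub>B\<^esub> poly_val h)"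
proof -
  let ?X = "{m. h m \<noteq> \<zero>}"
  have p: "mono_val m \<in> nz_hom" if "m \<in> ?X" for m
    using that mpolyD(3) [OF h] G mono_val(1) by blast
  have eval: "poly_val h = (\<Oplus>\<^bsub>B\<^esub>m\<in>?X. h m \<odot>\<^bsub>B\<^esub> mono_val m)"
    by (simp add: eval_eq_lin_ext lin_ext_def)
  have "h m \<odot>\<^bsub>B\<^esub> mono_val m \<in> \<A> (hdeg \<Delta> \<A> r)" if "m \<in> ?X" for m
    using that nz_hom_hdeg(2) [OF p [OF that]] deg mpolyD(1) [OF h] nz_hom_hdeg [OF r]
    by (simp add: component_smult)
  then show "r \<ominus>\<^bsub>B\<^esub> poly_val h \<in> \<A> (hdeg \<Delta> \<A> r)"
    unfolding eval using nz_hom_hdeg [OF r]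
    by (intro component_minus component_finsum) auto
  have "r \<ominus>\<^bsub>B\<^esub> poly_val h \<in> filt_gt B v (v r)"
    unfolding eval using p mpolyD [OF h] r deg le eq eval_in_deg [OF G h]
    by (intro cancel_initial_form) auto
  then show "xval B v r < xval B v (r \<ominus>\<^bsub>B\<^esub> poly_val h)"
    using nz_homD [OF r] by (auto simp: xval_def mem_filt_gt)
qed

text \<open>The degree is a fixed \<delta> since \<open>hdeg\<close> says nothing useful about 0,
  and \<open>f\<close> or \<open>r\<close> may be 0. Conditions are imposed on monomials rather than
  terms, as coefficients may change. The weak inequality between the values of \<open>f\<close> and
  \<open>r\<close> holds from the start; it makes the strict one available after a step.\<close>

definition subduction_invariant ::
    "'d \<Rightarrow> 'b \<Rightarrow> 'b set \<Rightarrow> 'b set \<times> ('b multiset \<Rightarrow> 'k) \<times> 'b \<Rightarrow> bool"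
  where "subduction_invariant \<delta> f G = (\<lambda>(G', h, r).
    finite G' \<and> G' \<subseteq> G \<and> h \<in> carrier (mpoly_ring K G') \<and> r \<in> \<A> \<delta> \<and>
    f = poly_val h \<oplus>\<^bsub>B\<^esub> r \<and>
    (\<forall>m. h m \<noteq> \<zero> \<longrightarrow> xval B v f \<le> Fin (v (mono_val m)) \<and> hdeg \<Delta> \<A> (mono_val m) = \<delta>) \<and>
    xval B v f \<le> xval B v r \<and> (h = (\<lambda>m. \<zero>) \<or> xval B v f < xval B v r))"

lemma subduction_invariant_init:
  assumes "\<delta> \<in> carrier \<Delta>" "f \<in> \<A> \<delta>"
  shows "subduction_invariant \<delta> f G ({}, \<zero>\<^bsub>mpoly_ring K G\<^esub>, f)"
  using assms component_carrier [OF assms]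
  by (auto simp: subduction_invariant_def mpoly_ring_add_zero eval_eq_lin_ext lin_ext_def
      mpoly_ring_def monoid_algebra_simps)

lemma subduction_invariant_step:
  assumes G: "G \<subseteq> nz_hom" and \<delta>: "\<delta> \<in> carrier \<Delta>"
    and inv: "subduction_invariant \<delta> f G s" and step: "subduction_step K B v \<Delta> \<A> G s s'"
  shows "subduction_invariant \<delta> f G s'"
  using step
proof cases
  case (1 r F h' G' h)
  have G': "finite G'" "G' \<subseteq> G" and h: "h \<in> carrier (mpoly_ring K G')" and r: "r \<in> \<A> \<delta>"
    and f: "f = poly_val h \<oplus>\<^bsub>B\<^esub> r"
    and terms: "\<And>m. h m \<noteq> \<zero> \<Longrightarrow> xval B v f \<le> Fin (v (mono_val m)) \<and> hdeg \<Delta> \<A> (mono_val m) = \<delta>"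
    and fr: "xval B v f \<le> xval B v r"
    using inv by (auto simp: subduction_invariant_def 1)
  have "r \<noteq> \<zero>\<^bsub>B\<^esub>" using 1 by (simp add: subduction_guard_def)
  then have r': "r \<in> nz_hom" and hdeg: "hdeg \<Delta> \<A> r = \<delta>"
    using r \<delta> component_carrier hdeg_eq by (auto simp: nz_hom_def homogeneous_def)
  have F: "F \<subseteq> nz_hom" using 1 G by blast
  \<comment> \<open>The algorithm constrains the terms of \<open>h'\<close>; dropping the non-zero
    coefficients gives the same constraints on its monomials.\<close>
  have new: "hdeg \<Delta> \<A> (mono_val m) = \<delta>" "Fin (v r) \<le> Fin (v (mono_val m))" if m: "h' m \<noteq> \<zero>" for m
  proof -
    have "single K (h' m) m \<in> Supp K h'" using m by (auto simp: Supp_def)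
    then have "xval B v r \<le> xval B v (poly_val (single K (h' m) m))"
      "hdeg \<Delta> \<A> (poly_val (single K (h' m) m)) = hdeg \<Delta> \<A> r" using 1 by auto
    moreover have "set_mset m \<subseteq> nz_hom" "h' m \<in> carrier K"
      using F m mpolyD [OF \<open>h' \<in> carrier (mpoly_ring K F)\<close>] by auto
    ultimately show "hdeg \<Delta> \<A> (mono_val m) = \<delta>" "Fin (v r) \<le> Fin (v (mono_val m))"
      using m hdeg \<open>r \<noteq> \<zero>\<^bsub>B\<^esub>\<close> by (simp_all add: term_value xval_def [of _ _ r])
  qed
  have rem: "r \<ominus>\<^bsub>B\<^esub> poly_val h' \<in> \<A> \<delta>" "xval B v r < xval B v (r \<ominus>\<^bsub>B\<^esub> poly_val h')"
    using subduction_step_remainder [OF F r' \<open>h' \<in> carrier (mpoly_ring K F)\<close>] 1 new hdeg by auto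
  have GF: "G' \<union> F \<subseteq> nz_hom" using G G' F by blast
  have hh: "h \<in> carrier (mpoly_ring K (G' \<union> F))" "h' \<in> carrier (mpoly_ring K (G' \<union> F))"
    using mpoly_ring_mono [of G' "G' \<union> F" K] mpoly_ring_mono [of F "G' \<union> F" K] h 1 by auto
  \<comment> \<open>The loop adds polynomials in all variables of \<open>G\<close>, the invariant in
    those used so far; addition is pointwise in either ring.\<close>
  have sum: "h \<oplus>\<^bsub>mpoly_ring K G\<^esub> h' = h \<oplus>\<^bsub>mpoly_ring K (G' \<union> F)\<^esub> h'"
    by (simp add: mpoly_ring_add_zero)
  have "poly_val (h \<oplus>\<^bsub>mpoly_ring K G\<^esub> h') \<oplus>\<^bsub>B\<^esub> (r \<ominus>\<^bsub>B\<^esub> poly_val h') = (poly_val h \<oplus>\<^bsub>B\<^esub> poly_val h') \<oplus>\<^bsub>B\<^esub> (r \<ominus>\<^bsub>B\<^esub> poly_val h')"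
    using eval_add [OF GF hh] sum by simp
  also have "\<dots> = poly_val h \<oplus>\<^bsub>B\<^esub> r"
    by (intro cring.add_diff_add_cancel [OF M_cring] eval_closed [OF GF] hh nz_homD(1) [OF r'])
  finally have f': "f = poly_val (h \<oplus>\<^bsub>mpoly_ring K G\<^esub> h') \<oplus>\<^bsub>B\<^esub> (r \<ominus>\<^bsub>B\<^esub> poly_val h')" using f by simp
  \<comment> \<open>Cancellation can only remove monomials: each one left occurs in \<open>h\<close>
    or in \<open>h'\<close>. In the second case its value is bounded below by that of
    \<open>r\<close>, hence by that of \<open>f\<close>.\<close>
  have terms': "xval B v f \<le> Fin (v (mono_val m)) \<and> hdeg \<Delta> \<A> (mono_val m) = \<delta>"
    if "(h \<oplus>\<^bsub>mpoly_ring K G\<^esub> h') m \<noteq> \<zero>" for m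
  proof (cases "h m = \<zero>")
    case True
    then have "h' m \<noteq> \<zero>" using that by (auto simp: mpoly_ring_add_zero)
    then show ?thesis using new [of m] fr \<open>r \<noteq> \<zero>\<^bsub>B\<^esub>\<close>
      by (auto simp: xval_def [of _ _ r] simp del: less_eq_extended.simps intro: order_trans)
  qed (use terms in blast)
  show ?thesis
    unfolding 1 subduction_invariant_def
    using G' 1 mpoly_add_closed [OF hh] sum rem f' terms' fr by auto
qed

lemma subduction_output_invariant:
  assumes "G \<subseteq> nz_hom" "\<delta> \<in> carrier \<Delta>" "f \<in> \<A> \<delta>"
    and "subduction_output K B v \<Delta> \<A> f G G' h r"
  shows "subduction_invariant \<delta> f G (G', h, r)"
proof -
  have "(subduction_step K B v \<Delta> \<A> G)\<^sup>*\<^sup>* ({}, \<zero>\<^bsub>mpoly_ring K G\<^esub>, f) (G', h, r)"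
    using assms by (simp add: subduction_output_def)
  then show ?thesis
    by (induction rule: rtranclp_induct)
      (use subduction_invariant_init subduction_invariant_step assms in blast)+
qed

end

theorem proposition2p11:
  fixes K :: "('k, 'm) ring_scheme" and B :: "('k, 'b, 'n) module_scheme" and A :: "'b set"
    and v :: "'b \<Rightarrow> 'g::linordered_ab_group_add"
    and \<Delta> :: "('d, 'p) monoid_scheme" and \<A> :: "'d \<Rightarrow> 'b set"
    and f r :: 'b and G G' :: "'b set" and h :: "'b multiset \<Rightarrow> 'k"
  assumes "field K"
    and "algebra K B" and "domain B" and "fin_gen_alg K B (carrier B)"
    and "subalg K B A" and "fin_gen_alg K B A"
    and "valuation_over K B v"
    and "comm_group \<Delta>" and "fin_gen_group \<Delta>" and "alg_grading K B A \<Delta> \<A>"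
    and "f \<in> A" and "homogeneous \<Delta> \<A> f"
    and "G \<subseteq> A" and "\<forall>g \<in> G. g \<noteq> \<zero>\<^bsub>B\<^esub> \<and> homogeneous \<Delta> \<A> g"
    and "subduction_output K B v \<Delta> \<A> f G G' h r"
  shows "finite G' \<and> G' \<subseteq> G \<and> h \<in> carrier (mpoly_ring K G') \<and> r \<in> A \<and>
    f = mpoly_eval K B (\<lambda>g. g) h \<oplus>\<^bsub>B\<^esub> r \<and>
    (\<forall>t \<in> Supp K h. xval B v f \<le> xval B v (mpoly_eval K B (\<lambda>g. g) t)
       \<and> hdeg \<Delta> \<A> (mpoly_eval K B (\<lambda>g. g) t) = hdeg \<Delta> \<A> f) \<and>
    (h = \<zero>\<^bsub>mpoly_ring K G'\<^esub> \<or> xval B v f < xval B v r) \<and>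
    (r = \<zero>\<^bsub>B\<^esub> \<or> homogeneous \<Delta> \<A> r \<and> hdeg \<Delta> \<A> r = hdeg \<Delta> \<A> f) \<and>
    (r = \<zero>\<^bsub>B\<^esub> \<or> init_deg K B v \<Delta> \<A> r \<notin> init_alg K B v \<Delta> \<A> G)"
proof -
  interpret graded_valued_algebra K B v \<Delta> A \<A>
    using assms by (intro graded_valued_algebra.intro valued_algebra.intro
        graded_valued_algebra_axioms.intro valued_algebra_axioms.intro)
  have A: "A \<subseteq> carrier B" using \<open>subalg K B A\<close> subringE(1) by (auto simp: subalg_def)
  then have G: "G \<subseteq> nz_hom" using \<open>G \<subseteq> A\<close> assms(14) by (auto simp: nz_hom_def)
  obtain \<delta> where \<delta>: "\<delta> \<in> carrier \<Delta>" "f \<in> \<A> \<delta>"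
    using \<open>homogeneous \<Delta> \<A> f\<close> by (auto simp: homogeneous_def)
  have inv: "finite G'" "G' \<subseteq> G" "h \<in> carrier (mpoly_ring K G')" "r \<in> \<A> \<delta>"
    "f = poly_val h \<oplus>\<^bsub>B\<^esub> r"
    "\<And>m. h m \<noteq> \<zero>\<^bsub>K\<^esub> \<Longrightarrow> xval B v f \<le> Fin (v (mono_val m)) \<and> hdeg \<Delta> \<A> (mono_val m) = \<delta>"
    "h = (\<lambda>m. \<zero>\<^bsub>K\<^esub>) \<or> xval B v f < xval B v r" "xval B v f \<le> xval B v r"
    using subduction_output_invariant [OF G \<delta> assms(15)]
    by (auto simp: subduction_invariant_def)
  have hdeg: "hdeg \<Delta> \<A> f = \<delta>" if "f \<noteq> \<zero>\<^bsub>B\<^esub>" using \<delta> that by (rule hdeg_eq)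
  have "xval B v f \<le> xval B v (poly_val t) \<and> hdeg \<Delta> \<A> (poly_val t) = hdeg \<Delta> \<A> f" if t: "t \<in> Supp K h" for t
  proof -
    obtain m where m: "t = single K (h m) m" "h m \<noteq> \<zero>\<^bsub>K\<^esub>" using t by (auto simp: Supp_def)
    have "set_mset m \<subseteq> nz_hom" "h m \<in> carrier K" using mpolyD [OF inv(3)] m G inv(2) by blast+
    \<comment> \<open>If \<open>h\<close> has a term, its finite value bounds that of
      \<open>f\<close>, so \<open>f\<close> is not 0 and its degree is \<delta>.\<close>
    moreover have "f \<noteq> \<zero>\<^bsub>B\<^esub>" using inv(6) [OF m(2)] by (auto simp: xval_def)
    ultimately show ?thesis using inv(6) [OF m(2)] m hdeg by (simp add: term_value)
  qed
  moreover have "r \<in> A" using inv(4) component_subset \<delta> by blast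
  moreover have "homogeneous \<Delta> \<A> r \<and> hdeg \<Delta> \<A> r = hdeg \<Delta> \<A> f" if r: "r \<noteq> \<zero>\<^bsub>B\<^esub>"
  proof -
    \<comment> \<open>If \<open>f\<close> were 0, its value \<infinity> would be at most the finite
      value of \<open>r\<close>.\<close>
    have "f \<noteq> \<zero>\<^bsub>B\<^esub>" using r inv(8) by (auto simp: xval_def)
    then show ?thesis using r inv(4) \<delta> hdeg hdeg_eq by (auto simp: homogeneous_def)
  qed
  moreover have "r = \<zero>\<^bsub>B\<^esub> \<or> init_deg K B v \<Delta> \<A> r \<notin> init_alg K B v \<Delta> \<A> G"
    using assms(15) by (simp add: subduction_output_def subduction_guard_def)
  ultimately show ?thesis using inv(1-3,5,7) unfolding mpoly_ring_add_zero by blast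
qed

end
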